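(* Let $G$ be $\mathrm{Path}(\mathbf{k})$ or $\mathrm{Cycle}(\mathbf{k})$ with the lab framing, and let $P$ be its $\mathbf{g}$-polytope. The DKK triangulation of $P$ is a pulling triangulation.
   Context: DAGs. All DAGs are finite acyclic directed multigraphs with one source $s$ and one sink $t$; inner vertices are the other vertices; a DAG is full if every inner vertex has indegree and outdegree $2$. The inner graph is the subgraph induced by inner vertices; an inner route is a maximal directed path in it. A route is a directed path from $s$ to $t$. $\mathrm{Path}(\mathbf{k})$, $\mathbf{k}=(k_1,\dots,k_r)$ a sequence of positive integers, $r\ge1$: the full DAG with inner vertices $1,\dots,n$, $n=k_1+\cdots+k_r+1$, with one inner edge between $i$ and $i+1$ for each $i<n$; the first $k_1$ inner edges are directed $i\to i+1$, the next $k_2$ are directed $i+1\to i$, and so on alternating. Edges from $s$ and to $t$ (possibly parallel pairs) are added to make it full; there is no edge $s\to t$. $\mathrm{Cycle}(\mathbf{k})$, $r$ even: same, with $n=k_1+\cdots+k_r$ inner vertices and inner edges between $i$ and $i+1$ modulo $n$. Lab framing: edges are labeled by $\{1,2\}$; inner edges of odd-numbered inner routes (first, third, ...) get label $2$, those of even-numbered inner routes get label $1$, and source and sink edges are labeled so that at each inner vertex the two incoming edges have distinct labels and the two outgoing edges have distinct labels. Coherence: let $[u,v]$ be a maximal common subpath of routes $R,S$ with $u,v$ inner vertices (possibly $u=v$), so they enter $u$ by distinct edges and leave $v$ by distinct edges. They are in conflict at $[u,v]$ if the one entering $u$ by the smaller label leaves $v$ by the larger label. $R,S$ are coherent if they are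 in conflict at no such $[u,v]$. A clique is a set of pairwise coherent routes. $\mathbf{g}$-polytope: $\mathbf{g}(R)=(a_v)_v\in\mathbb{Z}^n$ with $a_v=-1$ if $R$ enters $v$ with label $1$ and leaves with label $2$, $a_v=1$ if it enters with label $2$ and leaves with label $1$, and $a_v=0$ otherwise. $P$ is the convex hull of all $\mathbf{g}(R)$. The DKK triangulation of $P$ is the (unimodular) triangulation whose maximal simplices are $\mathrm{conv}\{\mathbf{g}(R):R\in M\}$, $M$ a maximal clique. Pulling: a subdivision of a $d$-dimensional polytope $P$ is a finite collection of $d$-dimensional polytopes (cells) with union $P$, any two meeting in a common (possibly empty) proper face. For a subdivision $\mathcal{S}$ and $x\in P$, $\mathrm{pull}(\mathcal{S};x)$ is obtained by keeping each cell not containing $x$ and replacing each cell $S\ni x$ by the polytopes $\mathrm{conv}(F,x)$ for all facets $F$ of $S$ not containing $x$. A pulling triangulation of $P$ is a triangulation obtained from $\{P\}$ by successively pulling at the points of some finite sequence $x^1,\dots,x^m\in P$. *)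

theory Defs
  imports "HOL-Analysis.Analysis" "Graph_Theory.Graph_Theory"
begin

subsection \<open>Full DAGs\<close>

datatype dag_vertex = Source | Sink | Inner nat

text \<open>
  \<open>Inner_Edge i\<close> is the inner edge between the \<open>i\<close>-th inner vertex and its successor.
  \<open>Source_Edge v c\<close> is an edge from the source to the inner vertex \<open>v\<close> and
  \<open>Sink_Edge v c\<close> an edge from \<open>v\<close> to the sink; \<open>c\<close> only distinguishes parallel edges.
\<close>

datatype dag_edge = Inner_Edge nat | Source_Edge nat nat | Sink_Edge nat nat

type_synonym dag = "(dag_vertex, dag_edge) pre_digraph"

text \<open>
  The DAG with inner vertices \<open>1..n\<close> and inner edges \<open>1..m\<close>, where the inner edge \<open>i\<close> is
  directed \<open>tail_of i \<rightarrow> head_of i\<close>, completed by the missing source and sink edges (see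
  \<open>make_full_in_degree\<close> and \<open>make_full_out_degree\<close> below).
\<close>

definition make_full :: "nat \<Rightarrow> nat \<Rightarrow> (nat \<Rightarrow> nat) \<Rightarrow> (nat \<Rightarrow> nat) \<Rightarrow> dag" where
  "make_full n m tail_of head_of =
    \<lparr> verts = {Source, Sink} \<union> Inner ` {1..n},
      arcs = Inner_Edge ` {1..m}
        \<union> {Source_Edge v c | v c. v \<in> {1..n} \<and> c < 2 - card {i \<in> {1..m}. head_of i = v}}
        \<union> {Sink_Edge v c | v c. v \<in> {1..n} \<and> c < 2 - card {i \<in> {1..m}. tail_of i = v}},
      tail = (\<lambda>a. case a of Inner_Edge i \<Rightarrow> Inner (tail_of i) | Source_Edge v c \<Rightarrow> Source
                | Sink_Edge v c \<Rightarrow> Inner v),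
      head = (\<lambda>a. case a of Inner_Edge i \<Rightarrow> Inner (head_of i) | Source_Edge v c \<Rightarrow> Inner v
                | Sink_Edge v c \<Rightarrow> Sink) \<rparr>"

text \<open>
  For \<open>ks = [k\<^sub>1, \<dots>, k\<^sub>r]\<close> and \<open>1 \<le> i \<le> k\<^sub>1 + \<dots> + k\<^sub>r\<close>, the number \<open>j \<in> {1..r}\<close> such that the
  inner edge \<open>i\<close> is one of the \<open>k\<^sub>j\<close> edges of the \<open>j\<close>-th group.
\<close>

definition group_no :: "nat list \<Rightarrow> nat \<Rightarrow> nat" where
  "group_no ks i = (LEAST j. i \<le> sum_list (take j ks))"

definition alternating_tail :: "nat list \<Rightarrow> (nat \<Rightarrow> nat) \<Rightarrow> nat \<Rightarrow> nat" where
  "alternating_tail ks nxt i = (if odd (group_no ks i) then i else nxt i)"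

definition alternating_head :: "nat list \<Rightarrow> (nat \<Rightarrow> nat) \<Rightarrow> nat \<Rightarrow> nat" where
  "alternating_head ks nxt i = (if odd (group_no ks i) then nxt i else i)"

definition Path_dag :: "nat list \<Rightarrow> dag" where
  "Path_dag ks = make_full (sum_list ks + 1) (sum_list ks)
     (alternating_tail ks (\<lambda>i. i + 1)) (alternating_head ks (\<lambda>i. i + 1))"

text \<open>In \<open>Cycle_dag\<close> the inner vertices are \<open>1..n\<close>, so the successor of \<open>n\<close> is \<open>1\<close>.\<close>

definition Cycle_dag :: "nat list \<Rightarrow> dag" where
  "Cycle_dag ks = (let n = sum_list ks; nxt = (\<lambda>i. if i = n then 1 else i + 1) in
     make_full n n (alternating_tail ks nxt) (alternating_head ks nxt))"

definition inner_verts :: "dag \<Rightarrow> dag_vertex set" where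
  "inner_verts G = verts G - {Source, Sink}"

definition inner_graph :: "dag \<Rightarrow> dag" where
  "inner_graph G = G \<restriction> inner_verts G"

definition routes :: "dag \<Rightarrow> dag_edge awalk set" where
  "routes G = {p. pre_digraph.apath G Source p Sink}"

definition inner_routes :: "dag \<Rightarrow> dag_edge awalk set" where
  "inner_routes G = {p. (\<exists>u v. pre_digraph.apath (inner_graph G) u p v) \<and>
     (\<forall>ps qs. (\<exists>u v. pre_digraph.apath (inner_graph G) u (ps @ p @ qs) v) \<longrightarrow> ps = [] \<and> qs = [])}"


subsection \<open>The lab framing\<close>

text \<open>
  Inner routes are numbered from 1 in the order in which they occur along the underlying
  path or cycle, i.e. by the smallest index of their edges.
\<close>

definition first_index :: "dag_edge awalk \<Rightarrow> nat" where
  "first_index p = Min {i. Inner_Edge i \<in> set p}"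

definition inner_route_no :: "dag \<Rightarrow> dag_edge awalk \<Rightarrow> nat" where
  "inner_route_no G p = card {q \<in> inner_routes G. first_index q \<le> first_index p}"

definition lab_framing :: "dag \<Rightarrow> (dag_edge \<Rightarrow> nat) \<Rightarrow> bool" where
  "lab_framing G lab \<longleftrightarrow>
     lab ` arcs G \<subseteq> {1, 2} \<and>
     (\<forall>p \<in> inner_routes G. \<forall>a \<in> set p. lab a = (if odd (inner_route_no G p) then 2 else 1)) \<and>
     (\<forall>v \<in> inner_verts G. inj_on lab (in_arcs G v) \<and> inj_on lab (out_arcs G v))"


subsection \<open>Coherence\<close>

text \<open>
  A maximal common subpath \<open>[u,v]\<close> is given by its (possibly empty) list \<open>m\<close> of edges; the two
  routes enter \<open>u\<close> by the edges \<open>a \<noteq> c\<close> and leave \<open>v\<close> by the edges \<open>b \<noteq> d\<close>.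
\<close>

definition in_conflict :: "dag \<Rightarrow> (dag_edge \<Rightarrow> nat) \<Rightarrow> dag_edge awalk \<Rightarrow> dag_edge awalk \<Rightarrow> bool" where
  "in_conflict G lab R S \<longleftrightarrow>
     (\<exists>p q p' q' m a b c d.
        R = p @ [a] @ m @ [b] @ q \<and> S = p' @ [c] @ m @ [d] @ q' \<and>
        head G a = head G c \<and> tail G b = tail G d \<and> a \<noteq> c \<and> b \<noteq> d \<and>
        (lab a < lab c \<and> lab b > lab d \<or> lab c < lab a \<and> lab d > lab b))"

definition coherent :: "dag \<Rightarrow> (dag_edge \<Rightarrow> nat) \<Rightarrow> dag_edge awalk \<Rightarrow> dag_edge awalk \<Rightarrow> bool" where
  "coherent G lab R S \<longleftrightarrow> \<not> in_conflict G lab R S"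

definition clique :: "dag \<Rightarrow> (dag_edge \<Rightarrow> nat) \<Rightarrow> dag_edge awalk set \<Rightarrow> bool" where
  "clique G lab M \<longleftrightarrow> M \<subseteq> routes G \<and> (\<forall>R \<in> M. \<forall>S \<in> M. coherent G lab R S)"

definition maximal_clique :: "dag \<Rightarrow> (dag_edge \<Rightarrow> nat) \<Rightarrow> dag_edge awalk set \<Rightarrow> bool" where
  "maximal_clique G lab M \<longleftrightarrow> clique G lab M \<and> (\<forall>N. clique G lab N \<and> M \<subseteq> N \<longrightarrow> N = M)"


subsection \<open>The g-polytope and its DKK triangulation\<close>

definition traverses ::
  "dag \<Rightarrow> (dag_edge \<Rightarrow> nat) \<Rightarrow> dag_edge awalk \<Rightarrow> dag_vertex \<Rightarrow> nat \<Rightarrow> nat \<Rightarrow> bool" where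
  "traverses G lab R v l l' \<longleftrightarrow>
     (\<exists>p q a b. R = p @ [a, b] @ q \<and> head G a = v \<and> lab a = l \<and> lab b = l')"

text \<open>
  Coordinates are indexed by a finite type \<open>'n\<close>, which \<open>e\<close> identifies with the inner vertices.
\<close>

definition g_vector ::
  "dag \<Rightarrow> (dag_edge \<Rightarrow> nat) \<Rightarrow> ('n::finite \<Rightarrow> dag_vertex) \<Rightarrow> dag_edge awalk \<Rightarrow> real ^ 'n" where
  "g_vector G lab e R = (\<chi> i. if traverses G lab R (e i) 1 2 then - 1
                              else if traverses G lab R (e i) 2 1 then 1 else 0)"

definition g_polytope ::
  "dag \<Rightarrow> (dag_edge \<Rightarrow> nat) \<Rightarrow> ('n::finite \<Rightarrow> dag_vertex) \<Rightarrow> (real ^ 'n) set" where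
  "g_polytope G lab e = convex hull (g_vector G lab e ` routes G)"

definition DKK_triangulation ::
  "dag \<Rightarrow> (dag_edge \<Rightarrow> nat) \<Rightarrow> ('n::finite \<Rightarrow> dag_vertex) \<Rightarrow> (real ^ 'n) set set" where
  "DKK_triangulation G lab e =
     {convex hull (g_vector G lab e ` M) | M. maximal_clique G lab M}"


subsection \<open>Subdivisions and pulling\<close>

text \<open>
  Subdivisions and triangulations are represented by their top-dimensional cells only; in
  particular \<open>is_triangulation_of\<close> is stronger than the library's \<open>triangulation\<close>.
\<close>

definition is_subdivision_of :: "'a::euclidean_space set set \<Rightarrow> 'a set \<Rightarrow> bool" where
  "is_subdivision_of \<S> P \<longleftrightarrow>
     finite \<S> \<and> (\<forall>S \<in> \<S>. polytope S \<and> aff_dim S = aff_dim P) \<and> \<Union>\<S> = P \<and>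
     (\<forall>S \<in> \<S>. \<forall>T \<in> \<S>. S \<noteq> T \<longrightarrow>
        (S \<inter> T) face_of S \<and> S \<inter> T \<noteq> S \<and> (S \<inter> T) face_of T \<and> S \<inter> T \<noteq> T)"

definition is_triangulation_of :: "'a::euclidean_space set set \<Rightarrow> 'a set \<Rightarrow> bool" where
  "is_triangulation_of \<S> P \<longleftrightarrow> is_subdivision_of \<S> P \<and> (\<forall>S \<in> \<S>. \<exists>d. d simplex S)"

definition pull :: "'a::euclidean_space set set \<Rightarrow> 'a \<Rightarrow> 'a set set" where
  "pull \<S> x = {S \<in> \<S>. x \<notin> S} \<union>
     {convex hull (insert x F) | F S. S \<in> \<S> \<and> x \<in> S \<and> F facet_of S \<and> x \<notin> F}"

definition is_pulling_triangulation_of :: "'a::euclidean_space set set \<Rightarrow> 'a set \<Rightarrow> bool" where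
  "is_pulling_triangulation_of \<S> P \<longleftrightarrow>
     is_triangulation_of \<S> P \<and> (\<exists>xs. set xs \<subseteq> P \<and> \<S> = foldl pull {P} xs)"


subsection \<open>The construction yields full DAGs\<close>

lemma make_full_in_degree:
  assumes "v \<in> {1..n}" and "card {i \<in> {1..m}. head_of i = v} \<le> 2"
  shows "in_degree (make_full n m tail_of head_of) (Inner v) = 2"
proof -
  let ?A = "{i \<in> {1..m}. head_of i = v}"
  have "in_arcs (make_full n m tail_of head_of) (Inner v) =
      Inner_Edge ` ?A \<union> Source_Edge v ` {..<2 - card ?A}"
    using assms(1) by (auto simp: in_arcs_def make_full_def)
  moreover have "card (Inner_Edge ` ?A \<union> Source_Edge v ` {..<2 - card ?A})
      = card (Inner_Edge ` ?A) + card (Source_Edge v ` {..<2 - card ?A})"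
    by (rule card_Un_disjoint) auto
  moreover have "card (Inner_Edge ` ?A) = card ?A"
    and "card (Source_Edge v ` {..<2 - card ?A}) = 2 - card ?A"
    by (simp_all add: card_image inj_on_def)
  ultimately show ?thesis
    using assms(2) by (simp add: in_degree_def)
qed

lemma make_full_out_degree:
  assumes "v \<in> {1..n}" and "card {i \<in> {1..m}. tail_of i = v} \<le> 2"
  shows "out_degree (make_full n m tail_of head_of) (Inner v) = 2"
proof -
  let ?A = "{i \<in> {1..m}. tail_of i = v}"
  have "out_arcs (make_full n m tail_of head_of) (Inner v) =
      Inner_Edge ` ?A \<union> Sink_Edge v ` {..<2 - card ?A}"
    using assms(1) by (auto simp: out_arcs_def make_full_def)
  moreover have "card (Inner_Edge ` ?A \<union> Sink_Edge v ` {..<2 - card ?A})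
      = card (Inner_Edge ` ?A) + card (Sink_Edge v ` {..<2 - card ?A})"
    by (rule card_Un_disjoint) auto
  moreover have "card (Inner_Edge ` ?A) = card ?A"
    and "card (Sink_Edge v ` {..<2 - card ?A}) = 2 - card ?A"
    by (simp_all add: card_image inj_on_def)
  ultimately show ?thesis
    using assms(2) by (simp add: out_degree_def)
qed

lemma card_le_2I: "A \<subseteq> {x, y} \<Longrightarrow> card A \<le> 2"
  by (rule order_trans[OF card_mono[of "{x, y}" A]]) (auto simp: card_insert_if)

lemma Path_dag_full:
  assumes "v \<in> inner_verts (Path_dag ks)"
  shows "in_degree (Path_dag ks) v = 2" and "out_degree (Path_dag ks) v = 2"
proof -
  obtain w where w: "v = Inner w" "w \<in> {1..sum_list ks + 1}"
    using assms by (auto simp: inner_verts_def Path_dag_def make_full_def)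
  have head_le: "card {i \<in> {1..sum_list ks}. alternating_head ks (\<lambda>i. i + 1) i = w} \<le> 2"
    by (rule card_le_2I[of _ w "w - 1"]) (auto simp: alternating_head_def split: if_splits)
  have tail_le: "card {i \<in> {1..sum_list ks}. alternating_tail ks (\<lambda>i. i + 1) i = w} \<le> 2"
    by (rule card_le_2I[of _ w "w - 1"]) (auto simp: alternating_tail_def split: if_splits)
  show "in_degree (Path_dag ks) v = 2"
    unfolding Path_dag_def w(1) by (rule make_full_in_degree[OF w(2) head_le])
  show "out_degree (Path_dag ks) v = 2"
    unfolding Path_dag_def w(1) by (rule make_full_out_degree[OF w(2) tail_le])
qed

lemma Cycle_dag_full:
  assumes "v \<in> inner_verts (Cycle_dag ks)"
  shows "in_degree (Cycle_dag ks) v = 2" and "out_degree (Cycle_dag ks) v = 2"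
proof -
  let ?n = "sum_list ks"
  obtain w where w: "v = Inner w" "w \<in> {1..?n}"
    using assms by (auto simp: inner_verts_def Cycle_dag_def make_full_def Let_def)
  let ?nxt = "\<lambda>i. if i = ?n then 1 else i + 1"
  have head_le: "card {i \<in> {1..?n}. alternating_head ks ?nxt i = w} \<le> 2"
    by (rule card_le_2I[of _ w "if w = 1 then ?n else w - 1"]) (auto simp: alternating_head_def split: if_splits)
  have tail_le: "card {i \<in> {1..?n}. alternating_tail ks ?nxt i = w} \<le> 2"
    by (rule card_le_2I[of _ w "if w = 1 then ?n else w - 1"]) (auto simp: alternating_tail_def split: if_splits)
  show "in_degree (Cycle_dag ks) v = 2"
    unfolding Cycle_dag_def w(1) Let_def by (rule make_full_in_degree[OF w(2) head_le])
  show "out_degree (Cycle_dag ks) v = 2"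
    unfolding Cycle_dag_def w(1) Let_def by (rule make_full_out_degree[OF w(2) tail_le])
qed

end

(*
  Every route runs inside one inner route, so its g-vector is 0, -e_v, e_v or e_b - e_a with a before b
  on one inner route.  Two routes R, S in conflict can be exchanged for R', S' with
  g(R) + g(S) = g(R') + g(S'), where g(R') precedes both g(R) and g(S) in a suitable order: 0 comes
  first, -e_a and e_b come before e_b - e_a, and longer differences come before those inside them.
  Hence the first point of a face of P is coherent with all other points of this face, and pulling in
  this order produces only simplices spanned by cliques.  Conversely, a convex combination supported on a
  clique is determined by its value: comparing two of them on a shortest e_b - e_a whose coefficients
  differ yields a crossing pair.  Therefore every maximal clique is obtained.
*)
theory Submission
  imports Defs
begin

text \<open>The lab framing makes the direction of an inner route immaterial. In an odd group the
  inner edges run upwards and carry label 2, in an even group they run downwards and carry label 1;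
  reversing a walk and swapping the labels exchanges the two situations. In both, a route through
  the inner edges \<open>i..k\<close> can have the entry -1 only at the lower end and the entry 1
  only at the upper end, so conflicts become comparisons of intervals. In the cycle this survives
  the step from \<open>n\<close> to 1 because the last group is even and the first odd: both edges
  leave vertex 1, and no inner route crosses it. Two obstacles remain. Several routes have the
  g-vector 0, so the geometry works with points, and coherence has to be shown to depend on
  g-vectors only. And the exchange shows that cells are spanned by coherent sets, but not that these
  are independent or maximal: independence comes from the uniqueness of coherent combinations,
  maximality from counting points against the dimension of the face.\<close>

subsection \<open>Pulling with empty facets allowed\<close>

text \<open>
  A point has no facet in the sense of \<open>facet_of\<close>, so \<open>pull\<close> would delete a 0-dimensional cell. Allowing
  the empty face of a point makes pulling commute with taking cones in every dimension.
\<close>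

definition hyperface :: "'a::euclidean_space set \<Rightarrow> 'a set \<Rightarrow> bool" where
  "hyperface F S \<longleftrightarrow> F face_of S \<and> aff_dim F + 1 = aff_dim S"

definition pull_ext :: "'a::euclidean_space set set \<Rightarrow> 'a \<Rightarrow> 'a set set" where
  "pull_ext \<S> x = {S \<in> \<S>. x \<notin> S} \<union>
     {convex hull (insert x F) | F S. S \<in> \<S> \<and> x \<in> S \<and> hyperface F S \<and> x \<notin> F}"

lemma hyperface_imp_subset: "hyperface F S \<Longrightarrow> F \<subseteq> S"
  by (simp add: hyperface_def face_of_imp_subset)

lemma notin_affine_hull_face:
  fixes S :: "'a::euclidean_space set"
  assumes "convex S" "F face_of S" "x \<in> S" "x \<notin> F"
  shows "x \<notin> affine hull F"
  using face_of_imp_eq_affine_Int[of S F] assms by blast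

lemma aff_dim_cone:
  assumes "v \<notin> affine hull F"
  shows "aff_dim (convex hull (insert v F)) = aff_dim F + 1"
  using assms by (simp add: aff_dim_convex_hull aff_dim_insert)

lemma pull_ext_polytopes:
  assumes "\<forall>S\<in>\<S>. polytope S \<and> aff_dim S = d" "T \<in> pull_ext \<S> x"
  shows "polytope T \<and> aff_dim T = d"
proof (cases "T \<in> \<S>")
  case True
  then show ?thesis using assms by auto
next
  case False
  then obtain F S where T: "T = convex hull (insert x F)" "S \<in> \<S>" "x \<in> S" "hyperface F S" "x \<notin> F"
    using assms(2) unfolding pull_ext_def by blast
  have S: "polytope S" "aff_dim S = d" using assms T by auto
  have x: "x \<notin> affine hull F"
    using notin_affine_hull_face[of S F x] T S by (auto simp: hyperface_def polytope_imp_convex)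
  have "polytope F" using T S face_of_polytope_polytope hyperface_def by blast
  then obtain V where V: "finite V" "F = convex hull V" by (auto simp: polytope_def)
  have "T = convex hull (insert x V)" unfolding T V by (simp add: hull_insert[symmetric])
  then have "polytope T" using V by (auto intro: polytope_convex_hull)
  then show ?thesis using T S aff_dim_cone[OF x] by (auto simp: hyperface_def)
qed

text \<open>Only a point has the empty set as a hyperface, so hyperfaces and facets agree for cells
  of dimension at least 1.\<close>

lemma pull_eq_pull_ext:
  assumes "\<forall>S\<in>\<S>. aff_dim S = d" "d \<ge> 1"
  shows "pull \<S> x = pull_ext \<S> x"
proof -
  have "F facet_of S \<longleftrightarrow> hyperface F S" if "S \<in> \<S>" for F S
    using that assms by (auto simp: facet_of_def hyperface_def)
  then show ?thesis unfolding pull_def pull_ext_def by blast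
qed

lemma foldl_pull_eq_pull_ext:
  assumes "\<forall>S\<in>\<S>. polytope S \<and> aff_dim S = d" "d \<ge> 1"
  shows "foldl pull \<S> xs = foldl pull_ext \<S> xs"
  using assms(1)
proof (induction xs arbitrary: \<S>)
  case (Cons x xs)
  have "\<forall>S\<in>pull_ext \<S> x. polytope S \<and> aff_dim S = d"
    using pull_ext_polytopes[OF Cons.prems] by blast
  then show ?case
    using Cons pull_eq_pull_ext[of \<S> d x] assms(2) by auto
qed simp

text \<open>Pulling acts on each cell separately, so the cones created by one pull can be followed
  independently through all later ones.\<close>

lemma pull_ext_Union: "pull_ext (\<Union>\<S>\<in>\<A>. f \<S>) x = (\<Union>\<S>\<in>\<A>. pull_ext (f \<S>) x)"
  unfolding pull_ext_def by blast

lemma foldl_pull_ext_Union: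
  "foldl pull_ext (\<Union>\<S>\<in>\<A>. f \<S>) xs = (\<Union>\<S>\<in>\<A>. foldl pull_ext (f \<S>) xs)"
proof (induction xs arbitrary: f)
  case (Cons x xs)
  show ?case
    using Cons[of "\<lambda>\<S>. pull_ext (f \<S>) x"] by (simp add: pull_ext_Union)
qed simp

section \<open>Pulling inside the base of a pyramid\<close>

lemma cone_Int_base:
  fixes B :: "'a::euclidean_space set"
  assumes "v \<notin> affine hull B" "C \<subseteq> B" "convex C" "y \<in> B" "y \<in> convex hull (insert v C)"
  shows "y \<in> C"
proof (cases "C = {}")
  case True
  then show ?thesis using assms hull_inc[of y B affine] by auto
next
  case False
  then obtain u w b where u: "0 \<le> u" "0 \<le> w" "u + w = 1" "b \<in> C" "y = u *\<^sub>R v + w *\<^sub>R b"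
    using assms(3,5) by (auto simp: convex_hull_insert hull_same)
  \<comment> \<open>Otherwise \<open>v\<close> would be an affine combination of \<open>y\<close>
    and \<open>b\<close>, which both lie in \<open>B\<close>.\<close>
  have "u = 0"
  proof (rule ccontr)
    assume "u \<noteq> 0"
    have "v = (1/u) *\<^sub>R y + (- w/u) *\<^sub>R b"
      using \<open>u \<noteq> 0\<close> by (simp add: u(5) scaleR_add_right)
    moreover have "1/u + (- w/u) = 1" using u(3) \<open>u \<noteq> 0\<close> by (simp add: field_simps)
    moreover have "y \<in> affine hull B" "b \<in> affine hull B"
      using assms u(4) by (auto intro: hull_inc)
    ultimately have "v \<in> affine hull B"
      using mem_affine[OF affine_affine_hull[of B], of y b "1/u" "- w/u"] by simp
    then show False using assms(1) by blast
  qed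
  then show ?thesis using u by auto
qed

text \<open>The faces of a pyramid are the faces of its base and the cones over these, and among the
  former only the base itself is a hyperface. As \<open>y\<close> lies in the base, the hyperfaces
  avoiding \<open>y\<close>, the only ones that matter when pulling at \<open>y\<close>, are
  cones.\<close>

lemma hyperface_cone:
  assumes "polytope C" "v \<notin> affine hull C" "y \<in> C"
  shows "hyperface F (convex hull (insert v C)) \<and> y \<notin> F
    \<longleftrightarrow> (\<exists>F'. hyperface F' C \<and> y \<notin> F' \<and> F = convex hull (insert v F'))"
proof -
  obtain V where V: "finite V" "C = convex hull V" using assms(1) by (auto simp: polytope_def)
  have vV: "v \<notin> affine hull V" using assms(2) V by simp
  have eq: "convex hull (insert v C) = convex hull (insert v V)"
    unfolding V by (simp add: hull_insert[symmetric])
  have face: "F face_of (convex hull (insert v C)) \<longleftrightarrow>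
      F face_of C \<or> (\<exists>F'. F' face_of C \<and> F = convex hull (insert v F'))" for F
    unfolding eq unfolding V by (rule face_of_convex_hull_insert_eq[OF V(1) vV])
  have dim: "aff_dim (convex hull (insert v C)) = aff_dim C + 1"
    by (rule aff_dim_cone[OF assms(2)])
  have conv: "convex C" using assms(1) polytope_imp_convex by blast
  have vF: "v \<notin> affine hull F'" if "F' face_of C" for F'
    using assms(2) hull_mono[OF face_of_imp_subset[OF that]] by blast
  have yF: "y \<notin> convex hull (insert v F')" if "F' face_of C" "y \<notin> F'" for F'
    using cone_Int_base[OF assms(2) face_of_imp_subset[OF that(1)] face_of_imp_convex[OF that(1)] assms(3)]
      that(2) by blast
  show ?thesis
  proof
    assume L: "hyperface F (convex hull (insert v C)) \<and> y \<notin> F"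
    then have "F face_of C \<or> (\<exists>F'. F' face_of C \<and> F = convex hull (insert v F'))"
      using face by (simp add: hyperface_def)
    then show "\<exists>F'. hyperface F' C \<and> y \<notin> F' \<and> F = convex hull (insert v F')"
    proof
      assume FC: "F face_of C"
      have "aff_dim F = aff_dim C" using L dim by (simp add: hyperface_def)
      then have "F = C" using face_of_aff_dim_lt[OF conv FC] by auto
      then show ?thesis using L assms(3) by blast
    next
      assume "\<exists>F'. F' face_of C \<and> F = convex hull (insert v F')"
      then obtain F' where F': "F' face_of C" "F = convex hull (insert v F')" by blast
      have "y \<notin> F'" using L F'(2) by (meson hull_inc insertCI)
      moreover have "hyperface F' C"
        using L dim aff_dim_cone[OF vF[OF F'(1)]] F' by (simp add: hyperface_def)
      ultimately show ?thesis using F' by blast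
    qed
  next
    assume "\<exists>F'. hyperface F' C \<and> y \<notin> F' \<and> F = convex hull (insert v F')"
    then obtain F' where F': "hyperface F' C" "y \<notin> F'" "F = convex hull (insert v F')" by blast
    then show "hyperface F (convex hull (insert v C)) \<and> y \<notin> F"
      using face dim aff_dim_cone[OF vF] yF by (auto simp: hyperface_def)
  qed
qed

text \<open>The last assumption lets \<open>y\<close> meet the big pyramid only in its base, so a
  cone over a cell contains \<open>y\<close> exactly if the cell does, and
  \<open>hyperface_cone\<close> applies. The second claim is the invariant that allows this to be
  repeated for further points.\<close>

lemma pull_ext_cone:
  assumes "\<forall>C\<in>\<S>. polytope C \<and> C \<subseteq> B" "v \<notin> affine hull B"
    and "y \<in> convex hull (insert v B) \<Longrightarrow> y \<in> B"
  shows "pull_ext ((\<lambda>C. convex hull (insert v C)) ` \<S>) y = (\<lambda>C. convex hull (insert v C)) ` pull_ext \<S> y"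
    and "\<forall>C\<in>pull_ext \<S> y. polytope C \<and> C \<subseteq> B"
proof -
  let ?c = "\<lambda>C. convex hull (insert v C)"
  have mem: "y \<in> ?c C \<longleftrightarrow> y \<in> C" if "C \<in> \<S>" for C
  proof
    assume y: "y \<in> ?c C"
    have "?c C \<subseteq> ?c B" using assms(1) that by (intro hull_mono) blast
    then have "y \<in> B" using y assms(3) by blast
    then show "y \<in> C" using cone_Int_base[OF assms(2) _ _ _ y] assms(1) that polytope_imp_convex by blast
  qed (simp add: hull_inc)
  have v: "v \<notin> affine hull C" if "C \<in> \<S>" for C
    using assms(1,2) hull_mono that by blast
  have swap: "convex hull (insert y (?c F)) = ?c (convex hull (insert y F))" for F
    by (simp add: hull_insert[symmetric] insert_commute)
  have "{T. \<exists>F S. T = convex hull (insert y F) \<and> S \<in> ?c ` \<S> \<and> y \<in> S \<and> hyperface F S \<and> y \<notin> F}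
     = ?c ` {convex hull (insert y F) | F S. S \<in> \<S> \<and> y \<in> S \<and> hyperface F S \<and> y \<notin> F}" (is "?L = ?R")
  proof
    show "?L \<subseteq> ?R"
    proof
      fix T assume "T \<in> ?L"
      then obtain F C where T: "T = convex hull (insert y F)" "C \<in> \<S>" "y \<in> ?c C" "hyperface F (?c C)" "y \<notin> F"
        by blast
      then have "y \<in> C" using mem by blast
      then obtain F' where "hyperface F' C" "y \<notin> F'" "F = ?c F'"
        using hyperface_cone[of C v y F] T assms(1) v by blast
      then show "T \<in> ?R" using T \<open>y \<in> C\<close> swap by blast
    qed
    show "?R \<subseteq> ?L"
    proof
      fix T assume "T \<in> ?R"
      then obtain F C where T: "T = ?c (convex hull (insert y F))" "C \<in> \<S>" "y \<in> C" "hyperface F C" "y \<notin> F"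
        by blast
      then have "hyperface (?c F) (?c C)" "y \<notin> ?c F"
        using hyperface_cone[of C v y "?c F"] T assms(1) v by blast+
      then show "T \<in> ?L" using T swap mem by blast
    qed
  qed
  moreover have "{S \<in> ?c ` \<S>. y \<notin> S} = ?c ` {S \<in> \<S>. y \<notin> S}" using mem by blast
  ultimately show "pull_ext (?c ` \<S>) y = ?c ` pull_ext \<S> y"
    unfolding pull_ext_def image_Un by simp
  show "\<forall>C\<in>pull_ext \<S> y. polytope C \<and> C \<subseteq> B"
  proof
    fix C assume C: "C \<in> pull_ext \<S> y"
    show "polytope C \<and> C \<subseteq> B"
    proof (cases "C \<in> \<S>")
      case False
      then obtain F S where T: "C = convex hull (insert y F)" "S \<in> \<S>" "y \<in> S" "hyperface F S" "y \<notin> F"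
        using C unfolding pull_ext_def by blast
      then have "C \<in> pull_ext {S} y" by (auto simp: pull_ext_def)
      then have "polytope C" using pull_ext_polytopes[of "{S}" "aff_dim S"] assms(1) T(2) by blast
      moreover have "C \<subseteq> S" unfolding T
        using T assms(1) by (intro hull_minimal) (auto dest: hyperface_imp_subset polytope_imp_convex)
      ultimately show ?thesis using assms(1) T by blast
    qed (use assms in blast)
  qed
qed

lemma foldl_pull_ext_cone:
  assumes "\<forall>C\<in>\<S>. polytope C \<and> C \<subseteq> B" "v \<notin> affine hull B"
    and "\<forall>y\<in>set ys. y \<in> convex hull (insert v B) \<longrightarrow> y \<in> B"
  shows "foldl pull_ext ((\<lambda>C. convex hull (insert v C)) ` \<S>) ys
    = (\<lambda>C. convex hull (insert v C)) ` foldl pull_ext \<S> ys"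
  using assms(1,3)
proof (induction ys arbitrary: \<S>)
  case (Cons y ys)
  have y: "y \<in> convex hull (insert v B) \<Longrightarrow> y \<in> B" using Cons.prems by auto
  show ?case
    using Cons.IH[OF pull_ext_cone(2)[OF Cons.prems(1) assms(2) y]] Cons.prems(2)
      pull_ext_cone(1)[OF Cons.prems(1) assms(2) y] by simp
qed simp

section \<open>Covering a polytope by cones from one of its points\<close>

lemma face_rel_interior_exists:
  fixes S :: "'a::euclidean_space set"
  assumes "polytope S" "w \<in> S"
  obtains F where "F face_of S" "w \<in> rel_interior F"
proof -
  let ?A = "{F. F face_of S \<and> w \<in> F}"
  have S: "S \<in> ?A" using assms polytope_imp_convex face_of_refl by auto
  \<comment> \<open>This is the smallest face containing \<open>w\<close>; were \<open>w\<close> on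
    its relative boundary, a facet of it would be a smaller one.\<close>
  define F where "F = \<Inter>?A"
  have F: "F face_of S" unfolding F_def using S by (intro face_of_Inter) blast+
  have wF: "w \<in> F" by (auto simp: F_def)
  have pF: "polyhedron F" using face_of_polytope_polytope[OF assms(1) F] polytope_imp_polyhedron by blast
  have "w \<in> rel_interior F"
  proof (rule ccontr)
    assume "w \<notin> rel_interior F"
    then have "w \<in> rel_frontier F"
      using wF closure_subset by (auto simp: rel_frontier_def)
    then obtain F' where F': "F' facet_of F" "w \<in> F'"
      using rel_frontier_of_polyhedron[OF pF] by auto
    then have "F' face_of S" using F face_of_trans facet_of_imp_face_of by blast
    then have "F \<subseteq> F'" using F' by (auto simp: F_def)
    then have "F' = F" using facet_of_imp_subset[OF F'(1)] by (rule subset_antisym[OF _, rotated])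
    then show False using F'(1) by simp
  qed
  then show ?thesis using F that by blast
qed

text \<open>A face is the intersection of the facets containing it, so one of these must omit a
  given point outside the face.\<close>

lemma face_subset_hyperface_avoiding:
  assumes "polytope S" "F face_of S" "F \<noteq> {}" "x \<in> S" "x \<notin> F"
  obtains F' where "hyperface F' S" "x \<notin> F'" "F \<subseteq> F'"
proof -
  have "F = \<Inter>{F'. F' facet_of S \<and> F \<subseteq> F'}"
    using assms polytope_imp_polyhedron by (intro face_of_polyhedron) auto
  then obtain F' where "F' facet_of S" "F \<subseteq> F'" "x \<notin> F'" using assms(5) by blast
  then show ?thesis using that[of F'] by (simp add: facet_of_def hyperface_def)
qed

text \<open>Follow the ray from \<open>x\<close> through \<open>z\<close> to its last point in
  \<open>S\<close>. The face having this point in its relative interior cannot contain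
  \<open>x\<close>, since the ray would then continue inside that face.\<close>

lemma polytope_cone_cover_aux:
  fixes S :: "'a::euclidean_space set"
  assumes "polytope S" "x \<in> S" "z \<in> S" "z \<noteq> x"
  obtains F where "hyperface F S" "x \<notin> F" "z \<in> convex hull (insert x F)"
proof -
  define g where "g = (\<lambda>t. x + t *\<^sub>R (z - x))"
  define K where "K = {t. g t \<in> S}"
  have "compact S" using assms(1) polytope_imp_compact by blast
  then obtain b where b: "\<forall>y\<in>S. norm y \<le> b" using compact_imp_bounded bounded_iff by metis
  have gi: "continuous_on UNIV g" unfolding g_def by (intro continuous_intros)
  have "closed K" using closed_vimage[OF compact_imp_closed[OF \<open>compact S\<close>] gi]
    by (simp add: K_def vimage_def)
  moreover have "bounded K"
  proof -
    have "\<bar>t\<bar> \<le> (b + norm x) / norm (z - x)" if "t \<in> K" for t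
    proof -
      have "norm (t *\<^sub>R (z - x)) \<le> norm (g t) + norm x"
        unfolding g_def using norm_triangle_ineq4[of "x + t *\<^sub>R (z - x)" x] by simp
      also have "\<dots> \<le> b + norm x" using b that by (auto simp: K_def)
      finally show ?thesis using assms(4) by (simp add: pos_le_divide_eq)
    qed
    then show ?thesis by (auto simp: bounded_iff)
  qed
  ultimately have "compact K" using compact_eq_bounded_closed by blast
  moreover have "1 \<in> K" using assms by (simp add: K_def g_def)
  ultimately obtain t where t: "t \<in> K" "\<forall>s\<in>K. s \<le> t"
    using compact_attains_sup[of K] by blast
  have t1: "1 \<le> t" using t \<open>1 \<in> K\<close> by blast
  have w: "g t \<in> S" using t by (simp add: K_def)
  obtain F where F: "F face_of S" "g t \<in> rel_interior F"
    using face_rel_interior_exists[OF assms(1) w] by blast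
  have wF: "g t \<in> F" using F rel_interior_subset by blast
  have "x \<notin> F"
  proof
    assume "x \<in> F"
    have "convex F" using F face_of_imp_convex by blast
    then obtain e where e: "e > 1" "(1 - e) *\<^sub>R x + e *\<^sub>R g t \<in> F"
      using convex_rel_interior_iff[of F "g t"] F \<open>x \<in> F\<close> by auto
    have "(1 - e) *\<^sub>R x + e *\<^sub>R g t = g (e * t)" by (simp add: g_def algebra_simps)
    then have "e * t \<in> K" using e F face_of_imp_subset by (auto simp: K_def)
    then have "e * t \<le> t" using t by blast
    then show False using e(1) t1 by (simp add: mult_le_cancel_right1)
  qed
  then obtain F' where F': "hyperface F' S" "x \<notin> F'" "F \<subseteq> F'"
    using face_subset_hyperface_avoiding[OF assms(1) F(1) _ assms(2)] wF by blast
  have "z = (1 - 1/t) *\<^sub>R x + (1/t) *\<^sub>R g t"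
    using t1 by (simp add: g_def algebra_simps)
  moreover have "x \<in> convex hull (insert x F')" "g t \<in> convex hull (insert x F')"
    using F' wF by (auto intro: hull_inc)
  ultimately have "z \<in> convex hull (insert x F')"
    using t1 convexD[OF convex_convex_hull, of x "insert x F'" "g t" "1 - 1/t" "1/t"] by simp
  then show ?thesis using F' that by blast
qed

lemma polytope_cone_cover:
  fixes S :: "'a::euclidean_space set"
  assumes "polytope S" "x \<in> S" "z \<in> S"
  obtains F where "hyperface F S" "x \<notin> F" "z \<in> convex hull (insert x F)"
proof (cases "S = {x}")
  case True
  \<comment> \<open>A point is the cone over its empty hyperface.\<close>
  have "hyperface {} S" unfolding hyperface_def True by simp
  then show ?thesis using that[of "{}"] assms True by simp
next
  case False
  \<comment> \<open>For \<open>z = x\<close> every cone will do, but a hyperface avoiding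
    \<open>x\<close> is still needed; the ray towards any other point supplies one.\<close>
  then obtain z' where z': "z' \<in> S" "z' \<noteq> x" using assms by blast
  show ?thesis
  proof (cases "z = x")
    case True
    then show ?thesis
      using polytope_cone_cover_aux[OF assms(1,2) z'] that by (metis hull_inc insertI1)
  next
    case False
    then show ?thesis using polytope_cone_cover_aux[OF assms] that by blast
  qed
qed

subsection \<open>Pulling triangulations from an exchange property\<close>

text \<open>
  The order of pulling is by increasing \<open>\<kappa>\<close>, with ties broken arbitrarily.
\<close>

locale exchange_complex =
  fixes X :: "'a::euclidean_space set" and inc :: "'a \<Rightarrow> 'a \<Rightarrow> bool" and \<kappa> :: "'a \<Rightarrow> nat"
  assumes finite_X: "finite X"
    and inc_sym: "inc x y \<Longrightarrow> inc y x"
    and inc_irrefl: "x \<in> X \<Longrightarrow> \<not> inc x x"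
    and exchange: "\<lbrakk>x \<in> X; y \<in> X; inc x y\<rbrakk> \<Longrightarrow>
      \<exists>x'\<in>X. \<exists>y'\<in>X. x + y = x' + y' \<and> \<kappa> x' < \<kappa> x \<and> \<kappa> x' < \<kappa> y"
    and unique_combination:
      "\<lbrakk>\<And>x. x \<in> X \<Longrightarrow> 0 \<le> c x; \<And>x. x \<in> X \<Longrightarrow> 0 \<le> d x; sum c X = 1; sum d X = 1;
        \<And>x y. \<lbrakk>x \<in> X; y \<in> X; 0 < c x; 0 < c y\<rbrakk> \<Longrightarrow> \<not> inc x y;
        \<And>x y. \<lbrakk>x \<in> X; y \<in> X; 0 < d x; 0 < d y\<rbrakk> \<Longrightarrow> \<not> inc x y;
        (\<Sum>x\<in>X. c x *\<^sub>R x) = (\<Sum>x\<in>X. d x *\<^sub>R x); x \<in> X\<rbrakk> \<Longrightarrow> c x = d x"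
begin

section \<open>Coherent sets span simplices that meet in common faces\<close>

definition coherent_set :: "'a set \<Rightarrow> bool" where
  "coherent_set M \<longleftrightarrow> M \<subseteq> X \<and> (\<forall>x\<in>M. \<forall>y\<in>M. \<not> inc x y)"

definition maximal_in :: "'a set \<Rightarrow> 'a set \<Rightarrow> bool" where
  "maximal_in A M \<longleftrightarrow> coherent_set M \<and> M \<subseteq> A \<and> (\<forall>N. coherent_set N \<and> N \<subseteq> A \<and> M \<subseteq> N \<longrightarrow> N = M)"

lemma coherent_set_finite: "coherent_set M \<Longrightarrow> finite M"
  using finite_X finite_subset by (auto simp: coherent_set_def)

lemma coherent_set_insert:
  assumes "coherent_set M" "x \<in> X" "\<And>y. y \<in> M \<Longrightarrow> \<not> inc x y"
  shows "coherent_set (insert x M)"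
  using assms inc_irrefl inc_sym unfolding coherent_set_def by blast

text \<open>Weights on \<open>M\<close> are extended by 0 to all of \<open>X\<close>, the form in
  which \<open>unique_combination\<close> compares two combinations.\<close>

lemma coherent_hull_coefficients:
  assumes "coherent_set M" "z \<in> convex hull M"
  obtains c where "\<And>x. x \<in> X \<Longrightarrow> 0 \<le> c x" "sum c X = 1" "(\<Sum>x\<in>X. c x *\<^sub>R x) = z"
    "\<And>x. x \<notin> M \<Longrightarrow> c x = 0" "\<And>x y. \<lbrakk>x \<in> X; y \<in> X; 0 < c x; 0 < c y\<rbrakk> \<Longrightarrow> \<not> inc x y"
proof -
  obtain u where u: "\<And>x. x \<in> M \<Longrightarrow> 0 \<le> u x" "sum u M = 1" "(\<Sum>x\<in>M. u x *\<^sub>R x) = z"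
    using assms coherent_set_finite by (auto simp: convex_hull_finite)
  define c where "c = (\<lambda>x. if x \<in> M then u x else 0)"
  have M: "M \<subseteq> X" using assms by (auto simp: coherent_set_def)
  have "sum c X = sum u M"
    unfolding c_def using M finite_X by (simp add: sum.If_cases Int_absorb1)
  moreover have "(\<Sum>x\<in>X. c x *\<^sub>R x) = (\<Sum>x\<in>M. u x *\<^sub>R x)"
    unfolding c_def using M finite_X
    by (intro sum.mono_neutral_cong_right) auto
  ultimately show ?thesis
    using u assms by (intro that[of c]) (auto simp: c_def coherent_set_def split: if_splits)
qed

text \<open>By uniqueness the representations of a common point over \<open>M\<close> and over
  \<open>N\<close> coincide, so they are supported on \<open>M \<inter> N\<close>.\<close>

lemma coherent_hull_Int:
  assumes "coherent_set M" "coherent_set N"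
  shows "convex hull M \<inter> convex hull N = convex hull (M \<inter> N)"
proof
  show "convex hull (M \<inter> N) \<subseteq> convex hull M \<inter> convex hull N"
    by (simp add: hull_mono)
  show "convex hull M \<inter> convex hull N \<subseteq> convex hull (M \<inter> N)"
  proof
    fix z assume z: "z \<in> convex hull M \<inter> convex hull N"
    from z obtain c where c: "\<And>x. x \<in> X \<Longrightarrow> 0 \<le> c x" "sum c X = 1" "(\<Sum>x\<in>X. c x *\<^sub>R x) = z"
      "\<And>x. x \<notin> M \<Longrightarrow> c x = 0" "\<And>x y. \<lbrakk>x \<in> X; y \<in> X; 0 < c x; 0 < c y\<rbrakk> \<Longrightarrow> \<not> inc x y"
      using coherent_hull_coefficients[OF assms(1), of z] by blast
    from z obtain d where d: "\<And>x. x \<in> X \<Longrightarrow> 0 \<le> d x" "sum d X = 1" "(\<Sum>x\<in>X. d x *\<^sub>R x) = z"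
      "\<And>x. x \<notin> N \<Longrightarrow> d x = 0" "\<And>x y. \<lbrakk>x \<in> X; y \<in> X; 0 < d x; 0 < d y\<rbrakk> \<Longrightarrow> \<not> inc x y"
      using coherent_hull_coefficients[OF assms(2), of z] by blast
    have cd: "c x = d x" if "x \<in> X" for x
      by (rule unique_combination[of c d]) (use c d that in simp_all)
    have MN: "M \<inter> N \<subseteq> X" "finite (M \<inter> N)"
      using assms coherent_set_finite by (auto simp: coherent_set_def)
    have zero: "c x = 0" if "x \<in> X" "x \<notin> M \<inter> N" for x
      using that c(4)[of x] d(4)[of x] cd[of x] by (cases "x \<in> M") auto
    have "sum c (M \<inter> N) = 1"
      unfolding c(2)[symmetric] using zero MN finite_X by (intro sum.mono_neutral_left) auto
    moreover have "(\<Sum>x\<in>M \<inter> N. c x *\<^sub>R x) = z"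
      unfolding c(3)[symmetric] using zero MN finite_X by (intro sum.mono_neutral_left) auto
    ultimately show "z \<in> convex hull (M \<inter> N)"
      unfolding convex_hull_finite[OF MN(2)] using c(1) MN(1) by blast
  qed
qed

text \<open>The barycentre of \<open>M\<close> gives positive weight to every point of
  \<open>M\<close>, and uniqueness forces these weights on any other coherent set. Thus a single
  point recognises \<open>M\<close>.\<close>

lemma coherent_interior_point:
  assumes "coherent_set M" "M \<noteq> {}"
  obtains z where "z \<in> convex hull M" "\<And>N. \<lbrakk>coherent_set N; z \<in> convex hull N\<rbrakk> \<Longrightarrow> M \<subseteq> N"
proof -
  have fin: "finite M" using assms coherent_set_finite by blast
  have MX: "M \<subseteq> X" using assms by (auto simp: coherent_set_def)
  define u where "u = (\<lambda>x. if x \<in> M then 1 / real (card M) else 0)"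
  have pos: "card M > 0" using fin assms(2) by (simp add: card_gt_0_iff)
  have u1: "sum u M = 1" using pos by (simp add: u_def)
  define z where "z = (\<Sum>x\<in>M. u x *\<^sub>R x)"
  have uX: "sum u X = 1"
    using u1 sum.mono_neutral_left[OF finite_X MX, of u] by (auto simp: u_def)
  have zX: "(\<Sum>x\<in>X. u x *\<^sub>R x) = z"
    unfolding z_def using finite_X MX by (intro sum.mono_neutral_right) (auto simp: u_def)
  have "\<exists>v. (\<forall>x\<in>M. 0 \<le> v x) \<and> sum v M = 1 \<and> (\<Sum>x\<in>M. v x *\<^sub>R x) = z"
    by (rule exI[of _ u]) (simp add: u1 z_def, simp add: u_def)
  then have "z \<in> convex hull M" by (simp add: convex_hull_finite[OF fin])
  moreover have "M \<subseteq> N" if N: "coherent_set N" "z \<in> convex hull N" for N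
  proof
    fix x assume x: "x \<in> M"
    obtain d where d: "\<And>x. x \<in> X \<Longrightarrow> 0 \<le> d x" "sum d X = 1" "(\<Sum>x\<in>X. d x *\<^sub>R x) = z"
      "\<And>x. x \<notin> N \<Longrightarrow> d x = 0" "\<And>x y. \<lbrakk>x \<in> X; y \<in> X; 0 < d x; 0 < d y\<rbrakk> \<Longrightarrow> \<not> inc x y"
      using coherent_hull_coefficients[OF N] by blast
    have "u x = d x"
    proof (rule unique_combination[of u d])
      show "\<And>x y. \<lbrakk>x \<in> X; y \<in> X; 0 < u x; 0 < u y\<rbrakk> \<Longrightarrow> \<not> inc x y"
        using assms(1) by (auto simp: u_def coherent_set_def split: if_splits)
      show "\<And>x. x \<in> X \<Longrightarrow> 0 \<le> u x" by (simp add: u_def)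
    qed (use uX zX d MX x in auto)
    moreover have "u x \<noteq> 0" using x pos by (simp add: u_def)
    ultimately show "x \<in> N" using d(4)[of x] by metis
  qed
  ultimately show ?thesis using that by blast
qed

lemma coherent_set_singleton: "x \<in> X \<Longrightarrow> coherent_set {x}"
  using inc_irrefl by (auto simp: coherent_set_def)

lemma vertex_in_coherent_hull:
  assumes "x \<in> X" "coherent_set N" "x \<in> convex hull N"
  shows "x \<in> N"
proof -
  obtain z where "z \<in> convex hull {x}" "\<And>N. \<lbrakk>coherent_set N; z \<in> convex hull N\<rbrakk> \<Longrightarrow> {x} \<subseteq> N"
    using coherent_interior_point[OF coherent_set_singleton[OF assms(1)]] by blast
  then show ?thesis using assms by auto
qed

text \<open>An affine dependence changes the weights of the barycentre without moving it, which
  contradicts uniqueness if the change is small enough to keep the weights nonnegative.\<close>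

lemma coherent_affine_independent:
  assumes "coherent_set M"
  shows "\<not> affine_dependent M"
proof
  assume dep: "affine_dependent M"
  have fin: "finite M" using assms coherent_set_finite by blast
  have MX: "M \<subseteq> X" using assms by (auto simp: coherent_set_def)
  obtain w where w: "sum w M = 0" "\<exists>v\<in>M. w v \<noteq> 0" "(\<Sum>v\<in>M. w v *\<^sub>R v) = 0"
    using dep affine_dependent_explicit_finite[OF fin] by auto
  obtain v where v: "v \<in> M" "w v \<noteq> 0" using w by blast
  define B where "B = (\<Sum>x\<in>M. \<bar>w x\<bar>)"
  have wB: "\<bar>w x\<bar> \<le> B" if "x \<in> M" for x
    unfolding B_def using that fin by (intro member_le_sum) auto
  have Bpos: "B > 0" using wB[OF v(1)] v(2) by auto
  define m where "m = real (card M)"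
  have m: "m > 0" using fin v(1) by (auto simp: m_def card_gt_0_iff)
  define c where "c = (\<lambda>x. if x \<in> M then 1 / m else 0)"
  \<comment> \<open>\<open>B\<close> bounds every \<open>\<bar>w x\<bar>\<close>, so the change is
    at most \<open>1 / m\<close> in absolute value.\<close>
  define d where "d = (\<lambda>x. if x \<in> M then 1 / m + w x / (B * m) else 0)"
  have sums: "sum f X = sum f M" if "\<And>x. x \<notin> M \<Longrightarrow> f x = 0" for f :: "'a \<Rightarrow> 'b::comm_monoid_add"
    using that by (intro sum.mono_neutral_right[OF finite_X MX]) auto
  have c1: "sum c X = 1"
  proof -
    have "sum c X = sum c M" by (rule sums) (simp add: c_def)
    then show ?thesis using m by (simp add: c_def m_def)
  qed
  have d1: "sum d X = 1"
  proof -
    have "sum d X = sum d M" by (rule sums) (simp add: d_def)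
    also have "\<dots> = (\<Sum>x\<in>M. 1 / m + w x / (B * m))" by (simp add: d_def)
    also have "\<dots> = 1 + sum w M / (B * m)"
      using m by (simp add: sum.distrib sum_divide_distrib m_def)
    finally show ?thesis using w by simp
  qed
  have "c v = d v"
  proof (rule unique_combination[of c d])
    show "0 \<le> d x" if "x \<in> X" for x
    proof (cases "x \<in> M")
      case True
      have "- w x / B \<le> 1" using wB[OF True] Bpos by (simp add: field_simps)
      then have "0 \<le> (1 + w x / B) / m" using m by (intro divide_nonneg_pos) (auto simp: minus_divide_left[symmetric])
      then show ?thesis using True by (simp add: d_def add_divide_distrib)
    qed (simp add: d_def)
    show "\<And>x y. \<lbrakk>x \<in> X; y \<in> X; 0 < c x; 0 < c y\<rbrakk> \<Longrightarrow> \<not> inc x y"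
      using assms by (auto simp: c_def coherent_set_def split: if_splits)
    show "\<And>x y. \<lbrakk>x \<in> X; y \<in> X; 0 < d x; 0 < d y\<rbrakk> \<Longrightarrow> \<not> inc x y"
      using assms by (auto simp: d_def coherent_set_def split: if_splits)
    have "(\<Sum>x\<in>X. d x *\<^sub>R x) = (\<Sum>x\<in>M. d x *\<^sub>R x)" by (rule sums) (simp add: d_def)
    also have "\<dots> = (\<Sum>x\<in>M. c x *\<^sub>R x + (1 / (B * m)) *\<^sub>R (w x *\<^sub>R x))"
      by (intro sum.cong) (simp_all add: c_def d_def scaleR_add_left)
    also have "\<dots> = (\<Sum>x\<in>M. c x *\<^sub>R x)"
      using w(3) by (simp only: sum.distrib scaleR_sum_right[symmetric]) simp
    also have "\<dots> = (\<Sum>x\<in>X. c x *\<^sub>R x)" by (rule sums[symmetric]) (simp add: c_def)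
    finally show "(\<Sum>x\<in>X. c x *\<^sub>R x) = (\<Sum>x\<in>X. d x *\<^sub>R x)" by simp
    show "v \<in> X" using v MX by blast
  qed (use c1 d1 m in \<open>auto simp: c_def\<close>)
  then show False using v m Bpos by (auto simp: c_def d_def)
qed

section \<open>Faces of the polytope and the effect of the pulling order\<close>

abbreviation P :: "'a set" where "P \<equiv> convex hull X"

lemma polytope_P: "polytope P"
  using finite_X by (rule polytope_convex_hull)

lemma face_eq_hull:
  assumes "F face_of P"
  shows "F = convex hull (X \<inter> F)"
proof -
  obtain S' where S': "S' \<subseteq> X" "F = convex hull S'"
    using face_of_convex_hull_subset[OF finite_imp_compact[OF finite_X] assms] by blast
  have "S' \<subseteq> X \<inter> F" using S' hull_subset[of S' convex] by simp
  then have "F \<subseteq> convex hull (X \<inter> F)" unfolding S'(2) by (intro hull_mono) (simp add: S'(2))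
  moreover have "convex hull (X \<inter> F) \<subseteq> F"
    using assms face_of_imp_convex by (intro hull_minimal) auto
  ultimately show ?thesis by blast
qed

text \<open>An exchanged pair would have the same midpoint as \<open>x\<close> and \<open>y\<close>.
  This midpoint lies in the face \<open>F\<close>, hence so do the ends of any segment of
  \<open>P\<close> through it, and \<open>x'\<close> would precede \<open>x\<close> in
  \<open>F\<close>.\<close>

lemma earliest_coherent:
  assumes F: "F face_of P" and x: "x \<in> X \<inter> F" "\<And>y. y \<in> X \<inter> F \<Longrightarrow> \<kappa> x \<le> \<kappa> y" and y: "y \<in> X \<inter> F"
  shows "\<not> inc x y"
proof
  assume "inc x y"
  then obtain x' y' where xy: "x' \<in> X" "y' \<in> X" "x + y = x' + y'" "\<kappa> x' < \<kappa> x"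
    using exchange x y by blast
  have P: "x' \<in> P" "y' \<in> P" using xy by (auto intro: hull_inc)
  have "midpoint x y \<in> F"
    using closed_segment_subset[OF _ _ face_of_imp_convex[OF F], of x y] x(1) y
      midpoint_in_closed_segment[of x y] by blast
  then have mid: "midpoint x' y' \<in> F" using xy(3) by (simp add: midpoint_def)
  have "x' \<in> F"
  proof (cases "x' = y'")
    case False
    then show ?thesis using face_ofD[OF F _ P mid] midpoint_in_open_segment[of x' y'] by simp
  qed (use mid in simp)
  then show False using x(2)[of x'] xy by auto
qed

lemma exists_earliest:
  assumes "F face_of P" "F \<noteq> {}"
  obtains x where "x \<in> X \<inter> F" "\<And>y. y \<in> X \<inter> F \<Longrightarrow> \<kappa> x \<le> \<kappa> y"
proof -
  have "X \<inter> F \<noteq> {}" using face_eq_hull[OF assms(1)] assms(2) by (metis convex_hull_empty)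
  then have "\<exists>x. x \<in> X \<inter> F \<and> (\<forall>y. y \<in> X \<inter> F \<longrightarrow> \<kappa> x \<le> \<kappa> y)"
    using ex_has_least_nat[of "\<lambda>x. x \<in> X \<inter> F" _ \<kappa>] by blast
  then show ?thesis using that by blast
qed

lemma hyperface_face: "F face_of P \<Longrightarrow> hyperface F' F \<Longrightarrow> F' face_of P"
  unfolding hyperface_def using face_of_trans by blast

lemma coherent_set_insert_earliest:
  assumes "F face_of P" "x \<in> X \<inter> F" "\<And>y. y \<in> X \<inter> F \<Longrightarrow> \<kappa> x \<le> \<kappa> y"
    and N: "coherent_set N" "N \<subseteq> F"
  shows "coherent_set (insert x N)"
proof (rule coherent_set_insert[OF N(1)])
  show "x \<in> X" using assms(2) by blast
  show "\<not> inc x y" if "y \<in> N" for y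
  proof (rule earliest_coherent[OF assms(1-3)])
    show "y \<in> X \<inter> F" using that N by (auto simp: coherent_set_def)
  qed
qed

lemma cone_covered_by_coherent:
  assumes "z \<in> convex hull (insert x F)" "convex F"
    and "\<And>b. b \<in> F \<Longrightarrow> \<exists>N. coherent_set N \<and> N \<subseteq> F \<and> b \<in> convex hull N"
  obtains N where "coherent_set N" "N \<subseteq> F" "z \<in> convex hull (insert x N)"
proof (cases "F = {}")
  case True
  then show ?thesis using that[of "{}"] assms(1) by (auto simp: coherent_set_def)
next
  case False
  then obtain u w b where u: "0 \<le> u" "0 \<le> w" "u + w = 1" "b \<in> F" "z = u *\<^sub>R x + w *\<^sub>R b"
    using assms(1,2) by (auto simp: convex_hull_insert hull_same)
  obtain N where N: "coherent_set N" "N \<subseteq> F" "b \<in> convex hull N"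
    using assms(3)[OF u(4)] by blast
  have b: "b \<in> convex hull (insert x N)" using N(3) hull_mono[of N "insert x N"] by blast
  have "z \<in> convex hull (insert x N)" unfolding u(5)
    using u by (intro convexD[OF convex_convex_hull _ b]) (auto intro: hull_inc)
  then show ?thesis using that N by blast
qed

text \<open>The point \<open>z\<close> lies in a cone from the earliest point of \<open>F\<close>
  over a hyperface, and a coherent set found in that hyperface stays coherent when the earliest
  point is added.\<close>

lemma face_covered_by_coherent:
  assumes "F face_of P" "z \<in> F"
  shows "\<exists>N. coherent_set N \<and> N \<subseteq> F \<and> z \<in> convex hull N"
  using assms
\<comment> \<open>The empty set has dimension -1; the shift makes the measure drop also from a point
  to its empty hyperface.\<close>
proof (induction "nat (aff_dim F + 1)" arbitrary: F z rule: less_induct)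
  case less
  obtain x where x: "x \<in> X \<inter> F" "\<And>y. y \<in> X \<inter> F \<Longrightarrow> \<kappa> x \<le> \<kappa> y"
    using exists_earliest[OF less.prems(1)] less.prems(2) by blast
  have pF: "polytope F" using face_of_polytope_polytope[OF polytope_P less.prems(1)] .
  obtain F' where F': "hyperface F' F" "x \<notin> F'" "z \<in> convex hull (insert x F')"
    using polytope_cone_cover[OF pF _ less.prems(2), of x] x by blast
  have F'P: "F' face_of P" using hyperface_face less.prems F' by blast
  have sub: "F' \<subseteq> F" using F' hyperface_imp_subset by blast
  have dim: "nat (aff_dim F' + 1) < nat (aff_dim F + 1)"
    using F'(1) aff_dim_geq[of F'] by (simp add: hyperface_def)
  obtain N where N: "coherent_set N" "N \<subseteq> F'" "z \<in> convex hull (insert x N)"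
    using cone_covered_by_coherent[OF F'(3) face_of_imp_convex[OF F'P] less.hyps[OF dim F'P]] by blast
  have "coherent_set (insert x N)"
    using coherent_set_insert_earliest[OF less.prems(1) x N(1)] N(2) sub by blast
  then show ?case using N sub x by (intro exI[of _ "insert x N"]) auto
qed

lemma extends_to_maximal:
  assumes "coherent_set N" "N \<subseteq> A"
  obtains M where "maximal_in A M" "N \<subseteq> M"
proof -
  let ?S = "{M. coherent_set M \<and> M \<subseteq> A \<and> N \<subseteq> M}"
  have fin: "finite ?S" by (rule finite_subset[of _ "Pow X"]) (auto simp: coherent_set_def finite_X)
  have "N \<in> ?S" using assms by simp
  from finite_has_maximal2[OF fin this]
  obtain M where M: "M \<in> ?S" "\<forall>M'\<in>?S. M \<subseteq> M' \<longrightarrow> M = M'"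
    by (elim bexE conjE) (rule that)
  have "maximal_in A M" unfolding maximal_in_def
  proof (intro conjI allI impI)
    fix M' assume "coherent_set M' \<and> M' \<subseteq> A \<and> M \<subseteq> M'"
    then have "M' \<in> ?S" "M \<subseteq> M'" using M(1) by auto
    then show "M' = M" using M(2) by blast
  qed (use M in auto)
  then show ?thesis using that M by blast
qed

text \<open>The point \<open>y\<close> lies in the hull of a coherent set made of \<open>x\<close>
  and points of \<open>F'\<close>, and a point of \<open>X\<close> in such a hull belongs to the
  set. So points pulled later meet the cone only in its base, as \<open>foldl_pull_ext_cone\<close>
  requires.\<close>

lemma vertex_in_cone_base:
  assumes F: "F face_of P" and x: "x \<in> X \<inter> F" "\<And>y. y \<in> X \<inter> F \<Longrightarrow> \<kappa> x \<le> \<kappa> y"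
    and F': "hyperface F' F" and y: "y \<in> X" "y \<noteq> x" "y \<in> convex hull (insert x F')"
  shows "y \<in> F'"
proof -
  have F'P: "F' face_of P" using hyperface_face F F' by blast
  have sub: "F' \<subseteq> F" using F' hyperface_imp_subset by blast
  obtain N where N: "coherent_set N" "N \<subseteq> F'" "y \<in> convex hull (insert x N)"
    using cone_covered_by_coherent[OF y(3) face_of_imp_convex[OF F'P] face_covered_by_coherent[OF F'P]]
    by blast
  have "coherent_set (insert x N)"
    using coherent_set_insert_earliest[OF F x N(1)] N(2) sub by blast
  then have "y \<in> insert x N" using vertex_in_coherent_hull y(1) N(3) by blast
  then show ?thesis using N y by blast
qed

lemma coherent_card_le:
  assumes "coherent_set M" "M \<subseteq> F"
  shows "int (card M) \<le> aff_dim F + 1"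
  using aff_dim_affine_independent[OF coherent_affine_independent[OF assms(1)]] aff_dim_subset[OF assms(2)]
  by simp

text \<open>Claimed for every face, so that the induction over the remaining points applies to the
  hyperfaces of \<open>F\<close>; points outside \<open>F\<close> leave it alone. The cardinality is
  carried along because it is what proves a coherent set maximal after \<open>x\<close> has been
  added.\<close>

lemma pull_ext_face:
  assumes "F face_of P" "X \<inter> F \<subseteq> set ys" "sorted (map \<kappa> ys)" "distinct ys" "set ys \<subseteq> X"
  shows "foldl pull_ext {F} ys = {convex hull M | M. maximal_in F M} \<and>
    (\<forall>M. maximal_in F M \<longrightarrow> int (card M) = aff_dim F + 1)"
  using assms
proof (induction ys arbitrary: F)
  case Nil
  \<comment> \<open>The only coherent set inside the empty face has 0 = -1 + 1 elements.\<close>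
  then have "F = {}" using face_eq_hull[of F] by simp
  then have "maximal_in F M \<longleftrightarrow> M = {}" for M
    unfolding maximal_in_def coherent_set_def by auto
  then show ?case using \<open>F = {}\<close> by auto
next
  case (Cons x ys)
  have ys: "sorted (map \<kappa> ys)" "distinct ys" "set ys \<subseteq> X" using Cons.prems by auto
  show ?case
  proof (cases "x \<in> F")
    case False
    then have "pull_ext {F} x = {F}" by (auto simp: pull_ext_def)
    moreover have "X \<inter> F \<subseteq> set ys" using False Cons.prems(2) by auto
    ultimately show ?thesis using Cons.IH[OF Cons.prems(1) _ ys] by simp
  next
    case True
    then have x: "x \<in> X \<inter> F" using Cons.prems by auto
    have first: "\<kappa> x \<le> \<kappa> y" if "y \<in> X \<inter> F" for y
      using Cons.prems(2,3) that by auto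
    let ?H = "{F'. hyperface F' F \<and> x \<notin> F'}"
    let ?c = "\<lambda>C. convex hull (insert x C)"
    have pF: "polytope F" using face_of_polytope_polytope[OF polytope_P Cons.prems(1)] .
    have step: "pull_ext {F} x = (\<Union>F'\<in>?H. {?c F'})"
      unfolding pull_ext_def using True by auto
    have H: "F' face_of P" "F' \<subseteq> F" "X \<inter> F' \<subseteq> set ys" "x \<notin> affine hull F'" "polytope F'"
      if "F' \<in> ?H" for F'
    proof -
      show face: "F' face_of P" and sub: "F' \<subseteq> F"
        using that hyperface_face[OF Cons.prems(1)] hyperface_imp_subset by auto
      show "X \<inter> F' \<subseteq> set ys" using sub that Cons.prems(2) by auto
      show "x \<notin> affine hull F'"
        using that True notin_affine_hull_face[of F F' x] polytope_imp_convex[OF pF]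
        by (auto simp: hyperface_def)
      show "polytope F'" using face_of_polytope_polytope[OF polytope_P face] .
    qed
    have IH: "foldl pull_ext {F'} ys = {convex hull M | M. maximal_in F' M}"
      "\<And>M. maximal_in F' M \<Longrightarrow> int (card M) = aff_dim F' + 1" if "F' \<in> ?H" for F'
      using Cons.IH[OF H(1)[OF that] H(3)[OF that] ys] by auto
    have cone: "foldl pull_ext {?c F'} ys = ?c ` foldl pull_ext {F'} ys" if F': "F' \<in> ?H" for F'
    proof -
      have "y \<in> F'" if "y \<in> set ys" "y \<in> ?c F'" for y
        using vertex_in_cone_base[OF Cons.prems(1) x first, of F' y] that F' Cons.prems(4,5) by auto
      then show ?thesis
        using foldl_pull_ext_cone[of "{F'}" F' x ys] H[OF F'] by auto
    qed
    have ext: "coherent_set (insert x M)" if "coherent_set M" "M \<subseteq> F" for M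
      by (rule coherent_set_insert_earliest[OF Cons.prems(1) x first that])
    have up: "maximal_in F (insert x M)" "int (card (insert x M)) = aff_dim F + 1"
      if "F' \<in> ?H" "maximal_in F' M" for F' M
    proof -
      have M: "coherent_set M" "M \<subseteq> F'" "M \<subseteq> F" "x \<notin> M" "finite M"
        using that H(2)[OF that(1)] coherent_set_finite by (auto simp: maximal_in_def)
      show card: "int (card (insert x M)) = aff_dim F + 1"
        using IH(2)[OF that] M that(1) by (simp add: hyperface_def)
      \<comment> \<open>By affine independence a coherent subset of \<open>F\<close> has at most
        \<open>aff_dim F + 1\<close> elements, and \<open>insert x M\<close> already has that
        many.\<close>
      have "N = insert x M" if N: "coherent_set N" "N \<subseteq> F" "insert x M \<subseteq> N" for N
        using card coherent_card_le[OF N(1,2)] card_seteq[OF coherent_set_finite[OF N(1)] N(3)] by simp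
      moreover have "coherent_set (insert x M)" by (rule ext[OF M(1,3)])
      moreover have "insert x M \<subseteq> F" using M(3) x by blast
      ultimately show "maximal_in F (insert x M)"
        unfolding maximal_in_def by blast
    qed
    \<comment> \<open>A point recognising \<open>M\<close> lies in a cone over some hyperface, hence
      in the hull of some \<open>insert x N'\<close> covered by \<open>up\<close>. This set then
      contains \<open>M\<close>, and maximality of \<open>M\<close> gives equality.\<close>
    have down: "\<exists>F'\<in>?H. \<exists>M'. maximal_in F' M' \<and> M = insert x M'" if M: "maximal_in F M" for M
    proof -
      have cM: "coherent_set M" "M \<subseteq> F" using M by (auto simp: maximal_in_def)
      have xM: "x \<in> M" using M ext[OF cM] x unfolding maximal_in_def by blast
      obtain z where z: "z \<in> convex hull M" "\<And>N. \<lbrakk>coherent_set N; z \<in> convex hull N\<rbrakk> \<Longrightarrow> M \<subseteq> N"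
        using coherent_interior_point[OF cM(1)] xM by blast
      have "z \<in> F" using z(1) hull_minimal[OF cM(2)] polytope_imp_convex[OF pF] by blast
      then obtain F' where F': "F' \<in> ?H" "z \<in> ?c F'"
        using polytope_cone_cover[OF pF True] by blast
      have F'P: "F' face_of P" using H(1)[OF F'(1)] .
      obtain N where N: "coherent_set N" "N \<subseteq> F'" "z \<in> ?c N"
        using cone_covered_by_coherent[OF F'(2) face_of_imp_convex[OF F'P] face_covered_by_coherent[OF F'P]]
        by blast
      obtain N' where N': "maximal_in F' N'" "N \<subseteq> N'" using extends_to_maximal[OF N(1,2)] .
      have max: "maximal_in F (insert x N')" using up(1)[OF F'(1) N'(1)] .
      have "z \<in> ?c N'" using N(3) N'(2) hull_mono[of "insert x N" "insert x N'"] by blast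
      then have "M \<subseteq> insert x N'" using z(2) max by (auto simp: maximal_in_def)
      then have "insert x N' = M" using M max by (auto simp: maximal_in_def)
      then show ?thesis using F' N' by blast
    qed
    have "foldl pull_ext {F} (x # ys) = (\<Union>F'\<in>?H. foldl pull_ext {?c F'} ys)"
      by (simp only: foldl_Cons step foldl_pull_ext_Union)
    also have "\<dots> = (\<Union>F'\<in>?H. {?c (convex hull M) | M. maximal_in F' M})"
      using cone IH(1) by (intro SUP_cong) auto
    also have "\<dots> = {?c M | M F'. F' \<in> ?H \<and> maximal_in F' M}"
      by (auto simp: hull_insert[symmetric])
    also have "\<dots> = {convex hull M | M. maximal_in F M}"
    proof
      show "{?c M | M F'. F' \<in> ?H \<and> maximal_in F' M} \<subseteq> {convex hull M | M. maximal_in F M}"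
        using up(1) by blast
      show "{convex hull M | M. maximal_in F M} \<subseteq> {?c M | M F'. F' \<in> ?H \<and> maximal_in F' M}"
        using down by blast
    qed
    finally show ?thesis using down up(2) by blast
  qed
qed

lemma maximal_in_hull_iff: "maximal_in P M \<longleftrightarrow> maximal_in X M"
proof -
  have "coherent_set N \<Longrightarrow> N \<subseteq> P \<and> N \<subseteq> X" for N
    using hull_subset[of X convex] by (auto simp: coherent_set_def)
  then show ?thesis unfolding maximal_in_def by blast
qed

theorem is_pulling_triangulation:
  assumes "aff_dim P \<ge> 1"
  shows "is_pulling_triangulation_of {convex hull M | M. maximal_in X M} P"
proof -
  let ?T = "{convex hull M | M. maximal_in X M}"
  obtain xs0 where xs0: "set xs0 = X" "distinct xs0" using finite_distinct_list[OF finite_X] by blast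
  define xs where "xs = sort_key \<kappa> xs0"
  have xs: "set xs = X" "distinct xs" "sorted (map \<kappa> xs)" using xs0 by (simp_all add: xs_def)
  have faceP: "P face_of P" by (simp add: face_of_refl)
  have pull: "foldl pull_ext {P} xs = ?T" and card: "\<And>M. maximal_in X M \<Longrightarrow> int (card M) = aff_dim P + 1"
    using pull_ext_face[OF faceP, of xs] xs unfolding maximal_in_hull_iff by auto
  have max: "coherent_set M" "M \<subseteq> X" if "maximal_in X M" for M
    using that by (auto simp: maximal_in_def)
  have indep: "\<not> affine_dependent M" if "maximal_in X M" for M
    using coherent_affine_independent[OF max(1)[OF that]] .
  have simplex: "aff_dim P simplex (convex hull M)" if "maximal_in X M" for M
    using indep[OF that] card[OF that] by (intro simplex_convex_hull) auto
  have fin: "finite ?T"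
    by (rule finite_subset[of _ "(\<lambda>M. convex hull M) ` Pow X"]) (auto simp: finite_X dest: max(2))
  have cover: "\<Union>?T = P"
  proof
    show "\<Union>?T \<subseteq> P" using hull_mono[OF max(2), where S = convex] by blast
    show "P \<subseteq> \<Union>?T"
    proof
      fix z assume "z \<in> P"
      then obtain N where N: "coherent_set N" "z \<in> convex hull N"
        using face_covered_by_coherent[OF faceP] by blast
      have "N \<subseteq> X" using N(1) by (simp add: coherent_set_def)
      then obtain M where "maximal_in X M" "N \<subseteq> M" using extends_to_maximal[OF N(1)] by blast
      then show "z \<in> \<Union>?T" using hull_mono[of N M convex] N(2) by blast
    qed
  qed
  have inter: "(S \<inter> T) face_of S \<and> S \<inter> T \<noteq> S" if "S \<in> ?T" "T \<in> ?T" "S \<noteq> T" for S T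
  proof -
    obtain M N where MN: "maximal_in X M" "S = convex hull M" "maximal_in X N" "T = convex hull N"
      using \<open>S \<in> ?T\<close> \<open>T \<in> ?T\<close> by blast
    have eq: "S \<inter> T = convex hull (M \<inter> N)"
      unfolding MN by (rule coherent_hull_Int[OF max(1)[OF MN(1)] max(1)[OF MN(3)]])
    have "S \<inter> T \<noteq> S"
    proof
      assume "S \<inter> T = S"
      have "M \<subseteq> N"
      proof
        fix x assume x: "x \<in> M"
        have "x \<in> S" unfolding MN by (rule hull_inc[OF x])
        then have "x \<in> convex hull N" using \<open>S \<inter> T = S\<close> MN(4) by blast
        then show "x \<in> N" using vertex_in_coherent_hull[OF _ max(1)[OF MN(3)], of x] max(2)[OF MN(1)] x by blast
      qed
      then have "N = M" using MN by (auto simp: maximal_in_def)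
      then show False using \<open>S \<noteq> T\<close> MN by blast
    qed
    moreover have "(S \<inter> T) face_of S"
      unfolding eq unfolding MN(2) face_of_convex_hull_affine_independent[OF indep[OF MN(1)]]
      by (rule exI[of _ "M \<inter> N"]) blast
    ultimately show ?thesis by blast
  qed
  have dims: "polytope S \<and> aff_dim S = aff_dim P" if "S \<in> ?T" for S
  proof -
    have "aff_dim P simplex S" using that simplex by blast
    from simplex_imp_polytope[OF this] aff_dim_simplex[OF this] show ?thesis by blast
  qed
  have pairs: "(S \<inter> T) face_of S \<and> S \<inter> T \<noteq> S \<and> (S \<inter> T) face_of T \<and> S \<inter> T \<noteq> T"
    if "S \<in> ?T" "T \<in> ?T" "S \<noteq> T" for S T
    using inter[OF that] inter[OF that(2,1) not_sym[OF that(3)]] unfolding Int_commute[of T S] by blast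
  have "is_subdivision_of ?T P"
    unfolding is_subdivision_of_def
    by (rule conjI[OF fin], rule conjI[OF _ conjI[OF cover]]) (use dims pairs in blast)+
  moreover have "\<forall>S\<in>?T. \<exists>d. d simplex S" using simplex by blast
  moreover have "foldl pull {P} xs = foldl pull_ext {P} xs"
    using polytope_P assms by (intro foldl_pull_eq_pull_ext[of _ "aff_dim P"]) auto
  then have "?T = foldl pull {P} xs" using pull by simp
  moreover have "set xs \<subseteq> P" unfolding xs(1) by (rule hull_subset)
  ultimately show ?thesis
    unfolding is_pulling_triangulation_of_def is_triangulation_of_def
    by (intro conjI exI[of _ xs])
qed

end

subsection \<open>The exchange property of the g-vectors\<close>

text \<open>
  Edge \<open>i\<close> joins the inner vertices \<open>i\<close> and \<open>nxt i\<close>, and \<open>gr i\<close> is the number of the inner route containing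
  it. A vertex is addressed by \<open>i\<close> where it is the first vertex of a block of edges and by \<open>nxt k\<close> where
  it is the last one, so that positions within a block are compared as natural numbers even when
  \<open>nxt N = 1\<close>.
\<close>

locale grouped_edges =
  fixes N n :: nat and gr nxt :: "nat \<Rightarrow> nat" and \<nu> :: "'n::finite \<Rightarrow> nat"
  assumes bij_\<nu>: "bij_betw \<nu> UNIV {1..n}"
    and N_le: "N \<le> n"
    and nxt_in: "i \<in> {1..N} \<Longrightarrow> nxt i \<in> {1..n}"
    and inj_nxt: "inj_on nxt {1..N}"
    and nxt_neq: "\<lbrakk>1 \<le> i; i \<le> k; k \<le> N; gr i = gr k\<rbrakk> \<Longrightarrow> nxt k \<noteq> i"
begin

section \<open>Signed points, conflicts and ranks\<close>

definition block :: "nat \<Rightarrow> nat \<Rightarrow> bool" where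
  "block i k \<longleftrightarrow> 1 \<le> i \<and> i \<le> k \<and> k \<le> N \<and> gr i = gr k"

definition unit_vec :: "nat \<Rightarrow> real ^ 'n" where
  "unit_vec v = axis (inv_into UNIV \<nu> v) 1"

definition co :: "real ^ 'n \<Rightarrow> nat \<Rightarrow> real" where
  "co x v = x $ inv_into UNIV \<nu> v"

definition points :: "(real ^ 'n) set" where
  "points = {0} \<union> (\<lambda>v. - unit_vec v) ` {1..n} \<union> unit_vec ` {1..n} \<union>
     {unit_vec (nxt k) - unit_vec i | i k. block i k}"

text \<open>Crossing along the edges \<open>a..k\<close>: \<open>x\<close> starts at
  \<open>a\<close> and must reach beyond \<open>k\<close>, \<open>y\<close> ends with
  \<open>k\<close> and must start before \<open>a\<close>. An end without a sign satisfies its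
  condition vacuously, so it counts as infinitely far away. For \<open>a = v\<close> the common part
  is a single vertex. The relation is one-sided; \<open>incoherent\<close> symmetrises it.\<close>

definition conf :: "real ^ 'n \<Rightarrow> real ^ 'n \<Rightarrow> bool" where
  "conf x y \<longleftrightarrow> (\<exists>a\<in>{1..n}. \<exists>v\<in>{1..n}. co x a = -1 \<and> co y v = 1 \<and>
     (a = v \<or> (\<exists>k. v = nxt k \<and> block a k \<and>
        (\<forall>k'. block a k' \<and> co x (nxt k') = 1 \<longrightarrow> k < k') \<and>
        (\<forall>a'. block a' k \<and> co y a' = -1 \<longrightarrow> a' < a))))"

definition incoherent :: "real ^ 'n \<Rightarrow> real ^ 'n \<Rightarrow> bool" where
  "incoherent x y \<longleftrightarrow> conf x y \<or> conf y x"

text \<open>A vertex that is no \<open>nxt k\<close> is treated as the successor of a fictitious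
  edge 0, whence \<open>N + 1\<close>; for such a vertex only positivity matters.\<close>

definition head_rank :: "nat \<Rightarrow> nat" where
  "head_rank v = (if v \<in> nxt ` {1..N} then N + 1 - inv_into {1..N} nxt v else N + 1)"

text \<open>
  \<open>rank\<close> is additive on \<open>- unit_vec a\<close> (of rank \<open>a\<close>) and \<open>unit_vec (nxt k)\<close> (of rank \<open>N + 1 - k\<close>), so that
  all cases of the exchange come down to comparing \<open>a\<close>'s and \<open>k\<close>'s.
\<close>

definition rank :: "real ^ 'n \<Rightarrow> nat" where
  "rank x = (\<Sum>v\<in>{1..n}. if co x v = -1 then v else if co x v = 1 then head_rank v else 0)"

lemma blockD: "block i k \<Longrightarrow> i \<in> {1..n}" "block i k \<Longrightarrow> nxt k \<in> {1..n}" "block i k \<Longrightarrow> nxt k \<noteq> i"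
    "block i k \<Longrightarrow> k \<in> {1..N}"
  using N_le nxt_in[of k] nxt_neq[of i k] by (auto simp: block_def)

lemma inv_\<nu>: "v \<in> {1..n} \<Longrightarrow> \<nu> (inv_into UNIV \<nu> v) = v"
  using bij_\<nu> f_inv_into_f[of v \<nu> UNIV] by (auto simp: bij_betw_def)

lemma co_unit: "\<lbrakk>v \<in> {1..n}; w \<in> {1..n}\<rbrakk> \<Longrightarrow> co (unit_vec v) w = (if v = w then 1 else 0)"
  unfolding co_def unit_vec_def axis_def using inv_\<nu>[of v] inv_\<nu>[of w] by auto

lemma co_simps [simp]: "co 0 v = 0" "co (- x) v = - co x v" "co (x - y) v = co x v - co y v"
    "co (x + y) v = co x v + co y v"
  by (simp_all add: co_def)

lemma finite_points: "finite points"
proof -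
  have "{unit_vec (nxt k) - unit_vec i | i k. block i k} \<subseteq>
      (\<lambda>(i, k). unit_vec (nxt k) - unit_vec i) ` ({1..n} \<times> {1..N})"
    using blockD by force
  then have "finite {unit_vec (nxt k) - unit_vec i | i k. block i k}" by (rule finite_subset) simp
  then show ?thesis by (simp add: points_def)
qed

lemma points_cases:
  assumes "x \<in> points"
  obtains "x = 0" | v where "v \<in> {1..n}" "x = - unit_vec v" | v where "v \<in> {1..n}" "x = unit_vec v"
    | i k where "block i k" "x = unit_vec (nxt k) - unit_vec i"
  using assms unfolding points_def by blast

lemma co_block:
  assumes "block i k" "v \<in> {1..n}"
  shows "co (unit_vec (nxt k) - unit_vec i) v = (if v = nxt k then 1 else if v = i then -1 else 0)"
  using blockD[OF assms(1)] assms(2) by (simp add: co_unit)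

lemma points_co: "\<lbrakk>x \<in> points; v \<in> {1..n}\<rbrakk> \<Longrightarrow> co x v \<in> {-1, 0, 1}"
  by (erule points_cases) (auto simp: co_unit co_block simp del: co_simps(3))

lemma points_tail_cases:
  assumes "x \<in> points" "a \<in> {1..n}" "co x a = -1"
  obtains "x = - unit_vec a" | k where "block a k" "x = unit_vec (nxt k) - unit_vec a"
  using assms
  by (elim points_cases) (auto simp: co_unit co_block simp del: co_simps(3) split: if_splits)

lemma points_head_cases:
  assumes "x \<in> points" "v \<in> {1..n}" "co x v = 1"
  obtains "x = unit_vec v" | i k where "block i k" "v = nxt k" "x = unit_vec v - unit_vec i"
  using assms
  by (elim points_cases) (auto simp: co_unit co_block simp del: co_simps(3) split: if_splits)

lemma head_rank_nxt: "k \<in> {1..N} \<Longrightarrow> head_rank (nxt k) = N + 1 - k"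
  using inj_nxt by (simp add: head_rank_def)

lemma head_rank_pos: "head_rank v > 0"
  using inv_into_into[of v nxt "{1..N}"] by (auto simp: head_rank_def)

lemma rank_zero: "rank 0 = 0"
  by (simp add: rank_def)

lemma rank_tail: "a \<in> {1..n} \<Longrightarrow> rank (- unit_vec a) = a"
proof -
  assume a: "a \<in> {1..n}"
  have "rank (- unit_vec a) = (\<Sum>v\<in>{1..n}. if v = a then v else 0)"
    unfolding rank_def using a by (intro sum.cong) (auto simp: co_unit)
  then show ?thesis using a by simp
qed

lemma rank_head: "a \<in> {1..n} \<Longrightarrow> rank (unit_vec a) = head_rank a"
proof -
  assume a: "a \<in> {1..n}"
  have "rank (unit_vec a) = (\<Sum>v\<in>{1..n}. if v = a then head_rank v else 0)"
    unfolding rank_def using a by (intro sum.cong) (auto simp: co_unit)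
  then show ?thesis using a by simp
qed

lemma rank_block: "block i k \<Longrightarrow> rank (unit_vec (nxt k) - unit_vec i) = i + (N + 1 - k)"
proof -
  assume a: "block i k"
  note d = blockD[OF a]
  have "rank (unit_vec (nxt k) - unit_vec i) =
      (\<Sum>v\<in>{1..n}. (if v = i then v else 0) + (if v = nxt k then head_rank v else 0))"
    unfolding rank_def using d by (intro sum.cong) (auto simp: co_unit)
  also have "\<dots> = i + head_rank (nxt k)" using d by (simp add: sum.distrib)
  finally show ?thesis using head_rank_nxt[OF d(4)] by simp
qed

lemma block_trans: "\<lbrakk>block a k; block a' k; block a k'; a' < a; k < k'\<rbrakk> \<Longrightarrow> block a' k'"
  by (auto simp: block_def)

lemma in_points: "0 \<in> points" "v \<in> {1..n} \<Longrightarrow> unit_vec v \<in> points" "v \<in> {1..n} \<Longrightarrow> - unit_vec v \<in> points"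
    "block i k \<Longrightarrow> unit_vec (nxt k) - unit_vec i \<in> points"
  unfolding points_def by auto

text \<open>If \<open>a = v\<close>, the opposite signs cancel and the remaining signs are
  distributed over two points. Otherwise the crossing is resolved: \<open>x'\<close> takes the
  earlier start of \<open>y\<close> and the later end of \<open>x\<close>, omitting a sign where it
  is missing, and \<open>y'\<close> is the block \<open>a..k\<close>. Compared with \<open>x\<close>
  the start of \<open>x'\<close> has become cheaper, compared with \<open>y\<close> the end, so its
  rank is below both.\<close>

lemma conf_exchange:
  assumes "x \<in> points" "y \<in> points" "conf x y"
  shows "\<exists>x'\<in>points. \<exists>y'\<in>points. x + y = x' + y' \<and> rank x' < rank x \<and> rank x' < rank y"
proof -
  obtain a v where av: "a \<in> {1..n}" "v \<in> {1..n}" "co x a = -1" "co y v = 1" and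
    or: "a = v \<or> (\<exists>k. v = nxt k \<and> block a k \<and>
        (\<forall>k'. block a k' \<and> co x (nxt k') = 1 \<longrightarrow> k < k') \<and>
        (\<forall>a'. block a' k \<and> co y a' = -1 \<longrightarrow> a' < a))"
    using assms(3) unfolding conf_def by blast
  have goalI: "\<exists>x'\<in>points. \<exists>y'\<in>points. x + y = x' + y' \<and> rank x' < rank x \<and> rank x' < rank y"
    if "x' \<in> points" "y' \<in> points" "x + y = x' + y'" "rank x' < rank x" "rank x' < rank y" for x' y'
    using that by blast
  from points_tail_cases[OF assms(1) av(1,3)] consider
    (X1) "x = - unit_vec a" | (X2) k1 where "block a k1" "x = unit_vec (nxt k1) - unit_vec a" by metis
  note xc = this
  from points_head_cases[OF assms(2) av(2,4)] consider
    (Y1) "y = unit_vec v" | (Y2) i2 k2 where "block i2 k2" "v = nxt k2" "y = unit_vec v - unit_vec i2" by metis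
  note yc = this
  show ?thesis
  proof (cases "a = v")
    case True
    from xc show ?thesis
    proof cases
      case X1
      from yc show ?thesis
      proof cases
        case Y1
        show ?thesis
          by (rule goalI[of 0 0]) (use X1 Y1 True av in \<open>simp_all add: in_points rank_zero rank_tail rank_head head_rank_pos\<close>)
      next
        case Y2
        show ?thesis
          by (rule goalI[of 0 "- unit_vec i2"])
            (use X1 Y2 True av blockD[OF Y2(1)] in \<open>auto simp: in_points rank_zero rank_tail rank_block\<close>)
      qed
    next
      case X2
      from yc show ?thesis
      proof cases
        case Y1
        show ?thesis
          by (rule goalI[of 0 "unit_vec (nxt k1)"])
            (use X2 Y1 True av blockD[OF X2(1)] in \<open>auto simp: in_points rank_zero rank_head rank_block head_rank_pos\<close>)
      next
        case Y2
        note d1 = blockD[OF X2(1)] and d2 = blockD[OF Y2(1)]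
        have rx: "rank x = a + (N + 1 - k1)" and ry: "rank y = i2 + (N + 1 - k2)"
          using X2 Y2 rank_block by auto
        have rt: "rank (- unit_vec i2) = i2" using d2 rank_tail by blast
        have rh: "rank (unit_vec (nxt k1)) = N + 1 - k1" using d1 rank_head head_rank_nxt by simp
        have sum: "x + y = - unit_vec i2 + unit_vec (nxt k1)" using X2 Y2 True by simp
        show ?thesis
        \<comment> \<open>Nothing relates the two leftover signs, so the one of smaller rank is
          chosen as \<open>x'\<close>.\<close>
        proof (cases "i2 \<le> N + 1 - k1")
          case True
          show ?thesis
            by (rule goalI[of "- unit_vec i2" "unit_vec (nxt k1)"])
              (use True sum rx ry rt d1 d2 av in \<open>auto simp: in_points\<close>)
        next
          case False
          show ?thesis
            by (rule goalI[of "unit_vec (nxt k1)" "- unit_vec i2"])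
              (use False sum rx ry rh d1 d2 av in \<open>auto simp: in_points\<close>)
        qed
      qed
    qed
  next
    case False
    then obtain k where k: "v = nxt k" "block a k"
      "\<And>k'. \<lbrakk>block a k'; co x (nxt k') = 1\<rbrakk> \<Longrightarrow> k < k'" "\<And>a'. \<lbrakk>block a' k; co y a' = -1\<rbrakk> \<Longrightarrow> a' < a"
      using or by blast
    note d = blockD[OF k(2)]
    from xc show ?thesis
    proof cases
      case X1
      from yc show ?thesis
      proof cases
        case Y1
        show ?thesis
          by (rule goalI[of 0 "unit_vec v - unit_vec a"])
            (use X1 Y1 k(1,2) av in \<open>auto simp: in_points rank_zero rank_tail rank_head head_rank_pos\<close>)
      next
        case Y2
        note d2 = blockD[OF Y2(1)]
        have "k2 = k" using k(1) Y2(2) d d2 inj_nxt by (auto dest: inj_onD)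
        then have Y: "block i2 k" "y = unit_vec (nxt k) - unit_vec i2" using Y2 by auto
        have "co y i2 = -1" using Y d2 d by (auto simp: co_unit blockD)
        then have "i2 < a" using k(4) Y by blast
        then show ?thesis
          by (intro goalI[of "- unit_vec i2" "unit_vec (nxt k) - unit_vec a"])
            (use X1 Y k(1,2) d d2 in \<open>auto simp: in_points rank_tail rank_block\<close>)
      qed
    next
      case X2
      note d1 = blockD[OF X2(1)]
      have "co x (nxt k1) = 1" using X2 d1 av by (auto simp: co_unit)
      then have "k < k1" using k(3) X2 by blast
      from yc show ?thesis
      proof cases
        case Y1
        show ?thesis
          by (rule goalI[of "unit_vec (nxt k1)" "unit_vec (nxt k) - unit_vec a"])
            (use X2 Y1 k(1,2) d d1 \<open>k < k1\<close> in \<open>auto simp: in_points rank_head rank_block head_rank_nxt\<close>)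
      next
        case Y2
        note d2 = blockD[OF Y2(1)]
        have "k2 = k" using k(1) Y2(2) d d2 inj_nxt by (auto dest: inj_onD)
        then have Y: "block i2 k" "y = unit_vec (nxt k) - unit_vec i2" using Y2 by auto
        have "co y i2 = -1" using Y d2 d by (auto simp: co_unit blockD)
        then have "i2 < a" using k(4) Y by blast
        have A: "block i2 k1" using block_trans[OF k(2) Y(1) X2(1) \<open>i2 < a\<close> \<open>k < k1\<close>] .
        show ?thesis
          by (rule goalI[of "unit_vec (nxt k1) - unit_vec i2" "unit_vec (nxt k) - unit_vec a"])
            (use X2 Y k(1,2) d d1 d2 \<open>k < k1\<close> \<open>i2 < a\<close> A in \<open>auto simp: in_points rank_block\<close>)
      qed
    qed
  qed
qed

lemma conf_irrefl:
  assumes "x \<in> points"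
  shows "\<not> conf x x"
proof
  assume "conf x x"
  then obtain a v where av: "a \<in> {1..n}" "v \<in> {1..n}" "co x a = -1" "co x v = 1" and
    or: "a = v \<or> (\<exists>k. v = nxt k \<and> block a k \<and> (\<forall>k'. block a k' \<and> co x (nxt k') = 1 \<longrightarrow> k < k'))"
    unfolding conf_def by blast
  have "a \<noteq> v" using av by auto
  then show False using or av by auto
qed

lemma same_tail_conf: "\<lbrakk>v \<in> {1..n}; co x v = -1; co y v = 1\<rbrakk> \<Longrightarrow> conf x y"
  unfolding conf_def by blast

section \<open>Uniqueness of coherent combinations\<close>

definition coherent_weights :: "(real ^ 'n \<Rightarrow> real) \<Rightarrow> bool" where
  "coherent_weights c \<longleftrightarrow> (\<forall>x\<in>points. 0 \<le> c x) \<and>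
     (\<forall>x\<in>points. \<forall>y\<in>points. 0 < c x \<longrightarrow> 0 < c y \<longrightarrow> \<not> incoherent x y)"

lemma co_combination: "co (\<Sum>x\<in>points. c x *\<^sub>R x) v = (\<Sum>x\<in>points. c x * co x v)"
  by (simp add: co_def)

text \<open>Opposite signs at \<open>v\<close> already conflict, so the points carrying weight do
  not disagree there and nothing cancels in coordinate \<open>v\<close>.\<close>

lemma coherent_weights_sign:
  assumes "coherent_weights c" "x \<in> points" "0 < c x" "v \<in> {1..n}" "co x v = s" "s \<in> {-1, 1}"
  shows "\<And>y. y \<in> points \<Longrightarrow> c y > 0 \<Longrightarrow> co y v \<noteq> - s" "(\<Sum>x\<in>points. c x * co x v) * s > 0"
proof -
  show sgn: "co y v \<noteq> - s" if y: "y \<in> points" "c y > 0" for y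
  proof
    assume "co y v = - s"
    then have "incoherent x y"
      using assms same_tail_conf[of v x y] same_tail_conf[of v y x] by (auto simp: incoherent_def)
    then show False using assms y by (auto simp: coherent_weights_def)
  qed
  have "0 < (\<Sum>x\<in>points. c x * co x v * s)"
  proof (rule sum_pos2[OF finite_points assms(2)])
    show "0 < c x * co x v * s" using assms by auto
    show "0 \<le> c y * co y v * s" if "y \<in> points" for y
    proof (cases "c y > 0")
      case True
      have "co y v \<in> {-1, 0, 1}" using points_co that assms by blast
      then show ?thesis using True sgn[OF that True] assms(6) by auto
    next
      case False
      then have "c y = 0" using assms(1) that by (force simp: coherent_weights_def)
      then show ?thesis by simp
    qed
  qed
  then show "(\<Sum>x\<in>points. c x * co x v) * s > 0" by (simp add: sum_distrib_right)
qed

text \<open>Coordinate \<open>v\<close> of the common value has the sign \<open>s\<close>, so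
  neither \<open>c\<close> nor \<open>d\<close> gives weight to points of sign \<open>- s\<close>.
  The total weights of sign \<open>s\<close> then agree, and the excess of \<open>c\<close> at
  \<open>x\<close> must be compensated.\<close>

lemma opposite_difference:
  assumes c: "coherent_weights c" and d: "coherent_weights d"
    and eq: "(\<Sum>x\<in>points. c x *\<^sub>R x) = (\<Sum>x\<in>points. d x *\<^sub>R x)"
    and x: "x \<in> points" "c x > d x" "v \<in> {1..n}" "co x v = s" "s \<in> {-1, 1}"
  shows "\<exists>y\<in>points. c y < d y \<and> co y v = s"
proof (rule ccontr)
  assume no: "\<not> ?thesis"
  have cx: "c x > 0" using d x by (force simp: coherent_weights_def)
  note sc = coherent_weights_sign[OF c x(1) cx x(3-5)]
  have sums: "(\<Sum>x\<in>points. c x * co x v) = (\<Sum>x\<in>points. d x * co x v)"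
    using arg_cong[OF eq, of "\<lambda>z. co z v"] by (simp only: co_combination)
  have sd: "co y v \<noteq> - s" if "y \<in> points" "d y > 0" for y
  proof
    assume y: "co y v = - s"
    have "(\<Sum>x\<in>points. d x * co x v) * (- s) > 0"
      by (rule coherent_weights_sign(2)[OF d that x(3) y]) (use x(5) in auto)
    then show False using sc(2) sums by simp
  qed
  have "0 < (\<Sum>y\<in>points. (c y - d y) * co y v * s)"
  proof (rule sum_pos2[OF finite_points x(1)])
    show "0 < (c x - d x) * co x v * s" using x by auto
    show "0 \<le> (c y - d y) * co y v * s" if y: "y \<in> points" for y
    proof -
      consider "co y v = s" | "co y v = 0" | "co y v = - s" using points_co[OF y x(3)] x(5) by auto
      then show ?thesis
      proof cases
        case 1
        then have "c y \<ge> d y" using no y by force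
        then show ?thesis using 1 x(5) by auto
      next
        case 3
        then have "c y = 0" "d y = 0"
          using sc(1)[OF y] sd[OF y] c d y by (force simp: coherent_weights_def)+
        then show ?thesis by simp
      qed simp
    qed
  qed
  moreover have "(\<Sum>y\<in>points. (c y - d y) * co y v * s) = 0"
    using sums by (simp add: sum_distrib_right[symmetric] left_diff_distrib sum_subtractf)
  ultimately show False by simp
qed

text \<open>
  If \<open>c\<close> exceeds \<open>d\<close> on a shortest block, then \<open>d\<close> exceeds \<open>c\<close> on a point with the same tail and on a point
  with the same head, and these two points conflict.
\<close>

lemma block_coefficient_le:
  assumes c: "coherent_weights c" and d: "coherent_weights d"
    and eq: "(\<Sum>x\<in>points. c x *\<^sub>R x) = (\<Sum>x\<in>points. d x *\<^sub>R x)"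
    and block: "block a k"
    and short: "\<And>i j. \<lbrakk>block i j; j - i < k - a\<rbrakk> \<Longrightarrow>
      c (unit_vec (nxt j) - unit_vec i) = d (unit_vec (nxt j) - unit_vec i)"
  shows "c (unit_vec (nxt k) - unit_vec a) \<le> d (unit_vec (nxt k) - unit_vec a)"
proof (rule ccontr)
  let ?x = "unit_vec (nxt k) - unit_vec a"
  assume "\<not> c ?x \<le> d ?x"
  then have gt: "c ?x > d ?x" by simp
  note A = blockD[OF block]
  have x: "?x \<in> points" by (rule in_points(4)[OF block])
  have cox: "co ?x a = -1" "co ?x (nxt k) = 1" using A by (auto simp: co_unit)
  obtain y where y: "y \<in> points" "c y < d y" "co y a = -1"
    using opposite_difference[OF c d eq x gt A(1) cox(1)] by auto
  obtain z where z: "z \<in> points" "c z < d z" "co z (nxt k) = 1"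
    using opposite_difference[OF c d eq x gt A(2) cox(2)] by auto
  \<comment> \<open>Such a \<open>y\<close> is the block \<open>a..k'\<close>. As \<open>d\<close>
    exceeds \<open>c\<close> on it, it is not the block \<open>a..k\<close>, and by
    \<open>short\<close> it is no shorter one.\<close>
  have "k < k'" if k': "block a k'" "co y (nxt k') = 1" for k'
  proof -
    have "y = unit_vec (nxt k') - unit_vec a"
      using points_tail_cases[OF y(1) A(1) y(3)]
    proof cases
      case 1
      then show ?thesis using k' A blockD[OF k'(1)] by (auto simp: co_unit split: if_splits)
    next
      case (2 k'')
      then have "nxt k'' = nxt k'"
        using k' blockD[OF k'(1)] blockD[OF 2(1)] by (auto simp: co_unit split: if_splits)
      then show ?thesis using 2 by simp
    qed
    then have "k' \<noteq> k" "\<not> k' - a < k - a" using y(2) gt short[OF k'(1)] by auto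
    then show ?thesis using k' block by (auto simp: block_def)
  qed
  moreover have "a' < a" if a': "block a' k" "co z a' = -1" for a'
  proof -
    have "z = unit_vec (nxt k) - unit_vec a'"
      using points_tail_cases[OF z(1) blockD(1)[OF a'(1)] a'(2)]
    proof cases
      case 1
      then show ?thesis using z A a' blockD[OF a'(1)] by (auto simp: co_unit split: if_splits)
    next
      case (2 k'')
      then have "nxt k'' = nxt k"
        using z(3) blockD[OF a'(1)] blockD[OF 2(1)] by (auto simp: co_unit split: if_splits)
      then show ?thesis using 2 by simp
    qed
    then have "a' \<noteq> a" "\<not> k - a' < k - a" using z(2) gt short[OF a'(1)] by auto
    then show ?thesis using a' block by (auto simp: block_def)
  qed
  ultimately have "conf y z"
    unfolding conf_def using y z A block by blast
  moreover have "d y > 0" "d z > 0" using c y z by (force simp: coherent_weights_def)+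
  ultimately show False using d y z by (auto simp: coherent_weights_def incoherent_def)
qed

lemma block_coefficient_unique:
  assumes c: "coherent_weights c" and d: "coherent_weights d"
    and eq: "(\<Sum>x\<in>points. c x *\<^sub>R x) = (\<Sum>x\<in>points. d x *\<^sub>R x)"
    and block: "block a k"
  shows "c (unit_vec (nxt k) - unit_vec a) = d (unit_vec (nxt k) - unit_vec a)"
  using block
proof (induction "k - a" arbitrary: a k rule: less_induct)
  case less
  show ?case
  proof (rule antisym)
    show "c (unit_vec (nxt k) - unit_vec a) \<le> d (unit_vec (nxt k) - unit_vec a)"
      by (rule block_coefficient_le[OF c d eq less.prems]) (use less.hyps in auto)
    show "d (unit_vec (nxt k) - unit_vec a) \<le> c (unit_vec (nxt k) - unit_vec a)"
      by (rule block_coefficient_le[OF d c eq[symmetric] less.prems]) (use less.hyps in auto)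
  qed
qed

text \<open>The coefficients of blocks are already known to agree, and apart from blocks only
  \<open>x\<close> has its sign at \<open>v\<close>; the compensating point would be
  \<open>x\<close> itself.\<close>

lemma unit_coefficient_le:
  assumes c: "coherent_weights c" and d: "coherent_weights d"
    and eq: "(\<Sum>x\<in>points. c x *\<^sub>R x) = (\<Sum>x\<in>points. d x *\<^sub>R x)"
    and v: "v \<in> {1..n}" and x: "x \<in> {unit_vec v, - unit_vec v}"
  shows "c x \<le> d x"
proof (rule ccontr)
  assume "\<not> c x \<le> d x"
  then have gt: "c x > d x" by simp
  define s where "s = co x v"
  have s: "s \<in> {-1, 1}" "x = s *\<^sub>R unit_vec v" using x v by (auto simp: s_def co_unit)
  have "x \<in> points" using x v in_points by auto
  then obtain y where y: "y \<in> points" "c y < d y" "co y v = s"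
    using opposite_difference[OF c d eq _ gt v s_def[symmetric] s(1)] by blast
  have blocks: "y \<noteq> unit_vec (nxt k) - unit_vec i" if "block i k" for i k
    using block_coefficient_unique[OF c d eq that] y(2) by auto
  have "y = x"
  proof (cases "s = 1")
    case True
    then show ?thesis using points_head_cases[OF y(1) v] y(3) blocks s(2) by (metis scaleR_one)
  next
    case False
    then have "s = -1" using s by auto
    then show ?thesis using points_tail_cases[OF y(1) v] y(3) blocks s(2)
      by (metis scaleR_minus_left scaleR_one)
  qed
  then show False using gt y(2) by simp
qed

lemma coefficients_unique:
  assumes c: "coherent_weights c" and d: "coherent_weights d"
    and eq: "(\<Sum>x\<in>points. c x *\<^sub>R x) = (\<Sum>x\<in>points. d x *\<^sub>R x)"
    and "sum c points = 1" "sum d points = 1" "x \<in> points"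
  shows "c x = d x"
proof -
  have nz: "c y = d y" if "y \<in> points" "y \<noteq> 0" for y
    using that(1)
  proof (cases rule: points_cases)
    case 1
    then show ?thesis using that by simp
  next
    case (2 v)
    then show ?thesis using unit_coefficient_le[OF c d eq 2(1), of y]
        unit_coefficient_le[OF d c eq[symmetric] 2(1), of y] by simp
  next
    case (3 v)
    then show ?thesis using unit_coefficient_le[OF c d eq 3(1), of y]
        unit_coefficient_le[OF d c eq[symmetric] 3(1), of y] by simp
  next
    case (4 i k)
    then show ?thesis using block_coefficient_unique[OF c d eq] by blast
  qed
  \<comment> \<open>The origin does not contribute to the combination; its coefficient is recovered
    from the total weight 1.\<close>
  have "sum c (points - {0}) = sum d (points - {0})" using nz by (intro sum.cong) auto
  then have "c 0 = d 0"
    using assms(4,5) sum.remove[OF finite_points in_points(1), of c]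
      sum.remove[OF finite_points in_points(1), of d] by simp
  then show ?thesis using nz assms(6) by (cases "x = 0") auto
qed

sublocale exchange_complex points incoherent rank
proof
  show "finite points" by (rule finite_points)
  show "incoherent x y \<Longrightarrow> incoherent y x" for x y by (auto simp: incoherent_def)
  show "x \<in> points \<Longrightarrow> \<not> incoherent x x" for x using conf_irrefl by (simp add: incoherent_def)
  show "\<exists>x'\<in>points. \<exists>y'\<in>points. x + y = x' + y' \<and> rank x' < rank x \<and> rank x' < rank y"
    if "x \<in> points" "y \<in> points" "incoherent x y" for x y
    using that(3) unfolding incoherent_def
  proof
    assume "conf y x"
    from conf_exchange[OF that(2,1) this] show ?thesis by (metis add.commute)
  qed (rule conf_exchange[OF that(1,2)])
qed (auto intro!: coefficients_unique simp: coherent_weights_def)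

lemma aff_dim_points:
  assumes "n \<ge> 1"
  shows "aff_dim (convex hull points) \<ge> 1"
proof -
  have "unit_vec 1 \<in> points" using in_points assms by simp
  moreover have "unit_vec 1 \<noteq> 0" by (simp add: unit_vec_def)
  ultimately have "\<not> points \<subseteq> {x}" for x using in_points(1) by auto
  then have "aff_dim points \<noteq> -1 \<and> aff_dim points \<noteq> 0"
    using in_points(1) by (auto simp: aff_dim_empty[symmetric] aff_dim_eq_0)
  then show ?thesis using aff_dim_geq[of points] by (simp add: aff_dim_convex_hull)
qed

end

subsection \<open>Inner routes\<close>

lemma upt_split: "\<lbrakk>i \<le> j; j \<le> k\<rbrakk> \<Longrightarrow> [i..<k] = [i..<j] @ [j..<k]"
  using upt_add_eq_append[of i j "k - j"] by simp

locale chain_dag =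
  fixes ks :: "nat list" and n :: nat and nxt :: "nat \<Rightarrow> nat"
  assumes ks_nonempty: "ks \<noteq> []" and ks_pos: "\<forall>k\<in>set ks. k > 0"
    and shape: "n = sum_list ks + 1 \<and> nxt = (\<lambda>i. i + 1) \<or>
      even (length ks) \<and> n = sum_list ks \<and> nxt = (\<lambda>i. if i = sum_list ks then 1 else i + 1)"
begin

abbreviation N :: nat where "N \<equiv> sum_list ks"
abbreviation gr :: "nat \<Rightarrow> nat" where "gr \<equiv> group_no ks"
abbreviation etail :: "nat \<Rightarrow> nat" where "etail \<equiv> alternating_tail ks nxt"
abbreviation ehead :: "nat \<Rightarrow> nat" where "ehead \<equiv> alternating_head ks nxt"

definition G :: dag where "G = make_full n N etail ehead"
definition offset :: "nat \<Rightarrow> nat" where "offset j = sum_list (take j ks)"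

section \<open>Groups of inner edges and the successor map\<close>

lemma offset_0: "offset 0 = 0" and offset_length: "offset (length ks) = N"
  by (simp_all add: offset_def)

lemma offset_Suc: "j < length ks \<Longrightarrow> offset j < offset (Suc j)"
  using ks_pos by (simp add: offset_def take_Suc_conv_app_nth)

lemma offset_mono: "j \<le> j' \<Longrightarrow> offset j \<le> offset j'"
proof -
  assume "j \<le> j'"
  then have "take j' ks = take j ks @ take (j' - j) (drop j ks)"
    by (metis le_add_diff_inverse take_add)
  then show ?thesis by (simp add: offset_def)
qed

lemma offset_strict: "\<lbrakk>j < j'; j' \<le> length ks\<rbrakk> \<Longrightarrow> offset j < offset j'"
  using offset_Suc[of j] offset_mono[of "Suc j" j'] by simp

lemma gr_le: "i \<le> offset j \<Longrightarrow> gr i \<le> j"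
  unfolding group_no_def offset_def by (rule Least_le)

lemma gr_bounds:
  assumes "i \<in> {1..N}"
  shows "1 \<le> gr i" "gr i \<le> length ks" "offset (gr i - 1) < i" "i \<le> offset (gr i)"
proof -
  show "gr i \<le> length ks" using assms by (intro gr_le) (simp add: offset_length)
  show le: "i \<le> offset (gr i)"
    unfolding group_no_def offset_def by (rule LeastI[of _ "length ks"]) (use assms in simp)
  show ge: "1 \<le> gr i" using le assms offset_0 by (cases "gr i") auto
  show "offset (gr i - 1) < i" using gr_le[of i "gr i - 1"] ge by linarith
qed

lemma gr_unique:
  assumes "1 \<le> j" "offset (j - 1) < i" "i \<le> offset j"
  shows "gr i = j"
proof (rule antisym)
  show "gr i \<le> j" by (rule gr_le[OF assms(3)])
  have "i \<le> offset (gr i)"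
    unfolding group_no_def offset_def by (rule LeastI[of _ j]) (use assms in \<open>simp add: offset_def\<close>)
  then show "j \<le> gr i" using offset_mono[of "gr i" "j - 1"] assms by linarith
qed

lemma gr_mono: "\<lbrakk>i \<le> k; k \<in> {1..N}\<rbrakk> \<Longrightarrow> gr i \<le> gr k"
  using gr_bounds(4)[of k] by (intro gr_le) simp

lemma gr_Suc: "\<lbrakk>i \<in> {1..N}; Suc i \<le> N\<rbrakk> \<Longrightarrow> gr (Suc i) \<le> Suc (gr i)"
proof (cases "gr i = length ks")
  case True
  assume "i \<in> {1..N}" "Suc i \<le> N"
  then show ?thesis using True gr_bounds(2)[of "Suc i"] by simp
next
  case False
  assume i: "i \<in> {1..N}" "Suc i \<le> N"
  then have "offset (gr i) < offset (Suc (gr i))" using False gr_bounds(2)[OF i(1)] by (intro offset_Suc) simp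
  then show ?thesis using gr_bounds(4)[OF i(1)] by (intro gr_le) simp
qed

lemma N_pos: "N \<ge> 1"
  using offset_strict[of 0 "length ks"] ks_nonempty offset_0 offset_length by simp

lemma gr_1: "gr 1 = 1"
  using offset_strict[of 0 1] ks_nonempty offset_0 by (intro gr_unique) (auto simp: Suc_le_eq)

lemma gr_N: "gr N = length ks"
  using offset_strict[of "length ks - 1" "length ks"] ks_nonempty offset_length
  by (intro gr_unique) (auto simp: Suc_le_eq)

lemma N_le: "N \<le> n"
  using shape by auto

lemma nxt_eq: "nxt i = Suc i \<or> i = N \<and> nxt i = 1 \<and> even (length ks)"
proof -
  from shape consider "nxt = (\<lambda>i. i + 1)" | "nxt = (\<lambda>i. if i = N then 1 else i + 1)" "even (length ks)"
    by blast
  then show ?thesis by cases simp_all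
qed

lemma nxt_in: "i \<in> {1..N} \<Longrightarrow> nxt i \<in> {1..n}"
proof -
  assume i: "i \<in> {1..N}"
  from shape consider "nxt = (\<lambda>i. i + 1)" "n = N + 1"
    | "nxt = (\<lambda>i. if i = N then 1 else i + 1)" "n = N" by blast
  then show ?thesis using i by cases auto
qed

lemma inj_nxt: "inj_on nxt {1..N}"
proof (rule inj_onI)
  fix i j assume "i \<in> {1..N}" "j \<in> {1..N}" "nxt i = nxt j"
  then show "i = j" using nxt_eq[of i] nxt_eq[of j] by auto
qed

lemma nxt_Suc: "i < N \<Longrightarrow> nxt i = Suc i"
  using nxt_eq[of i] by auto

text \<open>The wrap-around step leads from an even group to group 1, so it never stays within one
  group. This parity is how later arguments dispose of the difference between path and
  cycle.\<close>

lemma nxt_cases: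
  assumes "i \<in> {1..N}" "j \<in> {1..N}" "nxt i = j"
  shows "j = Suc i \<or> i = N \<and> j = 1 \<and> even (gr N)"
  using nxt_eq[of i] gr_N assms by auto

lemma nxt_neq:
  assumes "1 \<le> i" "i \<le> k" "k \<le> N" "gr i = gr k"
  shows "nxt k \<noteq> i"
proof
  assume "nxt k = i"
  then have "k = N" "i = 1" "even (gr N)" using nxt_cases[of k i] assms by auto
  then show False using assms(4) gr_1 by simp
qed

text \<open>Adjacent groups have opposite parity, also across the wrap-around, and where they meet
  both edges enter or both leave. A walk therefore never changes its group.\<close>

lemma edge_step:
  assumes "i \<in> {1..N}" "j \<in> {1..N}" "ehead i = etail j"
  shows "gr i = gr j \<and> (if odd (gr i) then j = Suc i else i = Suc j)"
proof (cases "odd (gr i)")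
  case oi: True
  show ?thesis
  proof (cases "odd (gr j)")
    case True
    then have "nxt i = j" using oi assms(3) by (simp add: alternating_head_def alternating_tail_def)
    then have j: "j = Suc i" using nxt_cases[OF assms(1,2)] oi by auto
    then have "gr i \<le> gr j" "gr j \<le> Suc (gr i)" using gr_mono[of i j] gr_Suc[of i] assms by auto
    then have "gr i = gr j" using oi True by (cases "gr j = Suc (gr i)") auto
    then show ?thesis using oi j by simp
  next
    case False
    then have "nxt i = nxt j" using oi assms(3) by (simp add: alternating_head_def alternating_tail_def)
    then have "i = j" using inj_onD[OF inj_nxt] assms by blast
    then show ?thesis using oi False by simp
  qed
next
  case ei: False
  show ?thesis
  proof (cases "odd (gr j)")
    case True
    then have "i = j" using ei assms(3) by (simp add: alternating_head_def alternating_tail_def)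
    then show ?thesis using ei True by simp
  next
    case False
    then have "nxt j = i" using ei assms(3) by (simp add: alternating_head_def alternating_tail_def)
    moreover have "\<not> (j = N \<and> i = 1)" using ei gr_1 by auto
    ultimately have i: "i = Suc j" using nxt_cases[OF assms(2,1)] by blast
    then have "gr j \<le> gr i" "gr i \<le> Suc (gr j)" using gr_mono[of j i] gr_Suc[of j] assms by auto
    then have "gr i = gr j" using ei False by (cases "gr i = Suc (gr j)") auto
    then show ?thesis using ei i by simp
  qed
qed

lemma gr_between: "\<lbrakk>1 \<le> i; i \<le> j; j \<le> k; k \<le> N; gr i = gr k\<rbrakk> \<Longrightarrow> gr j = gr k"
  using gr_mono[of i j] gr_mono[of j k] by auto

section \<open>Directed walks in the inner graph\<close>

lemma G_simps [simp]:
  "tail G (Inner_Edge i) = Inner (etail i)" "head G (Inner_Edge i) = Inner (ehead i)"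
  "tail G (Source_Edge v c) = Source" "head G (Source_Edge v c) = Inner v"
  "tail G (Sink_Edge v c) = Inner v" "head G (Sink_Edge v c) = Sink"
  "Inner_Edge i \<in> arcs G \<longleftrightarrow> i \<in> {1..N}"
  "verts G = {Source, Sink} \<union> Inner ` {1..n}"
  by (auto simp: G_def make_full_def)

lemma arcs_G_vertex: "Source_Edge v c \<in> arcs G \<Longrightarrow> v \<in> {1..n}" "Sink_Edge v c \<in> arcs G \<Longrightarrow> v \<in> {1..n}"
  by (auto simp: G_def make_full_def)

lemma edge_ends: "i \<in> {1..N} \<Longrightarrow> etail i \<in> {1..n}" "i \<in> {1..N} \<Longrightarrow> ehead i \<in> {1..n}"
  using nxt_in[of i] N_le by (auto simp: alternating_head_def alternating_tail_def)

lemma inner_verts_G: "inner_verts G = Inner ` {1..n}"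
  by (auto simp: inner_verts_def)

abbreviation casG where "casG \<equiv> pre_digraph.cas G"
declare pre_digraph.cas.simps [simp]
declare pre_digraph.awalk_verts.simps [simp]

lemma casG_append: "casG u (p @ q) v \<longleftrightarrow> (\<exists>w. casG u p w \<and> casG w q v)"
  by (induction p arbitrary: u) auto

definition directed :: "nat \<Rightarrow> nat \<Rightarrow> nat list" where
  "directed i k = (if odd (gr i) then [i..<Suc k] else rev [i..<Suc k])"

lemma set_directed: "set (directed i k) = {i..k}"
  by (auto simp: directed_def)

definition is_block :: "nat \<Rightarrow> nat \<Rightarrow> bool" where
  "is_block i k \<longleftrightarrow> 1 \<le> i \<and> i \<le> k \<and> k \<le> N \<and> gr i = gr k"

definition entry :: "nat \<Rightarrow> nat \<Rightarrow> nat" where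
  "entry i k = (if odd (gr i) then i else nxt k)"

definition exit :: "nat \<Rightarrow> nat \<Rightarrow> nat" where
  "exit i k = (if odd (gr i) then nxt k else i)"

text \<open>By \<open>edge_step\<close> a new first edge extends the interval by one, at its lower
  end in an odd group and at its upper end in an even one.\<close>

lemma inner_chain:
  assumes "casG u (map Inner_Edge is) v" "set is \<subseteq> {1..N}" "is \<noteq> []"
  obtains i k where "is_block i k" "is = directed i k" "u = Inner (entry i k)" "v = Inner (exit i k)"
proof -
  have "\<exists>i k. is_block i k \<and> is = directed i k \<and> u = Inner (entry i k) \<and> v = Inner (exit i k)"
    using assms
  proof (induction "is" arbitrary: u)
    case (Cons a js)
    show ?case
    proof (cases "js = []")
      case True
      then show ?thesis using Cons.prems
        by (intro exI[of _ a]) (auto simp: is_block_def directed_def entry_def exit_def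
            alternating_tail_def alternating_head_def)
    next
      case False
      have a: "a \<in> {1..N}" and u: "u = Inner (etail a)" using Cons.prems by auto
      obtain i k where ik: "is_block i k" "js = directed i k" "Inner (ehead a) = Inner (entry i k)"
          "v = Inner (exit i k)"
        using Cons.IH[of "Inner (ehead a)"] Cons.prems False by auto
      have b: "i \<in> {1..N}" "k \<in> {1..N}" "i \<le> k" "gr i = gr k" using ik(1) by (auto simp: is_block_def)
      show ?thesis
      proof (cases "odd (gr i)")
        case True
        then have "ehead a = etail i" using ik(3) by (simp add: entry_def alternating_tail_def)
        then have st: "gr a = gr i" "i = Suc a" using edge_step[OF a b(1)] True by auto
        then have "a # js = directed a k"
          using True ik(2) b(3) by (simp add: directed_def upt_conv_Cons)
        moreover have "is_block a k" using st a b by (auto simp: is_block_def)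
        ultimately show ?thesis using u ik(4) st True
          by (intro exI[of _ a] exI[of _ k]) (auto simp: entry_def exit_def alternating_tail_def)
      next
        case False
        then have "ehead a = etail k" using ik(3) b(4) by (simp add: entry_def alternating_tail_def)
        then have st: "gr a = gr k" "a = Suc k" using edge_step[OF a b(2)] False b(4) by auto
        then have "a # js = directed i a"
          using False ik(2) b(3) by (simp add: directed_def)
        moreover have "is_block i a" using st a b by (auto simp: is_block_def)
        ultimately show ?thesis using u ik(4) st False b(4)
          by (intro exI[of _ i] exI[of _ a]) (auto simp: entry_def exit_def alternating_tail_def)
      qed
    qed
  qed simp
  then show ?thesis using that by blast
qed

lemma casG_right:
  "\<lbrakk>i \<le> k; k \<le> N; 1 \<le> i; gr i = gr k; odd (gr i)\<rbrakk> \<Longrightarrow>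
    casG (Inner i) (map Inner_Edge [i..<Suc k]) (Inner (nxt k))"
proof (induction k rule: dec_induct)
  case base
  then show ?case by (simp add: alternating_tail_def alternating_head_def)
next
  case (step k)
  have g: "gr k = gr (Suc k)" using gr_between[of i k "Suc k"] step.hyps step.prems by simp
  then have IH: "casG (Inner i) (map Inner_Edge [i..<Suc k]) (Inner (Suc k))"
    using step nxt_Suc[of k] by simp
  have "odd (gr (Suc k))" using step.prems by simp
  then have "casG (Inner (Suc k)) [Inner_Edge (Suc k)] (Inner (nxt (Suc k)))"
    by (simp add: alternating_tail_def alternating_head_def)
  moreover have "map Inner_Edge [i..<Suc (Suc k)] = map Inner_Edge [i..<Suc k] @ [Inner_Edge (Suc k)]"
    using step.hyps by simp
  ultimately show ?case using IH casG_append by metis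
qed

lemma casG_left:
  "\<lbrakk>i \<le> k; k \<le> N; 1 \<le> i; gr i = gr k; even (gr i)\<rbrakk> \<Longrightarrow>
    casG (Inner (nxt k)) (map Inner_Edge (rev [i..<Suc k])) (Inner i)"
proof (induction k rule: dec_induct)
  case base
  then show ?case by (simp add: alternating_tail_def alternating_head_def)
next
  case (step k)
  have g: "gr k = gr (Suc k)" using gr_between[of i k "Suc k"] step.hyps step.prems by simp
  then have IH: "casG (Inner (Suc k)) (map Inner_Edge (rev [i..<Suc k])) (Inner i)"
    using step nxt_Suc[of k] by simp
  have "even (gr (Suc k))" using step.prems by simp
  then have "tail G (Inner_Edge (Suc k)) = Inner (nxt (Suc k))" "head G (Inner_Edge (Suc k)) = Inner (Suc k)"
    by (simp_all add: alternating_tail_def alternating_head_def)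
  moreover have "map Inner_Edge (rev [i..<Suc (Suc k)]) = Inner_Edge (Suc k) # map Inner_Edge (rev [i..<Suc k])"
    using step.hyps by simp
  ultimately show ?case using IH by (simp only: pre_digraph.cas.simps)
qed

lemma casG_directed: "is_block i k \<Longrightarrow> casG (Inner (entry i k)) (map Inner_Edge (directed i k)) (Inner (exit i k))"
  using casG_right[of i k] casG_left[of i k]
  by (auto simp: is_block_def directed_def entry_def exit_def)

lemma gr_in_block: "\<lbrakk>is_block i k; j \<in> {i..k}\<rbrakk> \<Longrightarrow> gr j = gr i"
  using gr_between[of i j k] by (auto simp: is_block_def)

lemma block_subset: "is_block i k \<Longrightarrow> {i..k} \<subseteq> {1..N}"
  by (auto simp: is_block_def)

lemma etail_in_block: "\<lbrakk>is_block i k; j \<in> {i..k}\<rbrakk> \<Longrightarrow> etail j = (if odd (gr i) then j else nxt j)"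
  unfolding alternating_tail_def by (simp only: gr_in_block)

lemma nxt_in_block: "\<lbrakk>is_block i k; j \<in> {i..k}\<rbrakk> \<Longrightarrow> nxt k \<noteq> j \<and> nxt j \<noteq> i"
  using gr_in_block[of i k j] nxt_neq[of j k] nxt_neq[of i j] by (simp add: is_block_def)

text \<open>In an odd group the tails are the edge indices themselves, in an even group their
  successors; the exit is none of them because no block closes up (\<open>nxt_neq\<close>).\<close>

lemma directed_vertices:
  assumes "is_block i k"
  shows "distinct (map etail (directed i k) @ [exit i k])" "set (map etail (directed i k)) \<subseteq> {1..n}"
proof -
  show "set (map etail (directed i k)) \<subseteq> {1..n}"
    using edge_ends(1) block_subset[OF assms] by (auto simp: set_directed)
  show "distinct (map etail (directed i k) @ [exit i k])"
  proof (cases "odd (gr i)")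
    case True
    then have "map etail (directed i k) = directed i k"
      using etail_in_block[OF assms] by (intro map_idI) (simp add: set_directed)
    moreover have "nxt k \<notin> {i..k}" using nxt_in_block[OF assms] by blast
    ultimately show ?thesis using True by (simp only: distinct_append set_directed) (auto simp: directed_def exit_def)
  next
    case False
    then have eq: "map etail (directed i k) = map nxt (directed i k)"
      using etail_in_block[OF assms] by (intro map_cong refl) (simp add: set_directed)
    have "i \<notin> nxt ` {i..k}" using nxt_in_block[OF assms] by blast
    moreover have "inj_on nxt {i..k}" using inj_nxt block_subset[OF assms] by (rule inj_on_subset)
    moreover have "distinct (directed i k)" by (simp add: directed_def)
    ultimately show ?thesis using False
      unfolding eq distinct_append distinct_map set_map set_directed by (simp add: exit_def)
  qed
qed

lemma inner_graph_simps:
  "tail (inner_graph G) = tail G" "head (inner_graph G) = head G"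
  "verts (inner_graph G) = Inner ` {1..n}" "arcs (inner_graph G) = Inner_Edge ` {1..N}"
proof -
  show "tail (inner_graph G) = tail G" "head (inner_graph G) = head G"
    by (simp_all add: inner_graph_def)
  show "verts (inner_graph G) = Inner ` {1..n}"
    by (simp add: inner_graph_def inner_verts_G)
  have "a \<in> Inner_Edge ` {1..N}" if "a \<in> arcs G" "tail G a \<in> Inner ` {1..n}" "head G a \<in> Inner ` {1..n}" for a
    using that by (cases a) auto
  moreover have "tail G (Inner_Edge i) \<in> Inner ` {1..n}" "head G (Inner_Edge i) \<in> Inner ` {1..n}"
    if "i \<in> {1..N}" for i using edge_ends that by auto
  ultimately show "arcs (inner_graph G) = Inner_Edge ` {1..N}"
    by (auto simp: inner_graph_def induce_subgraph_def inner_verts_G)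
qed

lemma cas_inner_graph: "pre_digraph.cas (inner_graph G) u p v = casG u p v"
  by (induction p arbitrary: u) (auto simp: inner_graph_simps)

lemma inner_apath_iff:
  "(\<exists>u v. pre_digraph.apath (inner_graph G) u p v) \<longleftrightarrow>
     p = [] \<or> (\<exists>i k. is_block i k \<and> p = map Inner_Edge (directed i k))"
proof
  assume "\<exists>u v. pre_digraph.apath (inner_graph G) u p v"
  then obtain u v where uv: "set p \<subseteq> Inner_Edge ` {1..N}" "casG u p v"
    by (auto simp: pre_digraph.apath_def pre_digraph.awalk_def cas_inner_graph inner_graph_simps)
  have "p \<in> lists (Inner_Edge ` {1..N})" using uv(1) by (simp add: in_lists_conv_set subset_iff)
  then obtain js where js: "p = map Inner_Edge js" "set js \<subseteq> {1..N}"
    by (auto simp: lists_image)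
  show "p = [] \<or> (\<exists>i k. is_block i k \<and> p = map Inner_Edge (directed i k))"
  proof (cases "js = []")
    case False
    obtain i k where "is_block i k" "js = directed i k"
      using inner_chain[OF uv(2)[unfolded js(1)] js(2) False] .
    then show ?thesis using js by blast
  qed (use js in simp)
next
  assume "p = [] \<or> (\<exists>i k. is_block i k \<and> p = map Inner_Edge (directed i k))"
  then show "\<exists>u v. pre_digraph.apath (inner_graph G) u p v"
  proof
    assume p: "p = []"
    have "Inner 1 \<in> verts (inner_graph G)" using N_pos N_le by (auto simp: inner_graph_simps)
    then show ?thesis using p
      by (intro exI[of _ "Inner 1"]) (auto simp: pre_digraph.apath_def pre_digraph.awalk_def)
  next
    assume "\<exists>i k. is_block i k \<and> p = map Inner_Edge (directed i k)"
    then obtain i k where b: "is_block i k" and p: "p = map Inner_Edge (directed i k)" by blast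
    have ne: "directed i k \<noteq> []" using b by (auto simp: directed_def is_block_def)
    have lst: "ehead (last (directed i k)) = exit i k"
    proof -
      have "last (directed i k) = (if odd (gr i) then k else i)"
        using b by (auto simp: directed_def is_block_def last_rev hd_upt upt_conv_Cons)
      then show ?thesis using b by (auto simp: exit_def alternating_head_def is_block_def)
    qed
    have verts: "pre_digraph.awalk_verts (inner_graph G) u p = map Inner (map etail (directed i k) @ [exit i k])" for u
      unfolding pre_digraph.awalk_verts_conv p using ne by (auto simp: inner_graph_simps last_map lst)
    have "Inner (entry i k) \<in> verts (inner_graph G)"
      using b nxt_in[of k] N_le by (auto simp: inner_graph_simps entry_def is_block_def)
    moreover have "distinct (map Inner (map etail (directed i k) @ [exit i k]))"
      unfolding distinct_map using directed_vertices(1)[OF b] by (auto simp: inj_on_def)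
    moreover have "set p \<subseteq> arcs (inner_graph G)"
      using block_subset[OF b] by (auto simp: p set_directed inner_graph_simps)
    ultimately have "pre_digraph.apath (inner_graph G) (Inner (entry i k)) p (Inner (exit i k))"
      using casG_directed[OF b] verts
      by (simp add: pre_digraph.apath_def pre_digraph.awalk_def cas_inner_graph p[symmetric])
    then show ?thesis by blast
  qed
qed

section \<open>Inner routes and their numbering\<close>

definition group_route :: "nat \<Rightarrow> dag_edge awalk" where
  "group_route j = map Inner_Edge (directed (offset (j - 1) + 1) (offset j))"

lemma group_block:
  assumes "j \<in> {1..length ks}"
  shows "is_block (offset (j - 1) + 1) (offset j)" "gr (offset (j - 1) + 1) = j" "gr (offset j) = j"
proof -
  have lt: "offset (j - 1) < offset j" using assms by (intro offset_strict) auto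
  have "gr (offset (j - 1) + 1) = j" "gr (offset j) = j" using assms lt by (auto intro!: gr_unique)
  moreover have "offset j \<le> N" using offset_mono[of j "length ks"] offset_length assms by simp
  ultimately show "is_block (offset (j - 1) + 1) (offset j)" "gr (offset (j - 1) + 1) = j" "gr (offset j) = j"
    using lt by (auto simp: is_block_def)
qed

definition inner_walk :: "dag_edge awalk \<Rightarrow> bool" where
  "inner_walk p \<longleftrightarrow> p = [] \<or> (\<exists>i k. is_block i k \<and> p = map Inner_Edge (directed i k))"

lemma inner_routes_iff:
  "p \<in> inner_routes G \<longleftrightarrow> inner_walk p \<and> (\<forall>ps qs. inner_walk (ps @ p @ qs) \<longrightarrow> ps = [] \<and> qs = [])"
  unfolding inner_routes_def mem_Collect_eq inner_apath_iff inner_walk_def by (rule refl)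

lemma inner_walk_group_route: "j \<in> {1..length ks} \<Longrightarrow> inner_walk (group_route j)"
  using group_block(1) by (auto simp: inner_walk_def group_route_def)

lemma group_route_nonempty: "j \<in> {1..length ks} \<Longrightarrow> group_route j \<noteq> []"
  using group_block(1)[of j] by (auto simp: group_route_def directed_def is_block_def)

text \<open>A block sits inside the interval of its group with a rest \<open>A\<close> below and
  \<open>B\<close> above, and maximality makes both rests empty. Conversely, an extension of a whole
  group is a block of the same group and cannot be longer.\<close>

lemma inner_routes_G: "inner_routes G = group_route ` {1..length ks}"
proof
  show "inner_routes G \<subseteq> group_route ` {1..length ks}"
  proof
    fix p assume p: "p \<in> inner_routes G"
    then have path: "inner_walk p"
      and max: "\<And>ps qs. inner_walk (ps @ p @ qs) \<Longrightarrow> ps = [] \<and> qs = []"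
      by (simp_all add: inner_routes_iff)
    have 1: "1 \<in> {1..length ks}" using ks_nonempty by (simp add: Suc_le_eq)
    \<comment> \<open>The empty walk counts as a path too, but every group extends it.\<close>
    have "p \<noteq> []"
    proof
      assume "p = []"
      then show False
        using max[of "[]" "group_route 1"] inner_walk_group_route[OF 1] group_route_nonempty[OF 1] by simp
    qed
    then obtain i k where b: "is_block i k" and pe: "p = map Inner_Edge (directed i k)"
      using path unfolding inner_walk_def by blast
    let ?j = "gr i"
    have i: "i \<in> {1..N}" "k \<in> {1..N}" "i \<le> k" using b by (auto simp: is_block_def)
    have j: "?j \<in> {1..length ks}" using gr_bounds[OF i(1)] by simp
    have lo: "offset (?j - 1) + 1 \<le> i" using gr_bounds(3)[OF i(1)] by simp
    have hi: "k \<le> offset ?j" using gr_bounds(4)[OF i(2)] b by (simp add: is_block_def)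
    define A where "A = [offset (?j - 1) + 1..<i]"
    define B where "B = [Suc k..<Suc (offset ?j)]"
    have split: "[offset (?j - 1) + 1..<Suc (offset ?j)] = A @ [i..<Suc k] @ B"
    proof -
      have 1: "[offset (?j - 1) + 1..<Suc (offset ?j)] = A @ [i..<Suc (offset ?j)]"
        unfolding A_def using lo hi i(3) by (intro upt_split) auto
      have 2: "[i..<Suc (offset ?j)] = [i..<Suc k] @ B"
        unfolding B_def using hi i(3) by (intro upt_split) auto
      show ?thesis unfolding 1 2 by (rule refl)
    qed
    have "\<exists>ps qs. group_route ?j = ps @ p @ qs"
    proof (cases "odd ?j")
      case True
      have "group_route ?j = map Inner_Edge A @ p @ map Inner_Edge B"
        using True unfolding group_route_def directed_def group_block(2)[OF j] pe split by simp
      then show ?thesis by blast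
    next
      case False
      have "group_route ?j = map Inner_Edge (rev B) @ p @ map Inner_Edge (rev A)"
        using False unfolding group_route_def directed_def group_block(2)[OF j] pe split by simp
      then show ?thesis by blast
    qed
    then obtain ps qs where eq: "group_route ?j = ps @ p @ qs" by blast
    then have "ps = [] \<and> qs = []"
      using inner_walk_group_route[OF j] by (intro max) simp
    then show "p \<in> group_route ` {1..length ks}" using eq j by (intro image_eqI[of _ _ ?j]) auto
  qed
next
  show "group_route ` {1..length ks} \<subseteq> inner_routes G"
  proof
    fix p assume "p \<in> group_route ` {1..length ks}"
    then obtain j where j: "j \<in> {1..length ks}" "p = group_route j" by blast
    note gb = group_block[OF j(1)]
    have "ps = [] \<and> qs = []" if ext: "inner_walk (ps @ p @ qs)" for ps qs
    proof -
      have pne: "offset j \<in> {offset (j - 1) + 1..offset j}" using gb(1) by (auto simp: is_block_def)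
      then have "Inner_Edge (offset j) \<in> set p" by (auto simp: j group_route_def set_directed)
      then have "ps @ p @ qs \<noteq> []" by auto
      then obtain i k where b: "is_block i k" and eq: "ps @ p @ qs = map Inner_Edge (directed i k)"
        using ext unfolding inner_walk_def by blast
      have "Inner_Edge (offset j) \<in> set (map Inner_Edge (directed i k))"
        using \<open>Inner_Edge (offset j) \<in> set p\<close> unfolding eq[symmetric] by simp
      then have "offset j \<in> {i..k}" by (auto simp: set_directed)
      then have gi: "gr i = j" using gr_in_block[OF b, of "offset j"] gb(3) by simp
      have ik: "i \<in> {1..N}" "k \<in> {1..N}" "i \<le> k" "gr k = j" using b gi by (auto simp: is_block_def)
      have "offset (j - 1) < i" "k \<le> offset j" using gr_bounds[OF ik(1)] gr_bounds[OF ik(2)] gi ik(4) by auto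
      then have "length (directed i k) \<le> length (directed (offset (j - 1) + 1) (offset j))"
        by (auto simp: directed_def)
      then have "length (ps @ p @ qs) \<le> length p" unfolding eq by (simp add: j group_route_def)
      then show ?thesis by simp
    qed
    then show "p \<in> inner_routes G"
      using inner_walk_group_route[OF j(1)] by (simp add: inner_routes_iff j)
  qed
qed

lemma first_index_group_route:
  assumes "j \<in> {1..length ks}"
  shows "first_index (group_route j) = offset (j - 1) + 1"
proof -
  have "{i. Inner_Edge i \<in> set (group_route j)} = {offset (j - 1) + 1..offset j}"
    by (auto simp: group_route_def set_directed)
  moreover have "offset (j - 1) + 1 \<le> offset j" using group_block(1)[OF assms] by (simp add: is_block_def)
  ultimately show ?thesis unfolding first_index_def by (auto intro!: Min_eqI)
qed

lemma inner_route_no_group_route: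
  assumes j: "j \<in> {1..length ks}"
  shows "inner_route_no G (group_route j) = j"
proof -
  have le: "first_index (group_route i) \<le> first_index (group_route j) \<longleftrightarrow> i \<le> j"
    if "i \<in> {1..length ks}" "j \<in> {1..length ks}" for i j
    using offset_strict[of "j - 1" "i - 1"] offset_mono[of "i - 1" "j - 1"] that
    by (simp add: first_index_group_route) linarith
  have "{q \<in> inner_routes G. first_index q \<le> first_index (group_route j)} = group_route ` {1..j}"
    unfolding inner_routes_G using le[OF _ j] j by auto
  moreover have "inj_on group_route {1..j}"
  proof (rule inj_onI)
    fix i i' assume i: "i \<in> {1..j}" "i' \<in> {1..j}" "group_route i = group_route i'"
    then show "i = i'" using le[of i i'] le[of i' i] j by auto
  qed
  ultimately show ?thesis unfolding inner_route_no_def by (simp add: card_image)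
qed

end

subsection \<open>Routes and their labels\<close>

lemma adjacent_cases:
  assumes "s # zs @ [t] = p @ [a, b] @ q" "zs \<noteq> []"
  shows "a = s \<and> b = hd zs \<or> a = last zs \<and> b = t \<or> a \<in> set zs \<and> b \<in> set zs"
proof (cases p)
  case Nil
  then have "a = s" "zs @ [t] = b # q" using assms(1) by auto
  then show ?thesis using assms(2) by (cases zs) auto
next
  case (Cons x p')
  then have eq: "zs @ [t] = p' @ [a, b] @ q" using assms(1) by simp
  show ?thesis
  proof (cases q rule: rev_cases)
    case Nil
    then have "zs @ [t] = (p' @ [a]) @ [b]" using eq by simp
    then have "zs = p' @ [a]" "t = b" by (simp_all only: append1_eq_conv)
    then show ?thesis by simp
  next
    case (snoc q' x)
    then have "zs @ [t] = (p' @ [a, b] @ q') @ [x]" using eq by simp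
    then have "zs = p' @ [a, b] @ q'" by (simp only: append1_eq_conv)
    then show ?thesis by simp
  qed
qed

text \<open>All letters of \<open>zs\<close> have value 2, so the letter of value 1 before
  \<open>m\<close> can only be \<open>s\<close>. Hence \<open>m\<close> is a prefix of
  \<open>zs\<close>, followed by another letter of \<open>zs\<close> or by \<open>t\<close>.\<close>

lemma factor_up_iff:
  fixes f :: "'b \<Rightarrow> nat"
  assumes "\<And>z. z \<in> set zs \<Longrightarrow> f z = 2" "m \<noteq> []"
  shows "(\<exists>p a b q. s # zs @ [t] = p @ [a] @ m @ [b] @ q \<and> f a = 1 \<and> f b = 2) \<longleftrightarrow>
    f s = 1 \<and> ((\<exists>q. q \<noteq> [] \<and> zs = m @ q) \<or> zs = m \<and> f t = 2)" (is "?L \<longleftrightarrow> ?R")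
proof
  assume ?L
  then obtain p a b q where eq: "s # zs @ [t] = p @ [a] @ m @ [b] @ q" "f a = 1" "f b = 2" by blast
  have qcase: "(\<exists>p''. zs = p' @ m @ [b] @ p'') \<or> zs = p' @ m \<and> t = b" if "zs @ [t] = p' @ m @ [b] @ q" for p'
  proof (cases q rule: rev_cases)
    case Nil
    then have "zs @ [t] = (p' @ m) @ [b]" using that by simp
    then have "zs = p' @ m" "t = b" by (simp_all only: append1_eq_conv)
    then show ?thesis by simp
  next
    case (snoc q' x)
    then have "zs @ [t] = (p' @ m @ [b] @ q') @ [x]" using that by simp
    then have "zs = p' @ m @ [b] @ q'" by (simp only: append1_eq_conv)
    then show ?thesis by blast
  qed
  show ?R
  proof (cases p)
    case Nil
    then have "a = s" "zs @ [t] = [] @ m @ [b] @ q" using eq(1) by auto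
    then show ?thesis using qcase[of "[]"] eq(2,3) by fastforce
  next
    case (Cons x p')
    then have "zs @ [t] = (p' @ [a]) @ m @ [b] @ q" using eq(1) by simp
    from qcase[OF this] have "a \<in> set zs" by auto
    then show ?thesis using assms(1) eq(2) by fastforce
  qed
next
  assume R: ?R
  then have fs: "f s = 1" by blast
  from R have "(\<exists>q. q \<noteq> [] \<and> zs = m @ q) \<or> zs = m \<and> f t = 2" by blast
  then show ?L
  proof
    assume "\<exists>q. q \<noteq> [] \<and> zs = m @ q"
    then obtain b q where "zs = m @ b # q" by (metis neq_Nil_conv)
    then have "s # zs @ [t] = [] @ [s] @ m @ [b] @ q @ [t]" "f b = 2" using assms(1)[of b] by auto
    then show ?L using fs by blast
  next
    assume "zs = m \<and> f t = 2"
    then have "s # zs @ [t] = [] @ [s] @ m @ [t] @ []" "f t = 2" by auto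
    then show ?L using fs by blast
  qed
qed

lemma rev_factor_iff:
  "(\<exists>p a b q. R = p @ [a] @ m @ [b] @ q \<and> P a \<and> Q b) \<longleftrightarrow>
   (\<exists>p b a q. rev R = p @ [b] @ rev m @ [a] @ q \<and> Q b \<and> P a)" (is "?L \<longleftrightarrow> ?R")
proof
  assume ?L
  then obtain p a b q where "R = p @ [a] @ m @ [b] @ q" "P a" "Q b" by blast
  then have "rev R = rev q @ [b] @ rev m @ [a] @ rev p" by simp
  then show ?R using \<open>P a\<close> \<open>Q b\<close> by blast
next
  assume ?R
  then obtain p b a q where eq: "rev R = p @ [b] @ rev m @ [a] @ q" "Q b" "P a" by blast
  have "R = rev (rev R)" by simp
  also have "\<dots> = rev q @ [a] @ m @ [b] @ rev p" unfolding eq(1) by simp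
  finally show ?L using eq by blast
qed

lemma factor_down_iff:
  fixes f :: "'b \<Rightarrow> nat"
  assumes "\<And>z. z \<in> set zs \<Longrightarrow> f z = 2" "m \<noteq> []"
  shows "(\<exists>p a b q. s # zs @ [t] = p @ [a] @ m @ [b] @ q \<and> f a = 2 \<and> f b = 1) \<longleftrightarrow>
    f t = 1 \<and> ((\<exists>p. p \<noteq> [] \<and> zs = p @ m) \<or> zs = m \<and> f s = 2)"
proof -
  have "(\<exists>q. q \<noteq> [] \<and> rev zs = rev m @ q) \<longleftrightarrow> (\<exists>p. p \<noteq> [] \<and> zs = p @ m)"
    by (metis rev_append rev_rev_ident rev_is_Nil_conv)
  then show ?thesis
    unfolding rev_factor_iff[of "s # zs @ [t]" m]
    using factor_up_iff[of "rev zs" f "rev m" t s] assms by simp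
qed

lemma prefix_upt_iff:
  assumes "m \<noteq> []" "inj f"
  shows "(\<exists>q. q \<noteq> [] \<and> map f [i..<Suc k] = m @ q) \<longleftrightarrow> (\<exists>w. i \<le> w \<and> w < k \<and> m = map f [i..<Suc w])"
proof
  assume "\<exists>q. q \<noteq> [] \<and> map f [i..<Suc k] = m @ q"
  then obtain q where q: "q \<noteq> []" "map f [i..<Suc k] = m @ q" by blast
  have len: "Suc k - i = length m + length q" using arg_cong[OF q(2), of length] by (simp del: upt_Suc)
  have lm: "length m > 0" "length q > 0" using assms q by auto
  have le: "i + length m \<le> Suc k" "i + length m - 1 < k" "i \<le> i + length m - 1" using len lm by arith+
  have "m = take (length m) (map f [i..<Suc k])" unfolding q(2) by simp
  also have "\<dots> = map f [i..<i + length m]" using le by (simp add: take_map take_upt del: upt_Suc)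
  finally have "m = map f [i..<Suc (i + length m - 1)]" using lm by simp
  moreover note le
  ultimately show "\<exists>w. i \<le> w \<and> w < k \<and> m = map f [i..<Suc w]" by blast
next
  assume "\<exists>w. i \<le> w \<and> w < k \<and> m = map f [i..<Suc w]"
  then obtain w where w: "i \<le> w" "w < k" "m = map f [i..<Suc w]" by blast
  then have "map f [i..<Suc k] = m @ map f [Suc w..<Suc k]"
    using upt_split[of i "Suc w" "Suc k"] by (simp del: upt_Suc)
  moreover have "map f [Suc w..<Suc k] \<noteq> []" using w by simp
  ultimately show "\<exists>q. q \<noteq> [] \<and> map f [i..<Suc k] = m @ q" by blast
qed

lemma suffix_upt_iff:
  assumes "m \<noteq> []" "inj f"
  shows "(\<exists>p. p \<noteq> [] \<and> map f [i..<Suc k] = p @ m) \<longleftrightarrow> (\<exists>u. i < u \<and> u \<le> k \<and> m = map f [u..<Suc k])"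
proof
  assume "\<exists>p. p \<noteq> [] \<and> map f [i..<Suc k] = p @ m"
  then obtain p where p: "p \<noteq> []" "map f [i..<Suc k] = p @ m" by blast
  have len: "Suc k - i = length p + length m" using arg_cong[OF p(2), of length] by (simp del: upt_Suc)
  have lm: "length m > 0" "length p > 0" using assms p by auto
  have "m = drop (length p) (map f [i..<Suc k])" unfolding p(2) by simp
  also have "\<dots> = map f [i + length p..<Suc k]" by (simp add: drop_map del: upt_Suc)
  finally have "m = map f [i + length p..<Suc k]" .
  moreover have "i < i + length p" "i + length p \<le> k" using len lm by arith+
  ultimately show "\<exists>u. i < u \<and> u \<le> k \<and> m = map f [u..<Suc k]" by blast
next
  assume "\<exists>u. i < u \<and> u \<le> k \<and> m = map f [u..<Suc k]"
  then obtain u where w: "i < u" "u \<le> k" "m = map f [u..<Suc k]" by blast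
  then have "map f [i..<Suc k] = map f [i..<u] @ m"
    using upt_split[of i u "Suc k"] by (simp del: upt_Suc)
  moreover have "map f [i..<u] \<noteq> []" using w by simp
  ultimately show "\<exists>p. p \<noteq> [] \<and> map f [i..<Suc k] = p @ m" by blast
qed

locale lab_chain = chain_dag +
  fixes lab :: "dag_edge \<Rightarrow> nat"
  assumes framing: "lab_framing G lab"
begin

section \<open>Labels forced by the framing\<close>

lemma lab_values: "a \<in> arcs G \<Longrightarrow> lab a = 1 \<or> lab a = 2"
  using framing unfolding lab_framing_def by blast

lemma lab_inner:
  assumes "i \<in> {1..N}"
  shows "lab (Inner_Edge i) = (if odd (gr i) then 2 else 1)"
proof -
  note b = gr_bounds[OF assms]
  have j: "gr i \<in> {1..length ks}" using b by simp
  have "group_route (gr i) \<in> inner_routes G" unfolding inner_routes_G using j by blast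
  moreover have "Inner_Edge i \<in> set (group_route (gr i))"
    unfolding group_route_def using b by (simp add: set_directed)
  ultimately show ?thesis
    using framing inner_route_no_group_route[OF j] unfolding lab_framing_def by metis
qed

lemma in_label_unique:
  assumes "a \<in> arcs G" "b \<in> arcs G" "head G a = Inner v" "head G b = Inner v" "v \<in> {1..n}" "lab a = lab b"
  shows "a = b"
proof -
  have "Inner v \<in> inner_verts G" using assms(5) inner_verts_G by blast
  then have "inj_on lab (in_arcs G (Inner v))" using framing unfolding lab_framing_def by blast
  then show ?thesis using assms by (auto dest: inj_onD simp: in_arcs_def)
qed

lemma out_label_unique:
  assumes "a \<in> arcs G" "b \<in> arcs G" "tail G a = Inner v" "tail G b = Inner v" "v \<in> {1..n}" "lab a = lab b"
  shows "a = b"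
proof -
  have "Inner v \<in> inner_verts G" using assms(5) inner_verts_G by blast
  then have "inj_on lab (out_arcs G (Inner v))" using framing unfolding lab_framing_def by blast
  then show ?thesis using assms by (auto dest: inj_onD simp: out_arcs_def)
qed

lemma G_cases: "G = Path_dag ks \<or> G = Cycle_dag ks"
proof -
  from shape consider (1) "nxt = (\<lambda>i. i + 1)" "n = N + 1"
    | (2) "nxt = (\<lambda>i. if i = N then 1 else i + 1)" "n = N" by blast
  then show ?thesis
  proof cases
    case 1
    have "Path_dag ks = make_full n N etail ehead" by (simp only: Path_dag_def 1)
    then have "G = Path_dag ks" by (simp only: G_def)
    then show ?thesis ..
  next
    case 2
    have "Cycle_dag ks = make_full n N etail ehead" by (simp only: Cycle_dag_def Let_def 2)
    then have "G = Cycle_dag ks" by (simp only: G_def)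
    then show ?thesis ..
  qed
qed

lemma degrees:
  assumes "v \<in> {1..n}"
  shows "in_degree G (Inner v) = 2" "out_degree G (Inner v) = 2"
proof -
  have v: "Inner v \<in> inner_verts G" using assms inner_verts_G by blast
  from G_cases show "in_degree G (Inner v) = 2"
    using v Path_dag_full(1) Cycle_dag_full(1) by metis
  from G_cases show "out_degree G (Inner v) = 2"
    using v Path_dag_full(2) Cycle_dag_full(2) by metis
qed

lemma label_attained:
  assumes "card A = 2" "inj_on lab A" "A \<subseteq> arcs G" "x = 1 \<or> x = 2"
  obtains a where "a \<in> A" "lab a = x"
proof -
  have "lab ` A \<subseteq> {1, 2}" using assms(3) lab_values by blast
  moreover have "card (lab ` A) = card {1, 2::nat}" using assms by (simp add: card_image)
  ultimately have "lab ` A = {1, 2}" by (intro card_subset_eq) auto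
  then have "x \<in> lab ` A" using assms(4) by auto
  then show ?thesis using that by blast
qed

text \<open>Fullness gives two incoming edges with distinct labels, so the label \<open>x\<close>
  occurs at \<open>v\<close>; if no inner edge holds it, a source edge does.\<close>

lemma source_edge_exists:
  assumes "v \<in> {1..n}" "x = 1 \<or> x = 2"
    and "\<And>i. \<lbrakk>i \<in> {1..N}; ehead i = v\<rbrakk> \<Longrightarrow> lab (Inner_Edge i) \<noteq> x"
  obtains c where "Source_Edge v c \<in> arcs G" "lab (Source_Edge v c) = x"
proof -
  have "Inner v \<in> inner_verts G" using assms(1) inner_verts_G by blast
  then have "inj_on lab (in_arcs G (Inner v))" using framing unfolding lab_framing_def by blast
  moreover have "card (in_arcs G (Inner v)) = 2" using degrees(1)[OF assms(1)] by (simp add: in_degree_def)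
  moreover have "in_arcs G (Inner v) \<subseteq> arcs G" by (auto simp: in_arcs_def)
  ultimately obtain a where "a \<in> in_arcs G (Inner v)" and la: "lab a = x"
    using label_attained assms(2) by metis
  then have a: "a \<in> arcs G" "head G a = Inner v" by (auto simp: in_arcs_def)
  show ?thesis
  proof (cases a)
    case (Inner_Edge i)
    then show ?thesis using a la assms(3)[of i] by simp
  next
    case (Source_Edge w c)
    then show ?thesis using a la that by simp
  next
    case (Sink_Edge w c)
    then show ?thesis using a by simp
  qed
qed

lemma sink_edge_exists:
  assumes "v \<in> {1..n}" "x = 1 \<or> x = 2"
    and "\<And>i. \<lbrakk>i \<in> {1..N}; etail i = v\<rbrakk> \<Longrightarrow> lab (Inner_Edge i) \<noteq> x"
  obtains c where "Sink_Edge v c \<in> arcs G" "lab (Sink_Edge v c) = x"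
proof -
  have "Inner v \<in> inner_verts G" using assms(1) inner_verts_G by blast
  then have "inj_on lab (out_arcs G (Inner v))" using framing unfolding lab_framing_def by blast
  moreover have "card (out_arcs G (Inner v)) = 2" using degrees(2)[OF assms(1)] by (simp add: out_degree_def)
  moreover have "out_arcs G (Inner v) \<subseteq> arcs G" by (auto simp: out_arcs_def)
  ultimately obtain a where "a \<in> out_arcs G (Inner v)" and la: "lab a = x"
    using label_attained assms(2) by metis
  then have a: "a \<in> arcs G" "tail G a = Inner v" by (auto simp: out_arcs_def)
  show ?thesis
  proof (cases a)
    case (Inner_Edge i)
    then show ?thesis using a la assms(3)[of i] by simp
  next
    case (Source_Edge w c)
    then show ?thesis using a by simp
  next
    case (Sink_Edge w c)
    then show ?thesis using a la that by simp
  qed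
qed

lemma source_edge_label:
  assumes "Source_Edge v c \<in> arcs G" "i \<in> {1..N}" "ehead i = v"
  shows "lab (Source_Edge v c) \<noteq> lab (Inner_Edge i)"
  using in_label_unique[OF assms(1), of "Inner_Edge i" v] arcs_G_vertex(1)[OF assms(1)] assms(2,3) by auto

lemma sink_edge_label:
  assumes "Sink_Edge v c \<in> arcs G" "i \<in> {1..N}" "etail i = v"
  shows "lab (Sink_Edge v c) \<noteq> lab (Inner_Edge i)"
  using out_label_unique[OF assms(1), of "Inner_Edge i" v] arcs_G_vertex(2)[OF assms(1)] assms(2,3) by auto

section \<open>The two kinds of routes, their signs and their factors\<close>

definition trivial_route :: "dag_edge awalk \<Rightarrow> nat \<Rightarrow> nat \<Rightarrow> nat \<Rightarrow> bool" where
  "trivial_route R v x y \<longleftrightarrow> (\<exists>c c'. R = [Source_Edge v c, Sink_Edge v c'] \<and>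
     Source_Edge v c \<in> arcs G \<and> Sink_Edge v c' \<in> arcs G \<and>
     lab (Source_Edge v c) = x \<and> lab (Sink_Edge v c') = y)"

text \<open>
  \<open>block_route R i k T H\<close>: the inner edges of \<open>R\<close> are \<open>i..k\<close>; the coordinate \<open>-1\<close> occurs (at \<open>i\<close>)
  iff \<open>T\<close>, and the coordinate \<open>1\<close> occurs (at \<open>nxt k\<close>) iff \<open>H\<close>.
\<close>

definition block_route :: "dag_edge awalk \<Rightarrow> nat \<Rightarrow> nat \<Rightarrow> bool \<Rightarrow> bool \<Rightarrow> bool" where
  "block_route R i k T H \<longleftrightarrow> is_block i k \<and> (\<exists>c c'.
     R = Source_Edge (entry i k) c # map Inner_Edge (directed i k) @ [Sink_Edge (exit i k) c'] \<and>
     Source_Edge (entry i k) c \<in> arcs G \<and> Sink_Edge (exit i k) c' \<in> arcs G \<and>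
     lab (Source_Edge (entry i k) c) = (if odd (gr i) then (if T then 1 else 2) else (if H then 2 else 1)) \<and>
     lab (Sink_Edge (exit i k) c') = (if odd (gr i) then (if H then 1 else 2) else (if T then 2 else 1)))"

lemma routes_iff: "R \<in> routes G \<longleftrightarrow>
    set R \<subseteq> arcs G \<and> casG Source R Sink \<and> distinct (pre_digraph.awalk_verts G Source R)"
  by (auto simp: routes_def pre_digraph.apath_def pre_digraph.awalk_def)

lemma casG_adjacent: "casG u (p @ [a, b] @ q) v \<Longrightarrow> head G a = tail G b"
  by (induction p arbitrary: u) auto

lemma walk_to_sink:
  assumes "casG (Inner v) es Sink" "set es \<subseteq> arcs G"
  obtains js w c where "es = map Inner_Edge js @ [Sink_Edge w c]" "casG (Inner v) (map Inner_Edge js) (Inner w)"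
    "set js \<subseteq> {1..N}"
proof -
  have "\<exists>js w c. es = map Inner_Edge js @ [Sink_Edge w c] \<and> casG (Inner v) (map Inner_Edge js) (Inner w) \<and>
      set js \<subseteq> {1..N}"
    using assms
  proof (induction es arbitrary: v)
    case (Cons a es)
    show ?case
    proof (cases a)
      case (Inner_Edge i)
      then have i: "i \<in> {1..N}" "etail i = v" "casG (Inner (ehead i)) es Sink" using Cons.prems by auto
      then obtain js w c where "es = map Inner_Edge js @ [Sink_Edge w c]"
        "casG (Inner (ehead i)) (map Inner_Edge js) (Inner w)" "set js \<subseteq> {1..N}"
        using Cons.IH[of "ehead i"] Cons.prems(2) by auto
      then show ?thesis using i Inner_Edge
        by (intro exI[of _ "i # js"] exI[of _ w] exI[of _ c]) auto
    next
      case (Source_Edge w c)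
      then show ?thesis using Cons.prems by simp
    next
      case (Sink_Edge w c)
      then have w: "w = v" "casG Sink es Sink" using Cons.prems by auto
      have "es = []"
      proof (cases es)
        case (Cons b bs)
        then show ?thesis using w(2) by (cases b) auto
      qed
      then show ?thesis using w Sink_Edge
        by (intro exI[of _ "[]"] exI[of _ w] exI[of _ c]) auto
    qed
  qed simp
  then show ?thesis using that by blast
qed

lemma route_cases:
  assumes "R \<in> routes G"
  obtains v x y where "trivial_route R v x y" | i k T H where "block_route R i k T H"
proof -
  have R: "set R \<subseteq> arcs G" "casG Source R Sink" using assms by (auto simp: routes_iff)
  then obtain a es where ae: "R = a # es" by (cases R) auto
  then have "tail G a = Source" using R by simp
  then obtain v c where a: "a = Source_Edge v c" by (cases a) auto
  have cas: "casG (Inner v) es Sink" "set es \<subseteq> arcs G" using R ae a by auto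
  obtain js w c' where js: "es = map Inner_Edge js @ [Sink_Edge w c']"
    "casG (Inner v) (map Inner_Edge js) (Inner w)" "set js \<subseteq> {1..N}" using walk_to_sink[OF cas] .
  have arcs: "Source_Edge v c \<in> arcs G" "Sink_Edge w c' \<in> arcs G" using R ae a js(1) by auto
  show ?thesis
  proof (cases "js = []")
    case True
    then have "w = v" using js(2) by simp
    then have "trivial_route R v (lab (Source_Edge v c)) (lab (Sink_Edge v c'))"
      unfolding trivial_route_def using ae a js(1) True arcs by auto
    then show ?thesis using that by blast
  next
    case False
    obtain i k where ik: "is_block i k" "js = directed i k" "Inner v = Inner (entry i k)"
      "Inner w = Inner (exit i k)" using inner_chain[OF js(2,3) False] .
    have R': "R = Source_Edge (entry i k) c # map Inner_Edge (directed i k) @ [Sink_Edge (exit i k) c']"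
      using ae a js(1) ik by simp
    have arcs': "Source_Edge (entry i k) c \<in> arcs G" "Sink_Edge (exit i k) c' \<in> arcs G" using arcs ik by auto
    \<comment> \<open>The labels of the two outer edges decide \<open>T\<close> and
      \<open>H\<close>; which edge belongs to which end depends on the direction of the
      group.\<close>
    have "block_route R i k (if odd (gr i) then lab (Source_Edge (entry i k) c) = 1 else lab (Sink_Edge (exit i k) c') = 2)
      (if odd (gr i) then lab (Sink_Edge (exit i k) c') = 1 else lab (Source_Edge (entry i k) c) = 2)"
      unfolding block_route_def
      using ik(1) R' arcs' lab_values[OF arcs'(1)] lab_values[OF arcs'(2)]
      by (intro conjI exI[of _ c] exI[of _ c']) auto
    then show ?thesis using that by blast
  qed
qed

text \<open>Without the sign -1 the outer edge at vertex \<open>i\<close> has the label of the inner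
  edges of its group. Edge \<open>i - 1\<close>, if it were in the same group, would carry this
  label at the same vertex and in the same direction, against the framing.\<close>

lemma block_route_start:
  assumes "block_route R i k T H" "\<not> T" "j \<in> {1..N}" "gr j = gr i"
  shows "i \<le> j"
proof (rule ccontr)
  assume "\<not> i \<le> j"
  have b: "is_block i k" using assms(1) by (simp add: block_route_def)
  then have i: "1 \<le> i" "i \<le> N" by (auto simp: is_block_def)
  define l where "l = i - 1"
  have l: "i = Suc l" "j \<le> l" "l \<in> {1..N}" "l < N" using \<open>\<not> i \<le> j\<close> assms(3) i by (auto simp: l_def)
  have g: "gr l = gr i" using gr_between[of j l i] assms(3,4) l i by simp
  have nx: "nxt l = i" using nxt_Suc[OF l(4)] l(1) by simp
  obtain c c' where cc: "Source_Edge (entry i k) c \<in> arcs G" "Sink_Edge (exit i k) c' \<in> arcs G"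
    "odd (gr i) \<Longrightarrow> lab (Source_Edge (entry i k) c) = 2" "even (gr i) \<Longrightarrow> lab (Sink_Edge (exit i k) c') = 1"
    using assms(1,2) unfolding block_route_def by auto
  show False
  proof (cases "odd (gr i)")
    case True
    have "ehead l = entry i k" using True nx by (simp add: alternating_head_def entry_def g)
    from source_edge_label[OF cc(1) l(3) this] show False using cc(3) lab_inner[OF l(3)] True g by simp
  next
    case False
    have "etail l = exit i k" using False nx by (simp add: alternating_tail_def exit_def g)
    from sink_edge_label[OF cc(2) l(3) this] show False using cc(4) lab_inner[OF l(3)] False g by simp
  qed
qed

text \<open>The argument of \<open>block_route_start\<close> at the upper end, with edge
  \<open>Suc k\<close>.\<close>

lemma block_route_end:
  assumes "block_route R i k T H" "\<not> H" "j \<in> {1..N}" "gr j = gr i"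
  shows "j \<le> k"
proof (rule ccontr)
  assume "\<not> j \<le> k"
  have b: "is_block i k" using assms(1) by (simp add: block_route_def)
  then have k: "1 \<le> i" "i \<le> k" "k \<le> N" and gk: "gr i = gr k" by (auto simp: is_block_def)
  have l: "Suc k \<in> {1..N}" "k < N" using \<open>\<not> j \<le> k\<close> assms(3) by auto
  have "gr (Suc k) = gr j" using gr_between[of i "Suc k" j] assms(3,4) k \<open>\<not> j \<le> k\<close> by simp
  then have g: "gr (Suc k) = gr i" using assms(4) by simp
  have nx: "nxt k = Suc k" using nxt_Suc[OF l(2)] .
  obtain c c' where cc: "Source_Edge (entry i k) c \<in> arcs G" "Sink_Edge (exit i k) c' \<in> arcs G"
    "odd (gr i) \<Longrightarrow> lab (Sink_Edge (exit i k) c') = 2" "even (gr i) \<Longrightarrow> lab (Source_Edge (entry i k) c) = 1"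
    using assms(1,2) unfolding block_route_def by auto
  show False
  proof (cases "odd (gr i)")
    case True
    have "etail (Suc k) = exit i k" using True nx by (simp add: alternating_tail_def exit_def g)
    from sink_edge_label[OF cc(2) l(1) this] show False using cc(3) lab_inner[OF l(1)] True g by simp
  next
    case False
    have "ehead (Suc k) = entry i k" using False nx by (simp add: alternating_head_def entry_def g)
    from source_edge_label[OF cc(1) l(1) this] show False using cc(4) lab_inner[OF l(1)] False g by simp
  qed
qed

lemma directed_ends:
  assumes "i \<le> k"
  shows "directed i k \<noteq> []" "hd (directed i k) = (if odd (gr i) then i else k)"
    "last (directed i k) = (if odd (gr i) then k else i)"
  using assms by (auto simp: directed_def last_rev hd_rev simp del: upt_Suc)

lemma lab_block:
  assumes "is_block i k" "j \<in> {i..k}"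
  shows "lab (Inner_Edge j) = (if odd (gr i) then 2 else 1)"
proof -
  have "j \<in> {1..N}" using block_subset[OF assms(1)] assms(2) by blast
  from lab_inner[OF this] show ?thesis unfolding gr_in_block[OF assms] .
qed

text \<open>The inner edges of the route share one label, so the label can change only at the two
  ends of the block.\<close>

lemma block_route_traverses:
  assumes "block_route R i k T H"
  shows "traverses G lab R (Inner w) 1 2 \<longleftrightarrow> T \<and> w = i"
    and "traverses G lab R (Inner w) 2 1 \<longleftrightarrow> H \<and> w = nxt k"
proof -
  have b: "is_block i k" using assms by (simp add: block_route_def)
  then have ik: "i \<le> k" by (simp add: is_block_def)
  note ends = directed_ends[OF ik]
  define zs where "zs = map Inner_Edge (directed i k)"
  have zs: "zs \<noteq> []" "hd zs = Inner_Edge (if odd (gr i) then i else k)"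
    "last zs = Inner_Edge (if odd (gr i) then k else i)"
    using ends by (auto simp: zs_def hd_map last_map)
  have labz: "lab z = (if odd (gr i) then 2 else 1)" if "z \<in> set zs" for z
    using that lab_block[OF b] unfolding zs_def by (auto simp: set_directed)
  obtain c c' where R: "R = Source_Edge (entry i k) c # zs @ [Sink_Edge (exit i k) c']" and
    ls: "lab (Source_Edge (entry i k) c) = (if odd (gr i) then (if T then 1 else 2) else (if H then 2 else 1))" and
    lt: "lab (Sink_Edge (exit i k) c') = (if odd (gr i) then (if H then 1 else 2) else (if T then 2 else 1))"
    using assms unfolding block_route_def zs_def by blast
  have hl: "lab (hd zs) = (if odd (gr i) then 2 else 1)" "lab (last zs) = (if odd (gr i) then 2 else 1)"
    using labz zs(1) by auto
  have headl: "head G (last zs) = Inner (exit i k)"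
    using b zs(3) by (simp add: exit_def alternating_head_def is_block_def)
  have tr: "traverses G lab R (Inner w) x y \<longleftrightarrow>
      entry i k = w \<and> lab (Source_Edge (entry i k) c) = x \<and> lab (hd zs) = y \<or>
      exit i k = w \<and> lab (last zs) = x \<and> lab (Sink_Edge (exit i k) c') = y" (is "?L \<longleftrightarrow> ?A \<or> ?B")
    if "x \<noteq> y" for x y
  proof
    assume ?L
    then obtain p q a d where ad: "R = p @ [a, d] @ q" "head G a = Inner w" "lab a = x" "lab d = y"
      unfolding traverses_def by blast
    have "\<not> (a \<in> set zs \<and> d \<in> set zs)" using labz ad that by auto
    then show "?A \<or> ?B" using adjacent_cases[OF ad(1)[unfolded R] zs(1)] ad headl by auto
  next
    assume "?A \<or> ?B"
    then show ?L
    proof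
      assume A: ?A
      have "R = [] @ [Source_Edge (entry i k) c, hd zs] @ (tl zs @ [Sink_Edge (exit i k) c'])"
        using R zs(1) by (cases zs) auto
      then show ?L unfolding traverses_def using A by (intro exI conjI) auto
    next
      assume B: ?B
      have "R = (Source_Edge (entry i k) c # butlast zs) @ [last zs, Sink_Edge (exit i k) c'] @ []"
        using R zs(1) by simp
      then show ?L unfolding traverses_def using B headl
        by (intro exI[of _ "Source_Edge (entry i k) c # butlast zs"] exI[of _ "[]"] exI[of _ "last zs"]
            exI[of _ "Sink_Edge (exit i k) c'"] conjI) auto
    qed
  qed
  show "traverses G lab R (Inner w) 1 2 \<longleftrightarrow> T \<and> w = i"
    using tr[of 1 2] hl ls lt by (auto simp: entry_def exit_def)
  show "traverses G lab R (Inner w) 2 1 \<longleftrightarrow> H \<and> w = nxt k"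
    using tr[of 2 1] hl ls lt by (auto simp: entry_def exit_def)
qed

lemma trivial_route_traverses:
  assumes "trivial_route R v x y"
  shows "traverses G lab R (Inner w) x' y' \<longleftrightarrow> w = v \<and> x' = x \<and> y' = y"
proof -
  obtain c c' where R: "R = [Source_Edge v c, Sink_Edge v c']" "lab (Source_Edge v c) = x" "lab (Sink_Edge v c') = y"
    using assms unfolding trivial_route_def by blast
  have "p = [] \<and> q = [] \<and> a = Source_Edge v c \<and> b = Sink_Edge v c'" if "R = p @ [a, b] @ q" for p q a b
  proof -
    have "length R = 2" using R by simp
    then have "length p = 0" "length q = 0" using arg_cong[OF that, of length] by auto
    then show ?thesis using that R by simp
  qed
  then show ?thesis unfolding traverses_def using R by fastforce
qed

definition factor :: "dag_edge awalk \<Rightarrow> dag_edge awalk \<Rightarrow> nat \<Rightarrow> nat \<Rightarrow> bool" where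
  "factor R m x y \<longleftrightarrow> (\<exists>p a b q. R = p @ [a] @ m @ [b] @ q \<and> lab a = x \<and> lab b = y)"

lemma trivial_route_factor:
  assumes "trivial_route R v x y" "m \<noteq> []"
  shows "\<not> factor R m x' y'"
proof
  assume "factor R m x' y'"
  then obtain p a b q where R: "R = p @ [a] @ m @ [b] @ q" unfolding factor_def by blast
  have "length R = 2" using assms unfolding trivial_route_def by auto
  then show False using assms(2) arg_cong[OF R, of length] by (cases m) auto
qed

text \<open>Reversing the route and swapping the labels turns an even group into an odd one, and the
  two operations together preserve the type \<open>1 2\<close> or \<open>2 1\<close> of a factor. So
  it suffices to study words with inner label 2, read upwards.\<close>

lemma block_route_factor:
  assumes "block_route R i k T H" "m \<noteq> []"
  shows "factor R m 1 2 \<longleftrightarrow> T \<and> (\<exists>w\<ge>i. m = map Inner_Edge (directed i w) \<and> (w < k \<or> w = k \<and> \<not> H))"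
    and "factor R m 2 1 \<longleftrightarrow> H \<and> (\<exists>u\<le>k. m = map Inner_Edge (directed u k) \<and> (i < u \<or> u = i \<and> \<not> T))"
proof -
  have b: "is_block i k" using assms by (simp add: block_route_def)
  then have ik: "i \<le> k" by (simp add: is_block_def)
  define U where "U = map Inner_Edge [i..<Suc k]"
  have inj: "inj Inner_Edge" by (simp add: inj_def)
  obtain c c' where R: "R = Source_Edge (entry i k) c # map Inner_Edge (directed i k) @ [Sink_Edge (exit i k) c']" and
    ls: "lab (Source_Edge (entry i k) c) = (if odd (gr i) then (if T then 1 else 2) else (if H then 2 else 1))" and
    lt: "lab (Sink_Edge (exit i k) c') = (if odd (gr i) then (if H then 1 else 2) else (if T then 2 else 1))"
    using assms unfolding block_route_def by blast
  have labU: "lab z = (if odd (gr i) then 2 else 1)" if "z \<in> set U" for z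
    using that lab_block[OF b] unfolding U_def by auto
  have du: "directed u k = (if odd (gr i) then [u..<Suc k] else rev [u..<Suc k])" if "i \<le> u" "u \<le> k" for u
    unfolding directed_def using gr_in_block[OF b, of u] that by simp
  have dw: "directed i w = (if odd (gr i) then [i..<Suc w] else rev [i..<Suc w])" for w
    by (simp add: directed_def)
  \<comment> \<open>\<open>st\<close> and \<open>en\<close> are the outer edges at the lower and the
    upper end, \<open>f\<close> is the label after the swap, and \<open>m'\<close> is the factor
    read upwards.\<close>
  define st where "st = (if odd (gr i) then Source_Edge (entry i k) c else Sink_Edge (exit i k) c')"
  define en where "en = (if odd (gr i) then Sink_Edge (exit i k) c' else Source_Edge (entry i k) c)"
  define f where "f = (\<lambda>a. if odd (gr i) then lab a else 3 - lab a)"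
  define m' where "m' = (if odd (gr i) then m else rev m)"
  have f: "f z = 2" if "z \<in> set U" for z using labU[OF that] by (simp add: f_def)
  have m: "m' \<noteq> []" using assms(2) by (simp add: m'_def)
  have st: "f st = 1 \<longleftrightarrow> T" "f st = 2 \<longleftrightarrow> \<not> T" and en: "f en = 1 \<longleftrightarrow> H" "f en = 2 \<longleftrightarrow> \<not> H"
    using ls lt by (auto simp: st_def en_def f_def)
  have up: "factor R m 1 2 \<longleftrightarrow> (\<exists>p a b q. st # U @ [en] = p @ [a] @ m' @ [b] @ q \<and> f a = 1 \<and> f b = 2)"
  proof (cases "odd (gr i)")
    case True
    then show ?thesis unfolding factor_def R by (simp add: U_def directed_def st_def en_def f_def m'_def)
  next
    case False
    have revR: "rev R = Sink_Edge (exit i k) c' # U @ [Source_Edge (entry i k) c]"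
      using False unfolding R by (simp add: U_def directed_def rev_map)
    have "factor R m 1 2 \<longleftrightarrow> (\<exists>p b a q. rev R = p @ [b] @ rev m @ [a] @ q \<and> lab b = 2 \<and> lab a = 1)"
      unfolding factor_def by (rule rev_factor_iff)
    also have "\<dots> \<longleftrightarrow> (\<exists>p b a q. rev R = p @ [b] @ rev m @ [a] @ q \<and> 3 - lab b = 1 \<and> 3 - lab a = 2)"
      by (intro ex_cong1 conj_cong refl) arith+
    finally show ?thesis using False unfolding revR by (simp add: st_def en_def f_def m'_def)
  qed
  have down: "factor R m 2 1 \<longleftrightarrow> (\<exists>p a b q. st # U @ [en] = p @ [a] @ m' @ [b] @ q \<and> f a = 2 \<and> f b = 1)"
  proof (cases "odd (gr i)")
    case True
    then show ?thesis unfolding factor_def R by (simp add: U_def directed_def st_def en_def f_def m'_def)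
  next
    case False
    have revR: "rev R = Sink_Edge (exit i k) c' # U @ [Source_Edge (entry i k) c]"
      using False unfolding R by (simp add: U_def directed_def rev_map)
    have "factor R m 2 1 \<longleftrightarrow> (\<exists>p b a q. rev R = p @ [b] @ rev m @ [a] @ q \<and> lab b = 1 \<and> lab a = 2)"
      unfolding factor_def by (rule rev_factor_iff)
    also have "\<dots> \<longleftrightarrow> (\<exists>p b a q. rev R = p @ [b] @ rev m @ [a] @ q \<and> 3 - lab b = 2 \<and> 3 - lab a = 1)"
      by (intro ex_cong1 conj_cong refl) arith+
    finally show ?thesis using False unfolding revR by (simp add: st_def en_def f_def m'_def)
  qed
  have flip: "m' = map Inner_Edge [u..<Suc w] \<longleftrightarrow>
      m = map Inner_Edge (if odd (gr i) then [u..<Suc w] else rev [u..<Suc w])" for u w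
    by (auto simp: m'_def rev_map rev_swap simp del: upt_Suc)
  have pre: "(\<exists>q. q \<noteq> [] \<and> U = m' @ q) \<longleftrightarrow> (\<exists>w. i \<le> w \<and> w < k \<and> m' = map Inner_Edge [i..<Suc w])"
    unfolding U_def by (rule prefix_upt_iff[OF m inj])
  have suf: "(\<exists>p. p \<noteq> [] \<and> U = p @ m') \<longleftrightarrow> (\<exists>u. i < u \<and> u \<le> k \<and> m' = map Inner_Edge [u..<Suc k])"
    unfolding U_def by (rule suffix_upt_iff[OF m inj])
  have whole: "U = m' \<longleftrightarrow> m = map Inner_Edge (directed i k)"
    using flip[of i k] unfolding U_def dw by metis
  have du': "(\<exists>u. i < u \<and> u \<le> k \<and> m = map Inner_Edge (if odd (gr i) then [u..<Suc k] else rev [u..<Suc k])) \<longleftrightarrow>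
      (\<exists>u. i < u \<and> u \<le> k \<and> m = map Inner_Edge (directed u k))"
  proof (rule ex_cong1)
    fix u
    show "i < u \<and> u \<le> k \<and> m = map Inner_Edge (if odd (gr i) then [u..<Suc k] else rev [u..<Suc k]) \<longleftrightarrow>
      i < u \<and> u \<le> k \<and> m = map Inner_Edge (directed u k)"
    proof (cases "i < u \<and> u \<le> k")
      case True
      then have "directed u k = (if odd (gr i) then [u..<Suc k] else rev [u..<Suc k])" using du by simp
      then show ?thesis by (simp only:)
    qed blast
  qed
  have fu: "(\<exists>p a b q. st # U @ [en] = p @ [a] @ m' @ [b] @ q \<and> f a = 1 \<and> f b = 2) \<longleftrightarrow>
      f st = 1 \<and> ((\<exists>q. q \<noteq> [] \<and> U = m' @ q) \<or> U = m' \<and> f en = 2)"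
    by (rule factor_up_iff) (rule f, assumption, rule m)
  have fd: "(\<exists>p a b q. st # U @ [en] = p @ [a] @ m' @ [b] @ q \<and> f a = 2 \<and> f b = 1) \<longleftrightarrow>
      f en = 1 \<and> ((\<exists>p. p \<noteq> [] \<and> U = p @ m') \<or> U = m' \<and> f st = 2)"
    by (rule factor_down_iff) (rule f, assumption, rule m)
  have "factor R m 1 2 \<longleftrightarrow> T \<and> ((\<exists>w. i \<le> w \<and> w < k \<and> m = map Inner_Edge (directed i w)) \<or>
      m = map Inner_Edge (directed i k) \<and> \<not> H)"
    unfolding up fu pre whole flip dw st en by (rule refl)
  then show "factor R m 1 2 \<longleftrightarrow> T \<and> (\<exists>w\<ge>i. m = map Inner_Edge (directed i w) \<and> (w < k \<or> w = k \<and> \<not> H))"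
    using ik by blast
  have "factor R m 2 1 \<longleftrightarrow> H \<and> ((\<exists>u. i < u \<and> u \<le> k \<and>
        m = map Inner_Edge (if odd (gr i) then [u..<Suc k] else rev [u..<Suc k])) \<or>
      m = map Inner_Edge (directed i k) \<and> \<not> T)"
    unfolding down fd suf whole flip st en by (rule refl)
  also have "\<dots> \<longleftrightarrow> H \<and> ((\<exists>u. i < u \<and> u \<le> k \<and> m = map Inner_Edge (directed u k)) \<or>
      m = map Inner_Edge (directed i k) \<and> \<not> T)"
    unfolding du' by (rule refl)
  finally show "factor R m 2 1 \<longleftrightarrow> H \<and> (\<exists>u\<le>k. m = map Inner_Edge (directed u k) \<and> (i < u \<or> u = i \<and> \<not> T))"
    using ik by blast
qed

end

subsection \<open>Conflicts\<close>

context lab_chain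
begin

section \<open>Conflicts as crossings\<close>

lemma route_adjacent:
  "R \<in> routes G \<Longrightarrow> R = p @ [a, b] @ q \<Longrightarrow> head G a = tail G b"
  using casG_adjacent by (auto simp: routes_iff)

lemma route_arcs: "R \<in> routes G \<Longrightarrow> a \<in> set R \<Longrightarrow> a \<in> arcs G"
  by (auto simp: routes_iff)

text \<open>The half of \<open>in_conflict\<close> in which the first route enters by label 1 and leaves by label 2.\<close>

definition crosses :: "dag_edge awalk \<Rightarrow> dag_edge awalk \<Rightarrow> bool" where
  "crosses R S \<longleftrightarrow>
     (\<exists>w\<in>{1..n}. traverses G lab R (Inner w) 1 2 \<and> traverses G lab S (Inner w) 2 1) \<or>
     (\<exists>m. m \<noteq> [] \<and> factor R m 1 2 \<and> factor S m 2 1)"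

lemma conflictI:
  assumes "R = p @ [a] @ m @ [b] @ q" "S = p' @ [c] @ m @ [d] @ q'"
    and "head G a = head G c" "tail G b = tail G d"
    and "lab a < lab c \<and> lab b > lab d \<or> lab c < lab a \<and> lab d > lab b"
  shows "in_conflict G lab R S"
proof -
  have ne: "a \<noteq> c" "b \<noteq> d" using assms(5) by auto
  show ?thesis
    unfolding in_conflict_def
    by (rule exI[of _ p], rule exI[of _ q], rule exI[of _ p'], rule exI[of _ q'],
        rule exI[of _ m], rule exI[of _ a], rule exI[of _ b], rule exI[of _ c],
        rule exI[of _ d]) (intro conjI assms ne)
qed

text \<open>If the common part has edges, both entering edges precede its first edge and both
  leaving edges follow its last one; this yields the equal heads and tails that
  \<open>in_conflict\<close> demands.\<close>

lemma crosses_imp_conflict: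
  assumes "R \<in> routes G" "S \<in> routes G" "crosses R S"
  shows "in_conflict G lab R S \<and> in_conflict G lab S R"
  using assms(3) unfolding crosses_def
proof
  assume "\<exists>w\<in>{1..n}. traverses G lab R (Inner w) 1 2 \<and> traverses G lab S (Inner w) 2 1"
  then obtain w p q a b p' q' c d where
    R: "R = p @ [a, b] @ q" "head G a = Inner w" "lab a = 1" "lab b = 2" and
    S: "S = p' @ [c, d] @ q'" "head G c = Inner w" "lab c = 2" "lab d = 1"
    unfolding traverses_def by blast
  have t: "tail G b = tail G d"
    using route_adjacent[OF assms(1) R(1)] route_adjacent[OF assms(2) S(1)] R(2) S(2) by simp
  have h: "head G a = head G c" using R(2) S(2) by simp
  have R': "R = p @ [a] @ [] @ [b] @ q" and S': "S = p' @ [c] @ [] @ [d] @ q'"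
    using R(1) S(1) by simp_all
  show ?thesis
    using conflictI[OF R' S' h t] conflictI[OF S' R' h[symmetric] t[symmetric]] R(3,4) S(3,4) by simp
next
  assume "\<exists>m. m \<noteq> [] \<and> factor R m 1 2 \<and> factor S m 2 1"
  then obtain m p q a b p' q' c d where m: "m \<noteq> []" and
    R: "R = p @ [a] @ m @ [b] @ q" "lab a = 1" "lab b = 2" and
    S: "S = p' @ [c] @ m @ [d] @ q'" "lab c = 2" "lab d = 1"
    unfolding factor_def by blast
  obtain x m' where x: "m = x # m'" using m by (cases m) auto
  obtain y m'' where y: "m = m'' @ [y]" using m by (cases m rule: rev_cases) auto
  have "R = p @ [a, x] @ (m' @ [b] @ q)" "S = p' @ [c, x] @ (m' @ [d] @ q')"
    unfolding R(1) S(1) x by simp_all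
  from route_adjacent[OF assms(1) this(1)] route_adjacent[OF assms(2) this(2)]
  have h: "head G a = head G c" by simp
  have "R = (p @ [a] @ m'') @ [y, b] @ q" "S = (p' @ [c] @ m'') @ [y, d] @ q'"
    unfolding R(1) S(1) y by simp_all
  from route_adjacent[OF assms(1) this(1)] route_adjacent[OF assms(2) this(2)]
  have t: "tail G b = tail G d" by simp
  show ?thesis
    using conflictI[OF R(1) S(1) h t] conflictI[OF S(1) R(1) h[symmetric] t[symmetric]] R(2,3) S(2,3) by simp
qed

text \<open>Only the labels 1 and 2 occur, so the strict inequalities determine all four
  labels.\<close>

lemma conflict_imp_crosses:
  assumes "R \<in> routes G" "S \<in> routes G" "in_conflict G lab R S"
  shows "crosses R S \<or> crosses S R"
proof -
  obtain p q p' q' m a b c d where *: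
    "R = p @ [a] @ m @ [b] @ q" "S = p' @ [c] @ m @ [d] @ q'"
    "head G a = head G c" "tail G b = tail G d"
    "lab a < lab c \<and> lab b > lab d \<or> lab c < lab a \<and> lab d > lab b"
    using assms(3) unfolding in_conflict_def by blast
  have arcs: "a \<in> arcs G" "b \<in> arcs G" "c \<in> arcs G" "d \<in> arcs G"
    using route_arcs[OF assms(1)] route_arcs[OF assms(2)] *(1,2) by auto
  have labs: "lab a = 1 \<and> lab b = 2 \<and> lab c = 2 \<and> lab d = 1 \<or> lab c = 1 \<and> lab d = 2 \<and> lab a = 2 \<and> lab b = 1"
    using *(5) lab_values[OF arcs(1)] lab_values[OF arcs(2)] lab_values[OF arcs(3)] lab_values[OF arcs(4)] by auto
  show ?thesis
  proof (cases "m = []")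
    case True
    have R: "R = p @ [a, b] @ q" and S: "S = p' @ [c, d] @ q'" using *(1,2) True by auto
    have hb: "head G a = tail G b" by (rule route_adjacent[OF assms(1) R])
    obtain w where w: "head G a = Inner w" "w \<in> {1..n}"
    proof (cases a)
      case (Inner_Edge i)
      then show ?thesis using that[of "ehead i"] arcs(1) edge_ends(2) by simp
    next
      case (Source_Edge v c)
      then show ?thesis using that[of v] arcs(1) arcs_G_vertex by simp
    next
      \<comment> \<open>No edge starts at \<open>Sink\<close>, so the common vertex is an inner
        one.\<close>
      case (Sink_Edge v c)
      then have "tail G b = Sink" using hb by simp
      then show ?thesis by (cases b) auto
    qed
    have tr: "traverses G lab R (Inner w) (lab a) (lab b)" "traverses G lab S (Inner w) (lab c) (lab d)"
    proof -
      show "traverses G lab R (Inner w) (lab a) (lab b)"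
        unfolding traverses_def using R w(1) by blast
      have "head G c = Inner w" using *(3) w(1) by simp
      then show "traverses G lab S (Inner w) (lab c) (lab d)"
        unfolding traverses_def using S by blast
    qed
    show ?thesis
      using labs
    proof
      assume "lab a = 1 \<and> lab b = 2 \<and> lab c = 2 \<and> lab d = 1"
      then show ?thesis using tr w(2) unfolding crosses_def by metis
    next
      assume "lab c = 1 \<and> lab d = 2 \<and> lab a = 2 \<and> lab b = 1"
      then show ?thesis using tr w(2) unfolding crosses_def by metis
    qed
  next
    case False
    have f: "factor R m (lab a) (lab b)" "factor S m (lab c) (lab d)"
      unfolding factor_def using *(1,2) by blast+
    show ?thesis
      using labs
    proof
      assume "lab a = 1 \<and> lab b = 2 \<and> lab c = 2 \<and> lab d = 1"
      then show ?thesis using f False unfolding crosses_def by metis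
    next
      assume "lab c = 1 \<and> lab d = 2 \<and> lab a = 2 \<and> lab b = 1"
      then show ?thesis using f False unfolding crosses_def by metis
    qed
  qed
qed

lemma coherent_iff_crosses:
  "\<lbrakk>R \<in> routes G; S \<in> routes G\<rbrakk> \<Longrightarrow> coherent G lab R S \<longleftrightarrow> \<not> crosses R S \<and> \<not> crosses S R"
  unfolding coherent_def using crosses_imp_conflict conflict_imp_crosses by blast

text \<open>A factor of type \<open>1 2\<close> begins with the lowest edge of its block and one of
  type \<open>2 1\<close> ends with the highest edge of its block, in terms of indices. The common
  factor can therefore only consist of the edges \<open>i..k'\<close>.\<close>

lemma block_routes_common_factor:
  assumes R: "block_route R i k T H" and S: "block_route S i' k' T' H'"
  shows "(\<exists>m. m \<noteq> [] \<and> factor R m 1 2 \<and> factor S m 2 1) \<longleftrightarrow>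
    T \<and> H' \<and> is_block i k' \<and> (k' < k \<or> k' = k \<and> \<not> H) \<and> (i' < i \<or> i' = i \<and> \<not> T')" (is "?L \<longleftrightarrow> ?R")
proof
  have bR: "is_block i k" and bS: "is_block i' k'" using R S by (auto simp: block_route_def)
  {
    assume ?L
    then obtain m where m: "m \<noteq> []" "factor R m 1 2" "factor S m 2 1" by blast
    obtain w where w: "T" "i \<le> w" "m = map Inner_Edge (directed i w)" "w < k \<or> w = k \<and> \<not> H"
      using block_route_factor(1)[OF R m(1)] m(2) by blast
    obtain u where u: "H'" "u \<le> k'" "m = map Inner_Edge (directed u k')" "i' < u \<or> u = i' \<and> \<not> T'"
      using block_route_factor(2)[OF S m(1)] m(3) by blast
    have "set m = Inner_Edge ` {i..w}" using w(3) by (simp add: set_directed)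
    moreover have "set m = Inner_Edge ` {u..k'}" using u(3) by (simp add: set_directed)
    ultimately have "Inner_Edge ` {i..w} = Inner_Edge ` {u..k'}" by simp
    then have "{i..w} = {u..k'}" by (simp add: inj_image_eq_iff inj_def)
    then have eq: "u = i" "w = k'" using w(2) u(2) by auto
    have "i \<in> {i'..k'}" using u(2,4) eq by auto
    then have "gr i = gr i'" by (rule gr_in_block[OF bS])
    then have "is_block i k'" using bR bS u(2) eq by (auto simp: is_block_def)
    then show ?R using w u eq by auto
  }
  assume r: ?R
  have dne: "map Inner_Edge (directed i k') \<noteq> []" using r by (auto simp: is_block_def directed_def)
  have "i \<le> k'" using r by (simp add: is_block_def)
  then have "factor R (map Inner_Edge (directed i k')) 1 2" "factor S (map Inner_Edge (directed i k')) 2 1"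
    using block_route_factor(1)[OF R dne] block_route_factor(2)[OF S dne] r by auto
  then show ?L using dne by blast
qed

text \<open>Edge \<open>v\<close> would occupy the label 2 among the edges leaving \<open>v\<close>
  in an odd group, or the label 1 among those entering \<open>v\<close> in an even group.\<close>

lemma trivial_tail_no_block: "trivial_route R v 1 2 \<Longrightarrow> \<not> is_block v k"
proof
  assume R: "trivial_route R v 1 2" and b: "is_block v k"
  then have v: "v \<in> {1..N}" by (auto simp: is_block_def)
  obtain c c' where cc: "Source_Edge v c \<in> arcs G" "Sink_Edge v c' \<in> arcs G"
    "lab (Source_Edge v c) = 1" "lab (Sink_Edge v c') = 2" using R unfolding trivial_route_def by blast
  show False
  proof (cases "odd (gr v)")
    case True
    then have "etail v = v" by (simp add: alternating_tail_def)
    from sink_edge_label[OF cc(2) v this] show False using cc(4) lab_inner[OF v] True by simp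
  next
    case False
    then have "ehead v = v" by (simp add: alternating_head_def)
    from source_edge_label[OF cc(1) v this] show False using cc(3) lab_inner[OF v] False by simp
  qed
qed

text \<open>Edge \<open>k\<close> would occupy the label 2 among the edges entering
  \<open>nxt k\<close> in an odd group, or the label 1 among those leaving \<open>nxt k\<close> in
  an even group.\<close>

lemma trivial_head_no_block: "trivial_route R (nxt k) 2 1 \<Longrightarrow> \<not> is_block i k"
proof
  assume R: "trivial_route R (nxt k) 2 1" and b: "is_block i k"
  then have k: "k \<in> {1..N}" by (auto simp: is_block_def)
  obtain c c' where cc: "Source_Edge (nxt k) c \<in> arcs G" "Sink_Edge (nxt k) c' \<in> arcs G"
    "lab (Source_Edge (nxt k) c) = 2" "lab (Sink_Edge (nxt k) c') = 1" using R unfolding trivial_route_def by blast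
  show False
  proof (cases "odd (gr k)")
    case True
    then have "ehead k = nxt k" by (simp add: alternating_head_def)
    from source_edge_label[OF cc(1) k this] show False using cc(3) lab_inner[OF k] True by simp
  next
    case False
    then have "etail k = nxt k" by (simp add: alternating_tail_def)
    from sink_edge_label[OF cc(2) k this] show False using cc(4) lab_inner[OF k] False by simp
  qed
qed

text \<open>By \<open>block_route_start\<close> and \<open>block_route_end\<close> an end without a
  sign must be an end of its group. Conversely, this keeps the wanted outer label free: an inner
  edge holding it would continue the block within its group.\<close>

lemma block_route_exists:
  assumes b: "is_block i k" and T: "\<not> T \<Longrightarrow> i = 1 \<or> gr (i - 1) \<noteq> gr i"
    and H: "\<not> H \<Longrightarrow> k = N \<or> gr (Suc k) \<noteq> gr k"
  obtains R where "R \<in> routes G" "block_route R i k T H"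
proof -
  have ik: "i \<in> {1..N}" "k \<in> {1..N}" "i \<le> k" "gr i = gr k" using b by (auto simp: is_block_def)
  have ends: "entry i k \<in> {1..n}" "exit i k \<in> {1..n}"
    using nxt_in[OF ik(2)] N_le ik(1) by (auto simp: entry_def exit_def)
  have no_in_left: False if "j \<in> {1..N}" "gr j = gr i" "nxt j = i" "\<not> T" for j
  proof -
    have "i = Suc j \<or> j = N \<and> i = 1 \<and> even (gr N)" using nxt_cases[OF that(1) ik(1) that(3)] .
    then show False
    proof
      assume "i = Suc j"
      then show False using T[OF that(4)] that(1,2) by simp
    next
      assume "j = N \<and> i = 1 \<and> even (gr N)"
      then show False using that(2) gr_1 by simp
    qed
  qed
  have no_out_right: False if "j \<in> {1..N}" "gr j = gr k" "nxt k = j" "\<not> H" for j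
  proof -
    have "j = Suc k \<or> k = N \<and> j = 1 \<and> even (gr N)" using nxt_cases[OF ik(2) that(1,3)] .
    then show False
    proof
      assume "j = Suc k"
      then show False using H[OF that(4)] that(1,2) by simp
    next
      assume "k = N \<and> j = 1 \<and> even (gr N)"
      then show False using that(2) gr_1 by simp
    qed
  qed
  \<comment> \<open>Neighbouring groups differ in parity, and so do the two groups meeting at the
    wrap-around.\<close>
  have parity: "gr j = gr l" if "odd (gr j) = odd (gr l)" "j \<in> {1..N}" "l \<in> {1..N}" "nxt j = l" for j l
  proof -
    have "l = Suc j \<or> j = N \<and> l = 1 \<and> even (gr N)" using nxt_cases[OF that(2-4)] .
    then show ?thesis
    proof
      assume l: "l = Suc j"
      then have "gr j \<le> gr l" "gr l \<le> Suc (gr j)" using gr_mono[of j l] gr_Suc[of j] that by auto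
      then have "gr l = gr j \<or> gr l = Suc (gr j)" by linarith
      then show ?thesis using that(1) by auto
    next
      assume "j = N \<and> l = 1 \<and> even (gr N)"
      then show ?thesis using that(1) gr_1 by simp
    qed
  qed
  let ?x = "if odd (gr i) then (if T then 1 else 2) else (if H then 2 else (1::nat))"
  let ?y = "if odd (gr i) then (if H then 1 else 2) else (if T then 2 else (1::nat))"
  have x: "?x = 1 \<or> ?x = 2" and y: "?y = 1 \<or> ?y = 2" by auto
  have srcfree: "lab (Inner_Edge j) \<noteq> ?x" if j: "j \<in> {1..N}" "ehead j = entry i k" for j
  proof
    assume l: "lab (Inner_Edge j) = ?x"
    show False
    proof (cases "odd (gr i)")
      case True
      have "lab (Inner_Edge j) = (if T then 1 else 2)" using l True by simp
      then have "odd (gr j) \<longleftrightarrow> \<not> T"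
        unfolding lab_inner[OF j(1)] by (cases T; cases "odd (gr j)") simp_all
      moreover have "odd (gr j)"
      proof (rule ccontr)
        assume "\<not> odd (gr j)"
        then have "j = i" using j(2) True by (simp add: alternating_head_def entry_def)
        then show False using True \<open>\<not> odd (gr j)\<close> by simp
      qed
      moreover from this have "nxt j = i" using j(2) True by (simp add: alternating_head_def entry_def)
      moreover from this have "gr j = gr i" using parity[of j i] True \<open>odd (gr j)\<close> j(1) ik(1) by simp
      ultimately show False using no_in_left[OF j(1)] by blast
    next
      case False
      have "lab (Inner_Edge j) = (if H then 2 else 1)" using l False by simp
      then have "even (gr j) \<longleftrightarrow> \<not> H"
        unfolding lab_inner[OF j(1)] by (cases H; cases "odd (gr j)") simp_all
      moreover have "even (gr j)"
      proof (rule ccontr)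
        assume o: "\<not> even (gr j)"
        then have "nxt j = nxt k" using j(2) False by (simp add: alternating_head_def entry_def)
        then have "j = k" using inj_onD[OF inj_nxt] j(1) ik(2) by blast
        then show False using False o ik(4) by simp
      qed
      moreover from this have "nxt k = j" using j(2) False by (simp add: alternating_head_def entry_def)
      moreover from this have "gr j = gr k" using parity[of k j] False \<open>even (gr j)\<close> j(1) ik(2,4) by simp
      ultimately show False using no_out_right[OF j(1)] by blast
    qed
  qed
  have snkfree: "lab (Inner_Edge j) \<noteq> ?y" if j: "j \<in> {1..N}" "etail j = exit i k" for j
  proof
    assume l: "lab (Inner_Edge j) = ?y"
    show False
    proof (cases "odd (gr i)")
      case True
      have "lab (Inner_Edge j) = (if H then 1 else 2)" using l True by simp
      then have "odd (gr j) \<longleftrightarrow> \<not> H"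
        unfolding lab_inner[OF j(1)] by (cases H; cases "odd (gr j)") simp_all
      moreover have "odd (gr j)"
      proof (rule ccontr)
        assume o: "\<not> odd (gr j)"
        then have "nxt j = nxt k" using j(2) True by (simp add: alternating_tail_def exit_def)
        then have "j = k" using inj_onD[OF inj_nxt] j(1) ik(2) by blast
        then show False using True o ik(4) by simp
      qed
      moreover from this have "nxt k = j" using j(2) True by (simp add: alternating_tail_def exit_def)
      moreover from this have "gr j = gr k" using parity[of k j] True \<open>odd (gr j)\<close> j(1) ik(2,4) by simp
      ultimately show False using no_out_right[OF j(1)] by blast
    next
      case False
      have "lab (Inner_Edge j) = (if T then 2 else 1)" using l False by simp
      then have "even (gr j) \<longleftrightarrow> \<not> T"
        unfolding lab_inner[OF j(1)] by (cases T; cases "odd (gr j)") simp_all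
      moreover have "even (gr j)"
      proof (rule ccontr)
        assume o: "\<not> even (gr j)"
        then have "j = i" using j(2) False by (simp add: alternating_tail_def exit_def)
        then show False using False o by simp
      qed
      moreover from this have "nxt j = i" using j(2) False by (simp add: alternating_tail_def exit_def)
      moreover from this have "gr j = gr i" using parity[of j i] False \<open>even (gr j)\<close> j(1) ik(1) by simp
      ultimately show False using no_in_left[OF j(1)] by blast
    qed
  qed
  obtain c where c: "Source_Edge (entry i k) c \<in> arcs G" "lab (Source_Edge (entry i k) c) = ?x"
    using source_edge_exists[OF ends(1) x srcfree] .
  obtain c' where c': "Sink_Edge (exit i k) c' \<in> arcs G" "lab (Sink_Edge (exit i k) c') = ?y"
    using sink_edge_exists[OF ends(2) y snkfree] .
  let ?R = "Source_Edge (entry i k) c # map Inner_Edge (directed i k) @ [Sink_Edge (exit i k) c']"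
  have br: "block_route ?R i k T H" unfolding block_route_def using b c c' by blast
  have "set ?R \<subseteq> arcs G" using c c' block_subset[OF b] by (auto simp: set_directed)
  moreover have "casG Source ?R Sink"
    using casG_directed[OF b] by (auto simp: casG_append)
  moreover have "pre_digraph.awalk_verts G Source ?R =
      Source # map Inner (map etail (directed i k) @ [exit i k]) @ [Sink]"
    by (simp add: pre_digraph.awalk_verts_conv)
  moreover have "distinct (Source # map Inner (map etail (directed i k) @ [exit i k]) @ [Sink])"
  proof -
    have "distinct (map Inner (map etail (directed i k) @ [exit i k]))"
      unfolding distinct_map using directed_vertices(1)[OF b] by (auto simp: inj_on_def)
    then show ?thesis by auto
  qed
  ultimately have "?R \<in> routes G" unfolding routes_iff by metis
  then show ?thesis using that br by blast
qed

lemma trivial_route_exists: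
  assumes v: "v \<in> {1..n}" and x: "x = 1 \<or> x = 2" and y: "y = 1 \<or> y = 2"
    and "\<And>j. \<lbrakk>j \<in> {1..N}; ehead j = v\<rbrakk> \<Longrightarrow> lab (Inner_Edge j) \<noteq> x"
    and "\<And>j. \<lbrakk>j \<in> {1..N}; etail j = v\<rbrakk> \<Longrightarrow> lab (Inner_Edge j) \<noteq> y"
  obtains R where "R \<in> routes G" "trivial_route R v x y"
proof -
  obtain c where c: "Source_Edge v c \<in> arcs G" "lab (Source_Edge v c) = x"
    using source_edge_exists[OF v x assms(4)] .
  obtain c' where c': "Sink_Edge v c' \<in> arcs G" "lab (Sink_Edge v c') = y"
    using sink_edge_exists[OF v y assms(5)] .
  have "[Source_Edge v c, Sink_Edge v c'] \<in> routes G" using c c' by (auto simp: routes_iff)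
  moreover have "trivial_route [Source_Edge v c, Sink_Edge v c'] v x y"
    unfolding trivial_route_def using c c' by blast
  ultimately show ?thesis using that by blast
qed

lemma start_of_group:
  assumes "k \<in> {1..N}"
  obtains i where "is_block i k" "i = 1 \<or> gr (i - 1) \<noteq> gr i"
proof -
  define i where "i = offset (gr k - 1) + 1"
  note b = gr_bounds[OF assms]
  have j: "gr k \<in> {1..length ks}" using b by simp
  have gi: "gr i = gr k" using group_block(2)[OF j] by (simp add: i_def)
  have "is_block i k" using b gi assms by (auto simp: is_block_def i_def)
  moreover have "i = 1 \<or> gr (i - 1) \<noteq> gr i"
  proof (cases "i = 1")
    case False
    have "gr (i - 1) \<le> gr k - 1" by (rule gr_le) (simp add: i_def)
    then have "gr (i - 1) < gr k" using b(1) by linarith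
    then show ?thesis using gi by simp
  qed simp
  ultimately show ?thesis using that by blast
qed

lemma end_of_group:
  assumes "i \<in> {1..N}"
  obtains k where "is_block i k" "k = N \<or> gr (Suc k) \<noteq> gr k"
proof -
  define k where "k = offset (gr i)"
  note b = gr_bounds[OF assms]
  have j: "gr i \<in> {1..length ks}" using b by simp
  have gk: "gr k = gr i" using group_block(3)[OF j] by (simp add: k_def)
  have kN: "k \<le> N" using offset_mono[of "gr i" "length ks"] b offset_length by (simp add: k_def)
  have "is_block i k" using b gk assms kN by (auto simp: is_block_def k_def)
  moreover have "k = N \<or> gr (Suc k) \<noteq> gr k"
  proof (cases "k = N")
    case False
    then have "Suc k \<in> {1..N}" using kN by simp
    from gr_bounds(4)[OF this] show ?thesis using gk by (auto simp: k_def)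
  qed simp
  ultimately show ?thesis using that by blast
qed

end

subsection \<open>The DKK triangulation\<close>

locale framed_polytope = lab_chain +
  fixes e :: "'n::finite \<Rightarrow> dag_vertex"
  assumes bij_e: "bij_betw e UNIV (inner_verts G)"
begin

section \<open>The g-vectors of routes are the points\<close>

definition vertex_no :: "'n \<Rightarrow> nat" where
  "vertex_no i = (THE v. e i = Inner v)"

lemma e_vertex_no: "e i = Inner (vertex_no i)" "vertex_no i \<in> {1..n}"
proof -
  have "e i \<in> Inner ` {1..n}" using bij_e unfolding inner_verts_G by (auto simp: bij_betw_def)
  then obtain v where v: "e i = Inner v" "v \<in> {1..n}" by blast
  then have "vertex_no i = v" by (simp add: vertex_no_def)
  then show "e i = Inner (vertex_no i)" "vertex_no i \<in> {1..n}" using v by simp_all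
qed

lemma bij_vertex_no: "bij_betw vertex_no UNIV {1..n}"
proof (rule bij_betw_imageI)
  show "inj vertex_no"
  proof (rule injI)
    fix i j assume "vertex_no i = vertex_no j"
    then have "e i = e j" using e_vertex_no(1) by simp
    then show "i = j" using bij_e by (auto simp: bij_betw_def dest: injD)
  qed
  show "range vertex_no = {1..n}"
  proof
    show "range vertex_no \<subseteq> {1..n}" using e_vertex_no(2) by blast
    show "{1..n} \<subseteq> range vertex_no"
    proof
      fix v assume "v \<in> {1..n}"
      then have "Inner v \<in> range e" using bij_e unfolding inner_verts_G by (auto simp: bij_betw_def)
      then obtain i where "e i = Inner v" by force
      then have "vertex_no i = v" using e_vertex_no(1)[of i] by simp
      then show "v \<in> range vertex_no" by blast
    qed
  qed
qed

sublocale gv: grouped_edges N n gr nxt vertex_no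
  by unfold_locales (fact bij_vertex_no N_le nxt_in inj_nxt nxt_neq)+

lemma block_eq: "gv.block = is_block"
  by (intro ext) (simp add: gv.block_def is_block_def)

abbreviation g :: "dag_edge awalk \<Rightarrow> real ^ 'n" where "g \<equiv> g_vector G lab e"

lemma vec_eqI: "(\<And>w. w \<in> {1..n} \<Longrightarrow> gv.co x w = gv.co y w) \<Longrightarrow> x = y"
proof -
  assume eq: "\<And>w. w \<in> {1..n} \<Longrightarrow> gv.co x w = gv.co y w"
  have "x $ i = y $ i" for i
  proof -
    have "inv_into UNIV vertex_no (vertex_no i) = i"
      using bij_vertex_no by (intro inv_into_f_f) (auto simp: bij_betw_def)
    then show ?thesis using eq[OF e_vertex_no(2)[of i]] by (simp add: gv.co_def)
  qed
  then show "x = y" by (simp add: vec_eq_iff)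
qed

lemma co_g:
  assumes "w \<in> {1..n}"
  shows "gv.co (g R) w = (if traverses G lab R (Inner w) 1 2 then -1
     else if traverses G lab R (Inner w) 2 1 then 1 else 0)"
proof -
  have "e (inv_into UNIV vertex_no w) = Inner w"
    using e_vertex_no(1)[of "inv_into UNIV vertex_no w"] gv.inv_\<nu>[OF assms] by simp
  then show ?thesis by (simp add: gv.co_def g_vector_def)
qed

lemma block_route_ends:
  assumes "block_route R i k T H"
  shows "i \<in> {1..n}" "nxt k \<in> {1..n}" "nxt k \<noteq> i"
  using assms gv.blockD(1-3)[of i k] unfolding block_eq block_route_def by blast+

lemma co_block:
  assumes R: "block_route R i k T H" and w: "w \<in> {1..n}"
  shows "gv.co (g R) w = (if T \<and> w = i then -1 else if H \<and> w = nxt k then 1 else 0)"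
  unfolding co_g[OF w] block_route_traverses[OF R] by (rule refl)

lemma co_trivial:
  assumes R: "trivial_route R v x y" and w: "w \<in> {1..n}"
  shows "gv.co (g R) w = (if w = v \<and> 1 = x \<and> 2 = y then -1 else if w = v \<and> 2 = x \<and> 1 = y then 1 else 0)"
  unfolding co_g[OF w] trivial_route_traverses[OF R] by (rule refl)

lemma g_block:
  assumes R: "block_route R i k T H"
  shows "g R = (if H then gv.unit_vec (nxt k) else 0) - (if T then gv.unit_vec i else 0)"
proof (rule vec_eqI)
  fix w assume w: "w \<in> {1..n}"
  note b = block_route_ends[OF R]
  show "gv.co (g R) w = gv.co ((if H then gv.unit_vec (nxt k) else 0) - (if T then gv.unit_vec i else 0)) w"
    unfolding co_block[OF R w] using b w by (cases H; cases T) (auto simp: gv.co_unit)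
qed

lemma trivial_route_vertex: "trivial_route R v x y \<Longrightarrow> v \<in> {1..n}"
  unfolding trivial_route_def using arcs_G_vertex by blast

lemma g_trivial:
  assumes R: "trivial_route R v x y"
  shows "g R = (if x = 1 \<and> y = 2 then - gv.unit_vec v else if x = 2 \<and> y = 1 then gv.unit_vec v else 0)"
proof (rule vec_eqI)
  fix w assume w: "w \<in> {1..n}"
  show "gv.co (g R) w = gv.co (if x = 1 \<and> y = 2 then - gv.unit_vec v
      else if x = 2 \<and> y = 1 then gv.unit_vec v else 0) w"
    unfolding co_trivial[OF R w] using trivial_route_vertex[OF R] w by (auto simp: gv.co_unit)
qed

lemma g_in_points: "R \<in> routes G \<Longrightarrow> g R \<in> gv.points"
proof (erule route_cases)
  fix v x y assume R: "trivial_route R v x y"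
  show ?thesis using gv.in_points trivial_route_vertex[OF R] by (simp add: g_trivial[OF R])
next
  fix i k T H assume R: "block_route R i k T H"
  have "gv.block i k" using R unfolding block_eq block_route_def by blast
  then show ?thesis
    using gv.in_points block_route_ends[OF R] by (cases H; cases T) (simp_all add: g_block[OF R])
qed

text \<open>An end without a sign is moved to the end of its group, where the framing permits it. A
  single sign at a vertex that is not the lower, or not the upper, end of any edge is realised by a
  trivial route.\<close>

lemma points_subset_g: "gv.points \<subseteq> g ` routes G"
proof
  fix x assume "x \<in> gv.points"
  then show "x \<in> g ` routes G"
  proof (cases rule: gv.points_cases)
    case 1
    have "1 \<in> {1..N}" using N_pos by simp
    then obtain k where k: "is_block 1 k" "k = N \<or> gr (Suc k) \<noteq> gr k" using end_of_group by blast
    obtain R where R: "R \<in> routes G" "block_route R 1 k False False"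
      using block_route_exists[of 1 k False False] k by auto
    have "g R = x" using 1 by (simp add: g_block[OF R(2)])
    then show ?thesis using R(1) by blast
  next
    case (2 v)
    have "\<exists>R\<in>routes G. g R = - gv.unit_vec v"
    proof (cases "v \<in> {1..N}")
      case True
      then obtain k where k: "is_block v k" "k = N \<or> gr (Suc k) \<noteq> gr k" using end_of_group by blast
      obtain R where R: "R \<in> routes G" "block_route R v k True False"
        using block_route_exists[of v k True False] k by auto
      have "g R = - gv.unit_vec v" by (simp add: g_block[OF R(2)])
      then show ?thesis using R(1) by blast
    next
      case False
      \<comment> \<open>An inner edge at this \<open>v\<close> has it as upper end, so it enters
        with label 2 or leaves with label 1; the labels of the trivial route are free.\<close>
      have "lab (Inner_Edge j) \<noteq> 1" if "j \<in> {1..N}" "ehead j = v" for j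
        using that False lab_inner[OF that(1)]
          by (cases "odd (gr j)") (auto simp: alternating_head_def)
      moreover have "lab (Inner_Edge j) \<noteq> 2" if "j \<in> {1..N}" "etail j = v" for j
        using that False lab_inner[OF that(1)]
          by (cases "odd (gr j)") (auto simp: alternating_tail_def)
      ultimately obtain R where R: "R \<in> routes G" "trivial_route R v 1 2"
        using trivial_route_exists[of v 1 2] 2 by auto
      have "g R = - gv.unit_vec v" by (simp add: g_trivial[OF R(2)])
      then show ?thesis using R(1) by blast
    qed
    then show ?thesis unfolding 2(2) by (metis imageI)
  next
    case (3 v)
    have "\<exists>R\<in>routes G. g R = gv.unit_vec v"
    proof (cases "v \<in> nxt ` {1..N}")
      case True
      then obtain k where vk: "k \<in> {1..N}" "v = nxt k" by blast
      then obtain i where i: "is_block i k" "i = 1 \<or> gr (i - 1) \<noteq> gr i" using start_of_group by blast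
      obtain R where R: "R \<in> routes G" "block_route R i k False True"
        using block_route_exists[of i k False True] i by auto
      have "g R = gv.unit_vec v" by (simp add: g_block[OF R(2)] vk)
      then show ?thesis using R(1) by blast
    next
      case False
      \<comment> \<open>Here \<open>v\<close> can only be the lower end of an inner edge, which
        enters with label 1 or leaves with label 2.\<close>
      have "lab (Inner_Edge j) \<noteq> 2" if "j \<in> {1..N}" "ehead j = v" for j
        using that False lab_inner[OF that(1)]
          by (cases "odd (gr j)") (auto simp: alternating_head_def)
      moreover have "lab (Inner_Edge j) \<noteq> 1" if "j \<in> {1..N}" "etail j = v" for j
        using that False lab_inner[OF that(1)]
          by (cases "odd (gr j)") (auto simp: alternating_tail_def)
      ultimately obtain R where R: "R \<in> routes G" "trivial_route R v 2 1"
        using trivial_route_exists[of v 2 1] 3 by auto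
      have "g R = gv.unit_vec v" by (simp add: g_trivial[OF R(2)])
      then show ?thesis using R(1) by blast
    qed
    then show ?thesis unfolding 3(2) by (metis imageI)
  next
    case (4 i k)
    obtain R where R: "R \<in> routes G" "block_route R i k True True"
      using block_route_exists[of i k True True] 4 unfolding block_eq by auto
    have "g R = x" using 4 by (simp add: g_block[OF R(2)])
    then show ?thesis using R(1) by blast
  qed
qed

lemma g_routes: "g ` routes G = gv.points"
  using g_in_points points_subset_g by blast

lemma co_g_tail:
  "w \<in> {1..n} \<Longrightarrow> gv.co (g R) w = -1 \<longleftrightarrow> traverses G lab R (Inner w) 1 2"
  by (simp add: co_g)

lemma co_g_head:
  assumes "R \<in> routes G" "w \<in> {1..n}"
  shows "gv.co (g R) w = 1 \<longleftrightarrow> traverses G lab R (Inner w) 2 1"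
  using assms(1)
proof (rule route_cases)
  fix v x y assume R: "trivial_route R v x y"
  show ?thesis unfolding co_trivial[OF R assms(2)] trivial_route_traverses[OF R] by auto
next
  fix i k T H assume R: "block_route R i k T H"
  show ?thesis
    unfolding co_block[OF R assms(2)] block_route_traverses[OF R] using block_route_ends(3)[OF R] by auto
qed

section \<open>Conflicts read off from g-vectors\<close>

definition nested_conf :: "real ^ 'n \<Rightarrow> real ^ 'n \<Rightarrow> bool" where
  "nested_conf x y \<longleftrightarrow> (\<exists>a k. is_block a k \<and> gv.co x a = -1 \<and> gv.co y (nxt k) = 1 \<and>
     (\<forall>k'. is_block a k' \<and> gv.co x (nxt k') = 1 \<longrightarrow> k < k') \<and>
     (\<forall>a'. is_block a' k \<and> gv.co y a' = -1 \<longrightarrow> a' < a))"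

lemma conf_iff: "gv.conf x y \<longleftrightarrow> (\<exists>w\<in>{1..n}. gv.co x w = -1 \<and> gv.co y w = 1) \<or> nested_conf x y"
proof
  assume "gv.conf x y"
  then show "(\<exists>w\<in>{1..n}. gv.co x w = -1 \<and> gv.co y w = 1) \<or> nested_conf x y"
    unfolding gv.conf_def nested_conf_def block_eq by blast
next
  assume "(\<exists>w\<in>{1..n}. gv.co x w = -1 \<and> gv.co y w = 1) \<or> nested_conf x y"
  then show "gv.conf x y"
  proof
    assume "nested_conf x y"
    then obtain a k where ak: "is_block a k" "gv.co x a = -1" "gv.co y (nxt k) = 1"
      "\<forall>k'. is_block a k' \<and> gv.co x (nxt k') = 1 \<longrightarrow> k < k'"
      "\<forall>a'. is_block a' k \<and> gv.co y a' = -1 \<longrightarrow> a' < a"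
      unfolding nested_conf_def by blast
    have "a \<in> {1..n}" "nxt k \<in> {1..n}" using gv.blockD(1,2)[of a k] ak(1) unfolding block_eq by blast+
    then show ?thesis unfolding gv.conf_def block_eq using ak by blast
  qed (auto simp: gv.conf_def)
qed

text \<open>An end with a sign is visible in the g-vector. An end without one is an end of its group
  by \<open>block_route_start\<close> or \<open>block_route_end\<close>, which matches the vacuous
  conditions in \<open>nested_conf\<close>. Trivial routes have no factor with edges, and their sign
  never sits where a block of the required kind begins or ends.\<close>

lemma nested_conf_iff_factor:
  assumes "R \<in> routes G" "S \<in> routes G"
  shows "nested_conf (g R) (g S) \<longleftrightarrow> (\<exists>m. m \<noteq> [] \<and> factor R m 1 2 \<and> factor S m 2 1)"
  using assms(1)
proof (rule route_cases)
  fix v x y assume R: "trivial_route R v x y"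
  have "\<not> nested_conf (g R) (g S)"
  proof
    assume "nested_conf (g R) (g S)"
    then obtain a k where ak: "is_block a k" "gv.co (g R) a = -1" unfolding nested_conf_def by blast
    have "a \<in> {1..n}" using gv.blockD(1)[of a k] ak(1) unfolding block_eq by blast
    then have "a = v" "x = 1" "y = 2" using ak(2) co_trivial[OF R, of a] by (auto split: if_splits)
    then show False using trivial_tail_no_block R ak(1) by blast
  qed
  then show ?thesis using trivial_route_factor[OF R] by blast
next
  fix i k T H assume R: "block_route R i k T H"
  show ?thesis using assms(2)
  proof (rule route_cases)
    fix v x y assume S: "trivial_route S v x y"
    have "\<not> nested_conf (g R) (g S)"
    proof
      assume "nested_conf (g R) (g S)"
      then obtain a k where ak: "is_block a k" "gv.co (g S) (nxt k) = 1" unfolding nested_conf_def by blast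
      have "nxt k \<in> {1..n}" using gv.blockD(2)[of a k] ak(1) unfolding block_eq by blast
      then have "nxt k = v" "x = 2" "y = 1" using ak(2) co_trivial[OF S, of "nxt k"] by (auto split: if_splits)
      then show False using trivial_head_no_block S ak(1) by blast
    qed
    then show ?thesis using trivial_route_factor[OF S] by blast
  next
    fix i' k' T' H' assume S: "block_route S i' k' T' H'"
    have bR: "is_block i k" and bS: "is_block i' k'" using R S unfolding block_route_def by blast+
    note eR = block_route_ends[OF R] and eS = block_route_ends[OF S]
    have tR: "gv.co (g R) w = -1 \<longleftrightarrow> T \<and> w = i" "gv.co (g R) w = 1 \<longleftrightarrow> H \<and> w = nxt k"
      and tS: "gv.co (g S) w = -1 \<longleftrightarrow> T' \<and> w = i'" "gv.co (g S) w = 1 \<longleftrightarrow> H' \<and> w = nxt k'"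
      if "w \<in> {1..n}" for w
      using eR(3) eS(3) by (auto simp: co_block[OF R that] co_block[OF S that])
    have bn: "a \<in> {1..n}" "nxt l \<in> {1..n}" "l \<in> {1..N}" if "is_block a l" for a l
      using gv.blockD[of a l] that unfolding block_eq by blast+
    have inj: "l = l'" if "nxt l = nxt l'" "l \<in> {1..N}" "l' \<in> {1..N}" for l l'
      using inj_onD[OF inj_nxt that] .
    have "nested_conf (g R) (g S) \<longleftrightarrow>
      T \<and> H' \<and> is_block i k' \<and> (k' < k \<or> k' = k \<and> \<not> H) \<and> (i' < i \<or> i' = i \<and> \<not> T')" (is "?L \<longleftrightarrow> ?R")
    proof
      assume ?L
      then obtain a l where al: "is_block a l" "gv.co (g R) a = -1" "gv.co (g S) (nxt l) = 1"
        "\<And>l'. \<lbrakk>is_block a l'; gv.co (g R) (nxt l') = 1\<rbrakk> \<Longrightarrow> l < l'"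
        "\<And>a'. \<lbrakk>is_block a' l; gv.co (g S) a' = -1\<rbrakk> \<Longrightarrow> a' < a"
        unfolding nested_conf_def by blast
      have T: "T" "a = i" using tR(1)[OF bn(1)[OF al(1)]] al(2) by auto
      have H: "H'" "nxt l = nxt k'" using tS(2)[OF bn(2)[OF al(1)]] al(3) by auto
      have l: "l = k'" by (rule inj[OF H(2) bn(3)[OF al(1)] bn(3)[OF bS]])
      have b: "is_block i k'" using al(1) T l by simp
      have grs: "gr k' = gr i" "gr i = gr i'" using b bS by (auto simp: is_block_def)
      have "k' < k \<or> k' = k \<and> \<not> H"
      proof (cases H)
        case True
        have "gv.co (g R) (nxt k) = 1" using tR(2)[OF eR(2)] True by simp
        then show ?thesis using al(4)[of k] bR T l by simp
      next
        case False
        then show ?thesis using block_route_end[OF R False bn(3)[OF bS] grs(1)] by auto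
      qed
      moreover have "i' < i \<or> i' = i \<and> \<not> T'"
      proof (cases T')
        case True
        have "gv.co (g S) i' = -1" using tS(1)[OF eS(1)] True by simp
        then show ?thesis using al(5)[of i'] bS T l by simp
      next
        case False
        have "i \<in> {1..N}" using bR by (auto simp: is_block_def)
        then show ?thesis using block_route_start[OF S False _ grs(2)] False by auto
      qed
      ultimately show ?R using T H b by blast
    next
      assume r: ?R
      have "gv.co (g R) i = -1" using tR(1)[OF eR(1)] r by simp
      moreover have "gv.co (g S) (nxt k') = 1" using tS(2)[OF eS(2)] r by simp
      moreover have "k' < l" if l: "is_block i l" "gv.co (g R) (nxt l) = 1" for l
      proof -
        have h: "H" "nxt l = nxt k" using tR(2)[OF bn(2)[OF l(1)]] l(2) by auto
        have "l = k" by (rule inj[OF h(2) bn(3)[OF l(1)] bn(3)[OF bR]])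
        then show ?thesis using r h by blast
      qed
      moreover have "a < i" if a: "is_block a k'" "gv.co (g S) a = -1" for a
      proof -
        have "T'" "a = i'" using tS(1)[OF bn(1)[OF a(1)]] a(2) by auto
        then show ?thesis using r by blast
      qed
      ultimately show ?L unfolding nested_conf_def using r by blast
    qed
    then show ?thesis unfolding block_routes_common_factor[OF R S] .
  qed
qed

lemma crosses_iff_conf:
  assumes "R \<in> routes G" "S \<in> routes G"
  shows "crosses R S \<longleftrightarrow> gv.conf (g R) (g S)"
proof -
  have "(\<exists>w\<in>{1..n}. traverses G lab R (Inner w) 1 2 \<and> traverses G lab S (Inner w) 2 1) \<longleftrightarrow>
      (\<exists>w\<in>{1..n}. gv.co (g R) w = -1 \<and> gv.co (g S) w = 1)"
    using co_g_tail co_g_head[OF assms(2)] by blast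
  then show ?thesis
    unfolding crosses_def conf_iff nested_conf_iff_factor[OF assms] by blast
qed

lemma coherent_iff:
  "\<lbrakk>R \<in> routes G; S \<in> routes G\<rbrakk> \<Longrightarrow> coherent G lab R S \<longleftrightarrow> \<not> gv.incoherent (g R) (g S)"
  using coherent_iff_crosses crosses_iff_conf unfolding gv.incoherent_def by blast

lemma clique_iff: "clique G lab M \<longleftrightarrow> M \<subseteq> routes G \<and> gv.coherent_set (g ` M)"
proof (cases "M \<subseteq> routes G")
  case True
  then have "g ` M \<subseteq> gv.points" using g_routes by blast
  moreover have "coherent G lab R S \<longleftrightarrow> \<not> gv.incoherent (g R) (g S)" if "R \<in> M" "S \<in> M" for R S
    using coherent_iff[of R S] True that by blast
  ultimately show ?thesis using True unfolding clique_def gv.coherent_set_def by blast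
qed (simp add: clique_def)

section \<open>Maximal cliques and maximal coherent sets of points\<close>

lemma image_routes_with: "K \<subseteq> gv.points \<Longrightarrow> g ` {R \<in> routes G. g R \<in> K} = K"
  unfolding g_routes[symmetric] by auto

lemma clique_image_subset: "clique G lab M \<Longrightarrow> g ` M \<subseteq> gv.points"
  unfolding clique_iff gv.coherent_set_def by simp

lemma maximal_clique_image:
  assumes M: "maximal_clique G lab M"
  shows "gv.maximal_in gv.points (g ` M)"
proof -
  have cl: "clique G lab M" using M by (simp add: maximal_clique_def)
  have "K = g ` M" if K: "gv.coherent_set K" "K \<subseteq> gv.points" "g ` M \<subseteq> K" for K
  proof -
    let ?M' = "{R \<in> routes G. g R \<in> K}"
    have "clique G lab ?M'" unfolding clique_iff image_routes_with[OF K(2)] using K(1) by auto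
    moreover have "M \<subseteq> ?M'" using cl K(3) by (auto simp: clique_def)
    ultimately have "?M' = M" using M by (simp add: maximal_clique_def)
    then show ?thesis using image_routes_with[OF K(2)] by simp
  qed
  then show ?thesis
    using cl clique_image_subset[OF cl] by (simp add: gv.maximal_in_def clique_iff)
qed

text \<open>Several routes may share a g-vector, and coherence does not distinguish them; a maximal
  clique therefore takes all routes over \<open>K\<close>.\<close>

lemma maximal_clique_preimage:
  assumes K: "gv.maximal_in gv.points K"
  shows "maximal_clique G lab {R \<in> routes G. g R \<in> K}" (is "maximal_clique G lab ?M")
proof -
  have cN: "gv.coherent_set K" "K \<subseteq> gv.points" using K by (simp_all add: gv.maximal_in_def)
  note gM = image_routes_with[OF cN(2)]
  have "M' = ?M" if M': "clique G lab M'" "?M \<subseteq> M'" for M'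
  proof -
    have "K \<subseteq> g ` M'" using image_mono[OF M'(2), of g] unfolding gM .
    then have "g ` M' = K"
      using K M'(1) clique_image_subset[OF M'(1)] by (simp add: gv.maximal_in_def clique_iff)
    then have "M' \<subseteq> ?M" using M'(1) by (auto simp: clique_def)
    then show ?thesis using M'(2) by (rule subset_antisym)
  qed
  moreover have "clique G lab ?M" unfolding clique_iff gM using cN(1) by auto
  ultimately show ?thesis by (simp add: maximal_clique_def)
qed

lemma DKK_triangulation_eq:
  "DKK_triangulation G lab e = {convex hull M | M. gv.maximal_in gv.points M}"
proof
  show "DKK_triangulation G lab e \<subseteq> {convex hull M | M. gv.maximal_in gv.points M}"
    unfolding DKK_triangulation_def using maximal_clique_image by fast
  show "{convex hull M | M. gv.maximal_in gv.points M} \<subseteq> DKK_triangulation G lab e"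
  proof
    fix C assume "C \<in> {convex hull M | M. gv.maximal_in gv.points M}"
    then obtain K where C: "C = convex hull K" and K: "gv.maximal_in gv.points K" by fast
    have "C = convex hull (g ` {R \<in> routes G. g R \<in> K})"
      using K unfolding C by (simp add: image_routes_with gv.maximal_in_def)
    then show "C \<in> DKK_triangulation G lab e"
      unfolding DKK_triangulation_def using maximal_clique_preimage[OF K] by fast
  qed
qed

lemma DKK_is_pulling_triangulation:
  "is_pulling_triangulation_of (DKK_triangulation G lab e) (g_polytope G lab e)"
proof -
  have "n \<ge> 1" using N_pos N_le by simp
  then show ?thesis
    unfolding DKK_triangulation_eq g_polytope_def g_routes
    by (intro gv.is_pulling_triangulation gv.aff_dim_points)
qed

end

theorem theorem4p34:
  fixes ks :: "nat list" and G :: dag and lab :: "dag_edge \<Rightarrow> nat"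
    and e :: "'n::finite \<Rightarrow> dag_vertex"
  assumes "ks \<noteq> []" and "\<forall>k \<in> set ks. k > 0"
    and "G = Path_dag ks \<or> even (length ks) \<and> G = Cycle_dag ks"
    and "lab_framing G lab"
    and "bij_betw e UNIV (inner_verts G)"
  shows "is_pulling_triangulation_of (DKK_triangulation G lab e) (g_polytope G lab e)"
  using assms(3)
proof
  assume G: "G = Path_dag ks"
  interpret c: chain_dag ks "sum_list ks + 1" "\<lambda>i. i + 1"
    by unfold_locales (use assms in auto)
  have cG: "c.G = G" unfolding c.G_def G Path_dag_def ..
  interpret framed_polytope ks "sum_list ks + 1" "\<lambda>i. i + 1" lab e
    by unfold_locales (use assms cG in auto)
  show ?thesis using DKK_is_pulling_triangulation unfolding cG .
next
  assume G: "even (length ks) \<and> G = Cycle_dag ks"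
  interpret c: chain_dag ks "sum_list ks" "\<lambda>i. if i = sum_list ks then 1 else i + 1"
    by unfold_locales (use assms G in auto)
  have cG: "c.G = G" unfolding c.G_def Cycle_dag_def Let_def using G by (simp add: Cycle_dag_def Let_def)
  interpret framed_polytope ks "sum_list ks" "\<lambda>i. if i = sum_list ks then 1 else i + 1" lab e
    by unfold_locales (use assms cG in auto)
  show ?thesis using DKK_is_pulling_triangulation unfolding cG .
qed

end
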